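(* Let $\Omega\subset\mathbb{R}^d$ be a nonempty, bounded, uniform and open set, let $0<s<1$, $1\le p<\infty$ and $0\le\alpha,\beta<\underline{\mathrm{co\,dim}}_A(\partial\Omega)$. If $sp+\alpha+\beta>\overline{\mathrm{co\,dim}}_A(\partial\Omega)$, then $$W_0^{s,p;\,\alpha,\beta}(\Omega)=\left\{f\in W^{s,p;\,\alpha,\beta}(\Omega):\int_\Omega\frac{|f(x)|^p}{d_\Omega(x)^{sp+\alpha+\beta}}\,dx<\infty\right\}.$$
   Context: Notation: $d_\Omega(x)=\mathrm{dist}(x,\partial\Omega)$; for $E\subset\mathbb{R}^d$ and $r>0$, $\widetilde E_r=\{x\in\mathbb{R}^d:\mathrm{dist}(x,E)\le r\}$. Spaces: $[f]_{W^{s,p;\,\alpha,\beta}(\Omega)}=\left(\int_\Omega\int_\Omega\frac{|f(x)-f(y)|^p}{|x-y|^{d+sp}}d_\Omega(y)^{-\alpha}d_\Omega(x)^{-\beta}\,dy\,dx\right)^{1/p}$ (symmetric under interchanging $\alpha$ and $\beta$); $W^{s,p;\,\alpha,\beta}(\Omega)=\{f\in L^p(\Omega):[f]_{W^{s,p;\,\alpha,\beta}(\Omega)}<\infty\}$ with norm $\|f\|_{L^p(\Omega)}+[f]_{W^{s,p;\,\alpha,\beta}(\Omega)}$. $W_0^{s,p;\,\alpha,\beta}(\Omega)$ is the closure of $C_c^\infty(\Omega)\cap W^{s,p;\,\alpha,\beta}(\Omega)$ in $W^{s,p;\,\alpha,\beta}(\Omega)$ with respect to this norm, where $C_c^\infty(\Omega)$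 denotes smooth functions with compact support in $\Omega$. Uniform: a domain (connected open set) $\Omega\subset\mathbb{R}^d$ is uniform if there is a constant $C\ge1$ such that all $x,y\in\Omega$ can be joined by a curve $\gamma:[0,l]\to\Omega$, parameterized by arc length, with $l\le C|x-y|$ and $\mathrm{dist}(z,\partial\Omega)\ge\frac1C\min\{|z-x|,|z-y|\}$ for all $z\in\gamma$. Assouad codimensions: $\underline{\mathrm{co\,dim}}_A(E)$ is the supremum of all $q\ge0$ for which there is $C=C(q)\ge1$ with $|\widetilde E_r\cap B(x,R)|\le C|B(x,R)|(r/R)^q$ for all $x\in E$, $0<r<R<\mathrm{diam}\,E$. $\overline{\mathrm{co\,dim}}_A(E)$ is the infimum of all $q\ge0$ for which there is $c=c(q)>0$ with $|\widetilde E_r\cap B(x,R)|\ge c|B(x,R)|(r/R)^q$ for all $x\in E$, $0<r<R<\mathrm{diam}\,E$. *)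

theory Defs
  imports "HOL-Analysis.Analysis"
begin

(* infdist x {} = 0, so this is the usual distance to the boundary only if the frontier
   is nonempty, as it is for bounded nonempty open sets. *)
definition bdist :: "'a::euclidean_space set \<Rightarrow> 'a \<Rightarrow> real" where
  "bdist \<Omega> x = infdist x (frontier \<Omega>)"

section \<open>Weighted fractional Sobolev spaces\<close>

text \<open>
  Elements of a function space on \<open>\<Omega>\<close> are represented by total functions on the ambient space,
  of which only the values on \<open>\<Omega>\<close> matter. The spaces below are sets of representatives; they
  are invariant under changing a function outside \<open>\<Omega>\<close> or on a null set, so that equality of two
  such sets amounts to equality of the corresponding spaces of almost-everywhere classes.
\<close>

definition Lp_space :: "'a::euclidean_space set \<Rightarrow> real \<Rightarrow> ('a \<Rightarrow> real) set" where
  "Lp_space \<Omega> p = {f. f \<in> borel_measurable (lebesgue_on \<Omega>) \<and>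
     (\<integral>\<^sup>+x. ennreal (\<bar>f x\<bar> powr p) \<partial>lebesgue_on \<Omega>) < \<infinity>}"

definition Lp_norm :: "'a::euclidean_space set \<Rightarrow> real \<Rightarrow> ('a \<Rightarrow> real) \<Rightarrow> real" where
  "Lp_norm \<Omega> p f = enn2real (\<integral>\<^sup>+x. ennreal (\<bar>f x\<bar> powr p) \<partial>lebesgue_on \<Omega>) powr (1 / p)"

(* The p-th power of the seminorm. Division by 0 on the diagonal gives the value 0 there. *)
definition gagliardo_energy ::
  "'a::euclidean_space set \<Rightarrow> real \<Rightarrow> real \<Rightarrow> real \<Rightarrow> real \<Rightarrow> ('a \<Rightarrow> real) \<Rightarrow> ennreal" where
  "gagliardo_energy \<Omega> s p \<alpha> \<beta> f =
     (\<integral>\<^sup>+x. (\<integral>\<^sup>+y. ennreal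
        (\<bar>f x - f y\<bar> powr p / norm (x - y) powr (real DIM('a) + s * p)
           * bdist \<Omega> y powr (- \<alpha>) * bdist \<Omega> x powr (- \<beta>))
        \<partial>lebesgue_on \<Omega>) \<partial>lebesgue_on \<Omega>)"

(* As for Lp_norm, meaningful only where the integral is finite (enn2real \<infinity> = 0);
   it is only used on members of the space. *)
definition gagliardo_seminorm ::
  "'a::euclidean_space set \<Rightarrow> real \<Rightarrow> real \<Rightarrow> real \<Rightarrow> real \<Rightarrow> ('a \<Rightarrow> real) \<Rightarrow> real" where
  "gagliardo_seminorm \<Omega> s p \<alpha> \<beta> f = enn2real (gagliardo_energy \<Omega> s p \<alpha> \<beta> f) powr (1 / p)"

definition sobolev ::
  "'a::euclidean_space set \<Rightarrow> real \<Rightarrow> real \<Rightarrow> real \<Rightarrow> real \<Rightarrow> ('a \<Rightarrow> real) set" where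
  "sobolev \<Omega> s p \<alpha> \<beta> = {f \<in> Lp_space \<Omega> p. gagliardo_energy \<Omega> s p \<alpha> \<beta> f < \<infinity>}"

definition sobolev_norm ::
  "'a::euclidean_space set \<Rightarrow> real \<Rightarrow> real \<Rightarrow> real \<Rightarrow> real \<Rightarrow> ('a \<Rightarrow> real) \<Rightarrow> real" where
  "sobolev_norm \<Omega> s p \<alpha> \<beta> f = Lp_norm \<Omega> p f + gagliardo_seminorm \<Omega> s p \<alpha> \<beta> f"

fun Ck :: "nat \<Rightarrow> ('a::euclidean_space \<Rightarrow> real) \<Rightarrow> bool" where
  "Ck 0 f \<longleftrightarrow> continuous_on UNIV f"
| "Ck (Suc k) f \<longleftrightarrow> (\<forall>x. f differentiable (at x)) \<and>
     (\<forall>b\<in>Basis. Ck k (\<lambda>x. frechet_derivative f (at x) b))"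

(* Test functions on \<Omega> are identified with their extensions by zero. *)
definition Cc_infinity :: "'a::euclidean_space set \<Rightarrow> ('a \<Rightarrow> real) set" where
  "Cc_infinity \<Omega> = {\<phi>. (\<forall>k. Ck k \<phi>) \<and>
     compact (closure {x. \<phi> x \<noteq> 0}) \<and> closure {x. \<phi> x \<noteq> 0} \<subseteq> \<Omega>}"

definition sobolev0 ::
  "'a::euclidean_space set \<Rightarrow> real \<Rightarrow> real \<Rightarrow> real \<Rightarrow> real \<Rightarrow> ('a \<Rightarrow> real) set" where
  "sobolev0 \<Omega> s p \<alpha> \<beta> = {f \<in> sobolev \<Omega> s p \<alpha> \<beta>.
     \<forall>\<epsilon>>0. \<exists>\<phi>\<in>Cc_infinity \<Omega> \<inter> sobolev \<Omega> s p \<alpha> \<beta>.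
       sobolev_norm \<Omega> s p \<alpha> \<beta> (\<lambda>x. f x - \<phi> x) < \<epsilon>}"

section \<open>Uniform domains\<close>

definition curve_length :: "(real \<Rightarrow> 'a::metric_space) \<Rightarrow> real \<Rightarrow> real \<Rightarrow> ennreal" where
  "curve_length \<gamma> a b =
     (SUP (n, t) \<in> {(n::nat, t). t 0 = a \<and> t n = b \<and> (\<forall>i<n. t i \<le> t (Suc i))}.
        \<Sum>i<n. ennreal (dist (\<gamma> (t i)) (\<gamma> (t (Suc i)))))"

definition arc_length_parameterized :: "(real \<Rightarrow> 'a::metric_space) \<Rightarrow> real \<Rightarrow> bool" where
  "arc_length_parameterized \<gamma> l \<longleftrightarrow>
     continuous_on {0..l} \<gamma> \<and> (\<forall>u\<in>{0..l}. curve_length \<gamma> 0 u = ennreal u)"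

definition uniform_domain :: "'a::euclidean_space set \<Rightarrow> bool" where
  "uniform_domain \<Omega> \<longleftrightarrow> open \<Omega> \<and> connected \<Omega> \<and>
     (\<exists>C\<ge>1. \<forall>x\<in>\<Omega>. \<forall>y\<in>\<Omega>. \<exists>l\<ge>0. \<exists>\<gamma>.
        arc_length_parameterized \<gamma> l \<and> \<gamma> ` {0..l} \<subseteq> \<Omega> \<and> \<gamma> 0 = x \<and> \<gamma> l = y \<and>
        l \<le> C * norm (x - y) \<and>
        (\<forall>z\<in>\<gamma> ` {0..l}. bdist \<Omega> z \<ge> 1 / C * min (norm (z - x)) (norm (z - y))))"

section \<open>Assouad codimensions\<close>

definition closed_nbhd :: "'a::euclidean_space set \<Rightarrow> real \<Rightarrow> 'a set" where
  "closed_nbhd E r = {x. infdist x E \<le> r}"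

(* Intended for bounded E, since diameter is not meaningful for unbounded sets. The values are
   extended reals so that no boundedness or nonemptiness of the sets of exponents is needed. *)
definition lower_assouad_codim :: "'a::euclidean_space set \<Rightarrow> ereal" where
  "lower_assouad_codim E = (SUP q \<in> {q::real. q \<ge> 0 \<and>
     (\<exists>C\<ge>1. \<forall>x\<in>E. \<forall>r R. 0 < r \<and> r < R \<and> R < diameter E \<longrightarrow>
        measure lebesgue (closed_nbhd E r \<inter> ball x R)
          \<le> C * measure lebesgue (ball x R) * (r / R) powr q)}. ereal q)"

definition upper_assouad_codim :: "'a::euclidean_space set \<Rightarrow> ereal" where
  "upper_assouad_codim E = (INF q \<in> {q::real. q \<ge> 0 \<and>
     (\<exists>c>0. \<forall>x\<in>E. \<forall>r R. 0 < r \<and> r < R \<and> R < diameter E \<longrightarrow>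
        measure lebesgue (closed_nbhd E r \<inter> ball x R)
          \<ge> c * measure lebesgue (ball x R) * (r / R) powr q)}. ereal q)"

end

theory Submission
  imports Defs "HOL-Probability.Probability_Measure"
begin

text \<open>
  For a compactly supported test function \<open>\<phi>\<close> put \<open>\<sigma> = s p + \<alpha> + \<beta>\<close>. Fix \<open>q < \<sigma>\<close> admissible for the
  upper codimension. By the corkscrew property of a uniform domain, the points \<open>y\<close> at distance about
  \<open>\<rho> d(x)\<close> from the boundary and within distance \<open>5 d(x)\<close> of \<open>x\<close> have measure at least
  \<open>c \<rho>\<^sup>q d(x)\<^sup>N\<close>. Averaging \<open>|\<phi>(x)|\<^sup>p \<le> 2\<^sup>p (|\<phi>(y)|\<^sup>p + |\<phi>(x) - \<phi>(y)|\<^sup>p)\<close> over these \<open>y\<close> and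
  integrating against \<open>d(x)\<close> to the power \<open>-\<sigma>\<close> bounds the Hardy integral of \<open>\<phi>\<close> by a constant times \<open>\<rho>\<close> to the
  power \<open>\<sigma> - q\<close> times itself plus the energy of \<open>\<phi>\<close>; for small \<open>\<rho>\<close> the first term is absorbed. This
  Hardy inequality passes to limits in \<open>W\<^sub>0\<close>.

  Conversely, if the Hardy integral of \<open>f\<close> is finite, then \<open>f\<close> is the limit of its cut-offs away from the
  boundary by dominated convergence; the commutator with the cut-off is controlled because
  \<open>\<alpha>\<close> lies below the lower codimension, which makes integrals of \<open>d\<close> to the power \<open>-\<alpha>\<close> over balls of
  radius \<open>r\<close> scale like \<open>r\<close> to the power \<open>N - \<alpha>\<close>. The cut-offs are then mollified: near the diagonal the energy
  of a mollification is at most that of the function by Jensen's inequality, and away from the diagonal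
  convergence in \<open>L\<^sup>p\<close> suffices.
\<close>

section \<open>Integration\<close>

text \<open>The upper codimension measures neighbourhoods of the boundary in the whole space,
  whereas the energy sees only points of the domain; uniformity serves to move that mass inside.
  Absorption subtracts a part of the Hardy integral from itself, so the integral must be finite
  beforehand; for a test function it is, because the support stays away from the boundary. The norm
  of the closure gives no direct control of the Hardy integral of a difference. The limit is
  therefore taken on the sets where the distance is at least 1/(n+1), with a bound independent of n.
  In the converse direction the weights are not translation invariant, so Jensen's inequality does
  not apply to the weighted energy itself. Instead, functions supported away from the boundary are
  compared with an unweighted energy in a strip around the diagonal. The width of the strip is fixed
  before the mollification radius, because the constant for the remaining part blows up as the width
  shrinks.\<close>

lemma term_le_suminf:
  fixes f :: "nat \<Rightarrow> ennreal"
  shows "f k \<le> suminf f"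
proof -
  have "sum f {k} \<le> suminf f" by (rule sum_le_suminf) auto
  then show ?thesis by simp
qed

text \<open>On the band between \<open>\<rho> k / 2\<close> and \<open>\<rho> k\<close> the
  integrand is comparable to \<open>\<rho> k powr - \<gamma>\<close>, with a loss of at most
  \<open>2 powr \<bar>\<gamma>\<bar>\<close> for either sign of \<gamma>. The bands have to cover
  but not to be disjoint, since each is estimated by a whole sublevel set. Abstract radii serve
  shrinking and growing scales alike.\<close>

lemma nn_integral_powr_dyadic:
  fixes g :: "'b \<Rightarrow> real" and \<rho> :: "nat \<Rightarrow> real"
  assumes [measurable]: "g \<in> borel_measurable M" "S \<in> sets M"
    and cover: "\<And>x. x \<in> S \<Longrightarrow> \<exists>k. \<rho> k / 2 \<le> g x \<and> g x \<le> \<rho> k"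
    and pos: "\<And>k. 0 < \<rho> k" and A: "0 \<le> A"
    and meas: "\<And>k. emeasure M {x\<in>S. g x \<le> \<rho> k} \<le> ennreal (A * \<rho> k powr m)"
    and summ: "summable (\<lambda>k. \<rho> k powr (m - \<gamma>))"
  shows "(\<integral>\<^sup>+x\<in>S. ennreal (g x powr - \<gamma>) \<partial>M) \<le> ennreal (2 powr \<bar>\<gamma>\<bar> * A * (\<Sum>k. \<rho> k powr (m - \<gamma>)))"
proof -
  define T where "T k = {x\<in>S. g x \<le> \<rho> k}" for k
  have T[measurable]: "T k \<in> sets M" for k
  proof -
    have "T k = S \<inter> {x\<in>space M. g x \<le> \<rho> k}"
      using sets.sets_into_space[OF assms(2)] by (auto simp: T_def)
    then show ?thesis by simp
  qed
  have pw: "g x powr - \<gamma> \<le> 2 powr \<bar>\<gamma>\<bar> * \<rho> k powr - \<gamma>"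
    if "\<rho> k / 2 \<le> g x" "g x \<le> \<rho> k" for x k
  proof (cases "\<gamma> \<ge> 0")
    case True
    have "g x powr - \<gamma> \<le> (\<rho> k / 2) powr - \<gamma>"
      using that True pos[of k] by (intro powr_mono2') auto
    also have "\<dots> = 2 powr \<bar>\<gamma>\<bar> * \<rho> k powr - \<gamma>"
      using True pos[of k] by (simp add: powr_divide powr_minus field_simps)
    finally show ?thesis .
  next
    case False
    have "g x powr - \<gamma> \<le> \<rho> k powr - \<gamma>"
      using that False pos[of k] by (intro powr_mono2) auto
    also have "\<dots> \<le> 2 powr \<bar>\<gamma>\<bar> * \<rho> k powr - \<gamma>"
      by (simp add: mult_le_cancel_right1 ge_one_powr_ge_zero)
    finally show ?thesis .
  qed
  have "(\<integral>\<^sup>+x\<in>S. ennreal (g x powr - \<gamma>) \<partial>M)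
      \<le> (\<integral>\<^sup>+x. (\<Sum>k. ennreal (2 powr \<bar>\<gamma>\<bar> * \<rho> k powr - \<gamma>) * indicator (T k) x) \<partial>M)"
  proof (rule nn_integral_mono)
    fix x
    show "ennreal (g x powr - \<gamma>) * indicator S x
      \<le> (\<Sum>k. ennreal (2 powr \<bar>\<gamma>\<bar> * \<rho> k powr - \<gamma>) * indicator (T k) x)"
    proof (cases "x \<in> S")
      case True
      then obtain k where k: "\<rho> k / 2 \<le> g x" "g x \<le> \<rho> k" using cover by blast
      have "ennreal (g x powr - \<gamma>) \<le> ennreal (2 powr \<bar>\<gamma>\<bar> * \<rho> k powr - \<gamma>) * indicator (T k) x"
        using pw[OF k] k True by (auto simp: T_def intro: ennreal_leI)
      also have "\<dots> \<le> (\<Sum>k. ennreal (2 powr \<bar>\<gamma>\<bar> * \<rho> k powr - \<gamma>) * indicator (T k) x)"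
        by (rule term_le_suminf)
      finally show ?thesis using True by simp
    qed simp
  qed
  also have "\<dots> = (\<Sum>k. ennreal (2 powr \<bar>\<gamma>\<bar> * \<rho> k powr - \<gamma>) * emeasure M (T k))"
    by (subst nn_integral_suminf) (auto simp: nn_integral_cmult_indicator)
  also have "\<dots> \<le> (\<Sum>k. ennreal (2 powr \<bar>\<gamma>\<bar> * A * \<rho> k powr (m - \<gamma>)))"
  proof (intro suminf_le summableI)
    fix k
    have "ennreal (2 powr \<bar>\<gamma>\<bar> * \<rho> k powr - \<gamma>) * emeasure M (T k)
        \<le> ennreal (2 powr \<bar>\<gamma>\<bar> * \<rho> k powr - \<gamma>) * ennreal (A * \<rho> k powr m)"
      unfolding T_def by (intro mult_left_mono meas) auto
    also have "\<dots> = ennreal (2 powr \<bar>\<gamma>\<bar> * A * \<rho> k powr (m - \<gamma>))"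
      using A pos[of k] by (simp flip: ennreal_mult add: powr_diff powr_minus field_simps)
    finally show "ennreal (2 powr \<bar>\<gamma>\<bar> * \<rho> k powr - \<gamma>) * emeasure M (T k)
        \<le> ennreal (2 powr \<bar>\<gamma>\<bar> * A * \<rho> k powr (m - \<gamma>))" .
  qed
  also have "\<dots> = ennreal (\<Sum>k. 2 powr \<bar>\<gamma>\<bar> * A * \<rho> k powr (m - \<gamma>))"
    using A summ by (intro suminf_ennreal2) (auto intro: summable_mult)
  also have "(\<Sum>k. 2 powr \<bar>\<gamma>\<bar> * A * \<rho> k powr (m - \<gamma>)) = 2 powr \<bar>\<gamma>\<bar> * A * (\<Sum>k. \<rho> k powr (m - \<gamma>))"
    using summ by (simp add: suminf_mult)
  finally show ?thesis .
qed

text \<open>The radii halve, and \<gamma> < m makes the series geometric with ratio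
  \<open>2 powr (\<gamma> - m)\<close> below 1. Zeros of \<open>g\<close> lie in no band, hence the
  condition \<open>0 < g x\<close>.\<close>

lemma nn_integral_powr_sublevel:
  fixes g :: "'b \<Rightarrow> real"
  assumes [measurable]: "g \<in> borel_measurable M" and A: "0 \<le> A" and R: "0 < R" and m: "\<gamma> < m"
    and meas: "\<And>r. 0 < r \<Longrightarrow> r \<le> R \<Longrightarrow>
      emeasure M {x\<in>space M. 0 < g x \<and> g x \<le> r} \<le> ennreal (A * r powr m)"
  shows "(\<integral>\<^sup>+x\<in>{x\<in>space M. 0 < g x \<and> g x \<le> R}. ennreal (g x powr - \<gamma>) \<partial>M)
    \<le> ennreal (2 powr \<bar>\<gamma>\<bar> / (1 - 2 powr (\<gamma> - m)) * A * R powr (m - \<gamma>))"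
proof -
  define \<rho> :: "nat \<Rightarrow> real" where "\<rho> k = R * (1/2)^k" for k
  have eq: "\<rho> k powr (m - \<gamma>) = R powr (m - \<gamma>) * (2 powr (\<gamma> - m)) ^ k" for k
  proof -
    have "((1/2)^k) powr (m - \<gamma>) = ((1/2) powr (m - \<gamma>)) ^ k"
      by (simp add: powr_powr mult.commute flip: powr_realpow)
    also have "(1/2) powr (m - \<gamma>) = (2::real) powr (\<gamma> - m)"
      by (simp add: powr_divide powr_diff)
    finally show ?thesis using R by (simp add: \<rho>_def powr_mult)
  qed
  have lt: "2 powr (\<gamma> - m) < 1" using m powr_less_mono[of "\<gamma> - m" 0 "2::real"] by simp
  have S: "(\<lambda>k. \<rho> k powr (m - \<gamma>)) sums (R powr (m - \<gamma>) * (1 / (1 - 2 powr (\<gamma> - m))))"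
    unfolding eq using lt by (intro sums_mult geometric_sums) simp
  have "(\<integral>\<^sup>+x\<in>{x\<in>space M. 0 < g x \<and> g x \<le> R}. ennreal (g x powr - \<gamma>) \<partial>M)
    \<le> ennreal (2 powr \<bar>\<gamma>\<bar> * A * (\<Sum>k. \<rho> k powr (m - \<gamma>)))"
  proof (rule nn_integral_powr_dyadic)
    show "summable (\<lambda>k. \<rho> k powr (m - \<gamma>))" using S by (rule sums_summable)
    show "0 < \<rho> k" for k using R by (simp add: \<rho>_def)
    show "emeasure M {x \<in> {x \<in> space M. 0 < g x \<and> g x \<le> R}. g x \<le> \<rho> k} \<le> ennreal (A * \<rho> k powr m)" for k
    proof -
      have "\<rho> k \<le> R" using R power_le_one[of "1/2::real" k] by (simp add: \<rho>_def mult_le_cancel_left1)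
      moreover have "{x \<in> {x \<in> space M. 0 < g x \<and> g x \<le> R}. g x \<le> \<rho> k} =
          {x \<in> space M. 0 < g x \<and> g x \<le> \<rho> k}" using calculation by auto
      ultimately show ?thesis using meas[of "\<rho> k"] R by (simp add: \<rho>_def)
    qed
    fix x assume "x \<in> {x \<in> space M. 0 < g x \<and> g x \<le> R}"
    then have x: "0 < g x" "g x \<le> R" by auto
    \<comment> \<open>The floor places \<open>g x\<close> in the band R / 2^(k+1) < g x \<le> R /
      2^k.\<close>
    define k where "k = nat \<lfloor>log 2 (R / g x)\<rfloor>"
    have "0 \<le> log 2 (R / g x)" using x R by simp
    then have k: "real k \<le> log 2 (R / g x)" "log 2 (R / g x) < real k + 1"
      unfolding k_def by linarith+
    have "2 ^ k \<le> R / g x"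
      using k(1) x R by (simp add: le_log_iff powr_realpow)
    moreover have "R / g x < 2 ^ (Suc k)"
      using k(2) x R powr_realpow[of 2 "Suc k"] by (simp add: log_less_iff add.commute)
    ultimately show "\<exists>k. \<rho> k / 2 \<le> g x \<and> g x \<le> \<rho> k"
      using x by (intro exI[of _ k]) (auto simp: \<rho>_def field_simps)
  qed (use A in auto)
  also have "2 powr \<bar>\<gamma>\<bar> * A * (\<Sum>k. \<rho> k powr (m - \<gamma>)) =
      2 powr \<bar>\<gamma>\<bar> / (1 - 2 powr (\<gamma> - m)) * A * R powr (m - \<gamma>)"
    unfolding sums_unique[OF S, symmetric] by simp
  finally show ?thesis .
qed

text \<open>The mirror image: the radii double, and m < \<gamma> makes the contributions decay. The
  measure is tested only at radii from \<open>R\<close> on, which fits a growth condition that is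
  known only beyond a threshold.\<close>

lemma nn_integral_powr_superlevel:
  fixes g :: "'b \<Rightarrow> real"
  assumes [measurable]: "g \<in> borel_measurable M" and A: "0 \<le> A" and R: "0 < R" and m: "m < \<gamma>"
    and meas: "\<And>r. R \<le> r \<Longrightarrow>
      emeasure M {x\<in>space M. g x \<le> r} \<le> ennreal (A * r powr m)"
  shows "(\<integral>\<^sup>+x\<in>{x\<in>space M. R \<le> g x}. ennreal (g x powr - \<gamma>) \<partial>M)
    \<le> ennreal (2 powr \<bar>\<gamma>\<bar> / (1 - 2 powr (m - \<gamma>)) * A * R powr (m - \<gamma>))"
proof -
  define \<rho> :: "nat \<Rightarrow> real" where "\<rho> k = R * 2^k" for k
  have eq: "\<rho> k powr (m - \<gamma>) = R powr (m - \<gamma>) * (2 powr (m - \<gamma>)) ^ k" for k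
  proof -
    have "(2^k) powr (m - \<gamma>) = ((2::real) powr (m - \<gamma>)) ^ k"
      by (simp add: powr_powr mult.commute flip: powr_realpow)
    then show ?thesis using R by (simp add: \<rho>_def powr_mult)
  qed
  have lt: "2 powr (m - \<gamma>) < 1" using m powr_less_mono[of "m - \<gamma>" 0 "2::real"] by simp
  have S: "(\<lambda>k. \<rho> k powr (m - \<gamma>)) sums (R powr (m - \<gamma>) * (1 / (1 - 2 powr (m - \<gamma>))))"
    unfolding eq using lt by (intro sums_mult geometric_sums) simp
  have "(\<integral>\<^sup>+x\<in>{x\<in>space M. R \<le> g x}. ennreal (g x powr - \<gamma>) \<partial>M)
    \<le> ennreal (2 powr \<bar>\<gamma>\<bar> * A * (\<Sum>k. \<rho> k powr (m - \<gamma>)))"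
  proof (rule nn_integral_powr_dyadic)
    show "summable (\<lambda>k. \<rho> k powr (m - \<gamma>))" using S by (rule sums_summable)
    show "0 < \<rho> k" for k using R by (simp add: \<rho>_def)
    show "emeasure M {x \<in> {x \<in> space M. R \<le> g x}. g x \<le> \<rho> k} \<le> ennreal (A * \<rho> k powr m)" for k
    proof -
      have "R \<le> \<rho> k" using R by (simp add: \<rho>_def mult_le_cancel_left1)
      moreover have "emeasure M {x \<in> {x \<in> space M. R \<le> g x}. g x \<le> \<rho> k} \<le> emeasure M {x \<in> space M. g x \<le> \<rho> k}"
        by (intro emeasure_mono) auto
      ultimately show ?thesis using meas[of "\<rho> k"] order_trans by blast
    qed
    fix x assume "x \<in> {x \<in> space M. R \<le> g x}"
    then have x: "R \<le> g x" by auto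
    define k where "k = nat \<lceil>log 2 (g x / R)\<rceil>"
    have "0 \<le> log 2 (g x / R)" using x R by simp
    then have k: "log 2 (g x / R) \<le> real k" "real k < log 2 (g x / R) + 1"
      unfolding k_def by linarith+
    have "g x / R \<le> 2 ^ k"
      using k(1) x R by (simp add: log_le_iff powr_realpow)
    moreover have "2 ^ k / 2 \<le> g x / R"
    proof -
      have "2 powr real k < 2 powr (log 2 (g x / R) + 1)" using k(2) by (intro powr_less_mono) auto
      then show ?thesis using x R by (simp add: powr_realpow powr_add)
    qed
    ultimately show "\<exists>k. \<rho> k / 2 \<le> g x \<and> g x \<le> \<rho> k"
      using x R by (intro exI[of _ k]) (auto simp: \<rho>_def field_simps)
  qed (use A in auto)
  also have "2 powr \<bar>\<gamma>\<bar> * A * (\<Sum>k. \<rho> k powr (m - \<gamma>)) =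
      2 powr \<bar>\<gamma>\<bar> / (1 - 2 powr (m - \<gamma>)) * A * R powr (m - \<gamma>)"
    unfolding sums_unique[OF S, symmetric] by simp
  finally show ?thesis .
qed

text \<open>Tonelli turns the iterated integrals into integrals over the product, where ordinary
  dominated convergence applies.\<close>

lemma iterated_dominated_convergence_0:
  fixes u :: "nat \<Rightarrow> 'a::euclidean_space \<Rightarrow> 'a \<Rightarrow> ennreal"
  assumes [measurable]: "\<And>i. case_prod (u i) \<in> borel_measurable (lborel \<Otimes>\<^sub>M lborel)"
      "case_prod w \<in> borel_measurable (lborel \<Otimes>\<^sub>M lborel)"
    and le: "\<And>i x y. u i x y \<le> w x y"
    and fin: "(\<integral>\<^sup>+x. \<integral>\<^sup>+y. w x y \<partial>lborel \<partial>lborel) < \<infinity>"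
    and lim: "\<And>x y. (\<lambda>i. u i x y) \<longlonglongrightarrow> 0"
  shows "(\<lambda>i. \<integral>\<^sup>+x. \<integral>\<^sup>+y. u i x y \<partial>lborel \<partial>lborel) \<longlonglongrightarrow> 0"
proof -
  have eq: "(\<integral>\<^sup>+x. \<integral>\<^sup>+y. f x y \<partial>lborel \<partial>lborel) = (\<integral>\<^sup>+z. case_prod f z \<partial>(lborel \<Otimes>\<^sub>M lborel))"
    if "case_prod f \<in> borel_measurable (lborel \<Otimes>\<^sub>M (lborel :: 'a measure))" for f :: "'a \<Rightarrow> 'a \<Rightarrow> ennreal"
    using lborel.nn_integral_fst[OF that] by simp
  have "(\<lambda>i. \<integral>\<^sup>+z. case_prod (u i) z \<partial>(lborel \<Otimes>\<^sub>M lborel)) \<longlonglongrightarrow> (\<integral>\<^sup>+z. 0 \<partial>((lborel :: 'a measure) \<Otimes>\<^sub>M (lborel :: 'a measure)))"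
  proof (intro nn_integral_dominated_convergence[where w = "case_prod w"])
    show "(\<integral>\<^sup>+z. case_prod w z \<partial>(lborel \<Otimes>\<^sub>M lborel)) < \<infinity>"
      using fin by (simp add: eq)
  qed (auto simp: le lim split: prod.splits)
  then show ?thesis by (simp add: eq)
qed

section \<open>Inequalities for p-th powers\<close>

lemma powr_abs_add_le:
  fixes a b :: real
  assumes "1 \<le> p"
  shows "\<bar>a + b\<bar> powr p \<le> 2 powr p * (\<bar>a\<bar> powr p + \<bar>b\<bar> powr p)"
proof -
  have "\<bar>a + b\<bar> powr p \<le> (2 * max \<bar>a\<bar> \<bar>b\<bar>) powr p"
    using assms by (intro powr_mono2) auto
  also have "\<dots> = 2 powr p * (max \<bar>a\<bar> \<bar>b\<bar>) powr p" by (simp add: powr_mult)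
  also have "(max \<bar>a\<bar> \<bar>b\<bar>) powr p \<le> \<bar>a\<bar> powr p + \<bar>b\<bar> powr p" by (simp add: max_def)
  finally show ?thesis by simp
qed

lemma powr_abs_diff_le:
  fixes a b :: real
  assumes "1 \<le> p"
  shows "\<bar>a - b\<bar> powr p \<le> 2 powr p * (\<bar>a\<bar> powr p + \<bar>b\<bar> powr p)"
  using powr_abs_add_le[OF assms, of a "- b"] by simp

lemma convex_on_abs_powr:
  assumes "1 \<le> p"
  shows "convex_on UNIV (\<lambda>t::real. \<bar>t\<bar> powr p)"
proof (rule convex_onI)
  fix t x y :: real assume t: "0 < t" "t < 1"
  have main: "((1 - t) * a + t * b) powr p \<le> (1 - t) * a powr p + t * b powr p" if "a \<ge> 0" "b \<ge> 0" for a b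
  proof -
    have le: "c * (d powr p) \<ge> (c * d) powr p" if "0 < c" "c < 1" for c d :: real
    proof -
      have "c powr p \<le> c powr 1" using that assms by (intro powr_mono') auto
      then show ?thesis using that by (simp add: powr_mult mult_right_mono)
    qed
    \<comment> \<open>\<open>powr_convex\<close> is used at two positive arguments; when one of them
      is 0, the inequality c^p \<le> c for 0 < c < 1 takes over.\<close>
    consider "a = 0" | "b = 0" | "a > 0" "b > 0" using \<open>a \<ge> 0\<close> \<open>b \<ge> 0\<close> by linarith
    then show ?thesis
    proof cases
      case 1 then show ?thesis using le[of t b] t assms by simp
    next
      case 2 then show ?thesis using le[of "1-t" a] t assms by simp
    next
      case 3 then show ?thesis
        using convex_onD[OF powr_convex[OF assms], of t a b] t by simp
    qed
  qed
  have "\<bar>(1 - t) * x + t * y\<bar> powr p \<le> ((1 - t) * \<bar>x\<bar> + t * \<bar>y\<bar>) powr p"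
  proof (intro powr_mono2)
    show "\<bar>(1 - t) * x + t * y\<bar> \<le> (1 - t) * \<bar>x\<bar> + t * \<bar>y\<bar>"
      using t abs_triangle_ineq[of "(1-t)*x" "t*y"] by (simp add: abs_mult)
  qed (use assms in auto)
  also have "\<dots> \<le> (1 - t) * \<bar>x\<bar> powr p + t * \<bar>y\<bar> powr p" by (rule main) auto
  finally show "\<bar>(1 - t) *\<^sub>R x + t *\<^sub>R y\<bar> powr p \<le> (1 - t) * \<bar>x\<bar> powr p + t * \<bar>y\<bar> powr p" by simp
qed simp

text \<open>Jensen's inequality for the probability measure with density \<psi>. An infinite right
  side leaves nothing to show; otherwise its finiteness is the integrability of the p-th power that
  the inequality for expectations asks for.\<close>

lemma jensen_powr:
  fixes \<psi> h :: "'a::euclidean_space \<Rightarrow> real"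
  assumes p: "1 \<le> p" and [measurable]: "\<psi> \<in> borel_measurable borel" "h \<in> borel_measurable borel"
    and nn: "\<And>z. 0 \<le> \<psi> z" and one: "(\<integral>\<^sup>+z. ennreal (\<psi> z) \<partial>lborel) = 1"
    and int: "integrable lborel (\<lambda>z. \<psi> z * h z)"
  shows "ennreal (\<bar>\<integral>z. \<psi> z * h z \<partial>lborel\<bar> powr p) \<le> (\<integral>\<^sup>+z. ennreal (\<psi> z * \<bar>h z\<bar> powr p) \<partial>lborel)"
proof (cases "(\<integral>\<^sup>+z. ennreal (\<psi> z * \<bar>h z\<bar> powr p) \<partial>lborel) = \<infinity>")
  case False
  define M where "M = density lborel (\<lambda>z. ennreal (\<psi> z))"
  have [measurable_cong]: "sets M = sets lborel" by (simp add: M_def)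
  interpret prob_space M
    by (rule prob_spaceI) (simp add: M_def emeasure_density one)
  have i2: "integrable lborel (\<lambda>z. \<psi> z * \<bar>h z\<bar> powr p)"
    using False nn by (intro integrableI_nonneg) (auto simp: top.not_eq_extremum)
  have "\<bar>expectation h\<bar> powr p \<le> expectation (\<lambda>z. \<bar>h z\<bar> powr p)"
    using int i2 nn convex_on_abs_powr[OF p]
    by (intro jensens_inequality[where I = UNIV]) (auto simp: M_def integrable_density)
  then have "\<bar>\<integral>z. \<psi> z * h z \<partial>lborel\<bar> powr p \<le> (\<integral>z. \<psi> z * \<bar>h z\<bar> powr p \<partial>lborel)"
    using nn by (simp add: M_def integral_density)
  then show ?thesis
    using i2 nn by (subst nn_integral_eq_integral) (auto intro: ennreal_leI)
qed simp

section \<open>Smooth functions and mollification\<close>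

lemma Ck_SucI:
  fixes f :: "'a::euclidean_space \<Rightarrow> real"
  assumes "\<And>x. (f has_derivative f' x) (at x)" "\<And>b. b \<in> Basis \<Longrightarrow> Ck k (\<lambda>x. f' x b)"
  shows "Ck (Suc k) f"
proof -
  have "frechet_derivative f (at x) = f' x" for x
    using frechet_derivative_at[OF assms(1)] by simp
  then show ?thesis using assms by (auto simp: differentiable_def)
qed

lemma has_derivative_Ck_Suc:
  assumes "Ck (Suc k) f"
  shows "(f has_derivative frechet_derivative f (at x)) (at x)"
  using assms frechet_derivative_works by auto

lemma Ck_SucD:
  fixes f :: "'a::euclidean_space \<Rightarrow> real"
  shows "Ck (Suc k) f \<Longrightarrow> Ck k f"
proof (induction k arbitrary: f)
  case 0
  then show ?case
    by (auto simp: continuous_on_eq_continuous_at differentiable_imp_continuous_within)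
next
  case (Suc k)
  then show ?case by (auto simp del: Ck.simps(1))
qed

lemma Ck_const [simp]: "Ck k (\<lambda>x::'a::euclidean_space. c)"
proof (induction k arbitrary: c)
  case (Suc k)
  show ?case by (rule Ck_SucI[where f' = "\<lambda>_ _. 0"]) (auto intro: derivative_eq_intros Suc)
qed simp

lemma Ck_inner: "Ck k (\<lambda>x::'a::euclidean_space. x \<bullet> v)"
proof (cases k)
  case (Suc j)
  show ?thesis unfolding Suc
    by (rule Ck_SucI[where f' = "\<lambda>_ h. h \<bullet> v"]) (auto intro!: derivative_eq_intros)
qed (auto intro: continuous_intros)

lemma Ck_add:
  fixes f g :: "'a::euclidean_space \<Rightarrow> real"
  shows "Ck k f \<Longrightarrow> Ck k g \<Longrightarrow> Ck k (\<lambda>x. f x + g x)"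
proof (induction k arbitrary: f g)
  case 0
  then show ?case by (auto intro: continuous_intros)
next
  case (Suc k)
  show ?case
  proof (rule Ck_SucI)
    show "((\<lambda>x. f x + g x) has_derivative
      (\<lambda>h. frechet_derivative f (at x) h + frechet_derivative g (at x) h)) (at x)" for x
      by (intro has_derivative_add has_derivative_Ck_Suc[OF Suc.prems(1)] has_derivative_Ck_Suc[OF Suc.prems(2)])
  qed (use Suc in auto)
qed

lemma Ck_mult:
  fixes f g :: "'a::euclidean_space \<Rightarrow> real"
  shows "Ck k f \<Longrightarrow> Ck k g \<Longrightarrow> Ck k (\<lambda>x. f x * g x)"
proof (induction k arbitrary: f g)
  case 0
  then show ?case by (auto intro: continuous_intros)
next
  case (Suc k)
  show ?case
  proof (rule Ck_SucI)
    show "((\<lambda>x. f x * g x) has_derivative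
      (\<lambda>h. f x * frechet_derivative g (at x) h + frechet_derivative f (at x) h * g x)) (at x)" for x
      by (intro has_derivative_mult has_derivative_Ck_Suc[OF Suc.prems(1)] has_derivative_Ck_Suc[OF Suc.prems(2)])
    show "Ck k (\<lambda>x. f x * frechet_derivative g (at x) b + frechet_derivative f (at x) b * g x)"
      if "b \<in> Basis" for b
      using Suc.prems that by (intro Ck_add Suc.IH Ck_SucD[OF Suc.prems(1)] Ck_SucD[OF Suc.prems(2)]) auto
  qed
qed

text \<open>
  The family is closed under differentiation, \<open>flat_exp n\<close> having derivative
  \<open>- n * flat_exp (n + 1) + flat_exp (n + 2)\<close>, which makes smoothness a plain induction.
\<close>

definition flat_exp :: "nat \<Rightarrow> real \<Rightarrow> real" where
  "flat_exp n t = (if t \<le> 0 then 0 else exp (- (1 / t)) / t ^ n)"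

lemma power_div_fact_le_exp:
  fixes y :: real
  assumes "0 \<le> y"
  shows "y ^ m / fact m \<le> exp y"
proof -
  have "(\<Sum>k\<in>{m}. y ^ k /\<^sub>R fact k) \<le> (\<Sum>k. y ^ k /\<^sub>R fact k)"
    using assms by (intro sum_le_suminf) (auto intro: summable_exp)
  then show ?thesis by (simp add: exp_def field_simps)
qed

text \<open>A single term of the exponential series at 1/t bounds the power 1/t^(n+m), so
  \<open>flat_exp n\<close> vanishes at 0 to any prescribed order \<open>m\<close>.\<close>

lemma flat_exp_le:
  assumes "0 < t"
  shows "flat_exp n t \<le> fact (n + m) * t ^ m"
proof -
  have "(1 / t) ^ (n + m) / fact (n + m) \<le> exp (1 / t)"
    using assms by (intro power_div_fact_le_exp) auto
  then show ?thesis
    using assms by (simp add: flat_exp_def exp_minus field_simps power_add)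
qed

lemma flat_exp_nonneg: "0 \<le> flat_exp n t"
  by (simp add: flat_exp_def)

lemma flat_exp_has_derivative:
  "(flat_exp n has_real_derivative (- real n * flat_exp (Suc n) t + flat_exp (n + 2) t)) (at t)"
proof -
  consider "t < 0" | "t > 0" | "t = 0" by linarith
  then show ?thesis
  proof cases
    case 1
    have "eventually (\<lambda>u. flat_exp n u = 0) (nhds t)"
      using eventually_nhds_in_open[of "{..<0}" t] 1
      by (auto elim!: eventually_mono simp: flat_exp_def)
    then show ?thesis
      using 1 by (subst DERIV_cong_ev[OF refl _ refl, where g = "\<lambda>_. 0"]) (auto simp: flat_exp_def)
  next
    case 2
    have ev: "eventually (\<lambda>u. flat_exp n u = exp (- (1 / u)) / u ^ n) (nhds t)"
      using eventually_nhds_in_open[of "{0<..}" t] 2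
      by (auto elim!: eventually_mono simp: flat_exp_def)
    have "((\<lambda>u. exp (- (1 / u)) / u ^ n) has_real_derivative
        ((exp (- (1 / t)) * (1 / t^2)) * t ^ n - exp (- (1 / t)) * (real n * t ^ (n - 1))) / (t ^ n * t ^ n)) (at t)"
      using 2 by (auto intro!: derivative_eq_intros simp: power2_eq_square)
    moreover have "((exp (- (1 / t)) * (1 / t^2)) * t ^ n - exp (- (1 / t)) * (real n * t ^ (n - 1))) / (t ^ n * t ^ n)
      = - real n * flat_exp (Suc n) t + flat_exp (n + 2) t"
      using 2 by (cases n) (auto simp: flat_exp_def field_simps power2_eq_square power_add)
    ultimately show ?thesis
      by (subst DERIV_cong_ev[OF refl ev refl]) simp
  next
    case 3
    \<comment> \<open>Vanishing to order 2 makes the difference quotient at 0 of order |h| from the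
      right; from the left it is identically 0.\<close>
    have "((\<lambda>h. (flat_exp n (0 + h) - flat_exp n 0) / h) \<longlongrightarrow> 0) (at 0)"
    proof (rule Lim_null_comparison)
      show "\<forall>\<^sub>F h in at 0. norm ((flat_exp n (0 + h) - flat_exp n 0) / h) \<le> fact (n + 2) * \<bar>h\<bar>"
      proof (rule eventuallyI)
        fix h :: real
        show "norm ((flat_exp n (0 + h) - flat_exp n 0) / h) \<le> fact (n + 2) * \<bar>h\<bar>"
        proof (cases "h > 0")
          case True
          have "flat_exp n h / h \<le> fact (n + 2) * h ^ 2 / h"
            using flat_exp_le[OF True, of n 2] True by (intro divide_right_mono) auto
          then show ?thesis using True flat_exp_nonneg[of n h]
            by (simp add: flat_exp_def[of n 0] power2_eq_square)
        qed (simp add: flat_exp_def mult_le_0_iff)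
      qed
    qed (auto intro!: tendsto_eq_intros)
    then show ?thesis using 3 by (simp add: DERIV_def flat_exp_def[of _ 0])
  qed
qed

lemma Ck_flat_exp_ball: "Ck k (\<lambda>x::'a::euclidean_space. flat_exp n (e - x \<bullet> x))"
proof (induction k arbitrary: n)
  case 0
  have "isCont (flat_exp n) t" for t by (rule DERIV_isCont[OF flat_exp_has_derivative])
  then have "continuous_on UNIV (flat_exp n)" by (simp add: continuous_at_imp_continuous_on)
  then show ?case
    by (auto intro!: continuous_on_compose2[of UNIV "flat_exp n"] continuous_intros)
next
  case (Suc k)
  show ?case
  proof (rule Ck_SucI)
    fix x :: 'a
    have "((\<lambda>x. flat_exp n (e - x \<bullet> x)) has_derivative
      (\<lambda>h. (- (h \<bullet> x + x \<bullet> h)) * (- real n * flat_exp (Suc n) (e - x \<bullet> x) + flat_exp (n + 2) (e - x \<bullet> x)))) (at x)"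
      by (rule DERIV_compose_FDERIV[OF flat_exp_has_derivative]) (auto intro!: derivative_eq_intros)
    then show "((\<lambda>x. flat_exp n (e - x \<bullet> x)) has_derivative
      (\<lambda>h. (- real n * flat_exp (Suc n) (e - x \<bullet> x) + flat_exp (n + 2) (e - x \<bullet> x)) * (- 2 * (x \<bullet> h)))) (at x)"
      by (simp add: inner_commute mult_ac)
  next
    fix b :: 'a
    show "Ck k (\<lambda>x. (- real n * flat_exp (Suc n) (e - x \<bullet> x) + flat_exp (n + 2) (e - x \<bullet> x)) * (- 2 * (x \<bullet> b)))"
      by (intro Ck_mult Ck_add Ck_const Suc Ck_inner)
  qed
qed

lemma continuous_on_Ck: "Ck k f \<Longrightarrow> continuous_on UNIV f"
  by (induction k) (auto dest: Ck_SucD simp del: Ck.simps(2))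

section \<open>Bump functions and differentiation under the integral\<close>

lemma mollifier_exists:
  assumes \<epsilon>: "0 < \<epsilon>"
  obtains \<psi> :: "'a::euclidean_space \<Rightarrow> real"
  where "\<And>k. Ck k \<psi>" "\<And>x. 0 \<le> \<psi> x" "\<And>x. \<epsilon> < norm x \<Longrightarrow> \<psi> x = 0"
    "(\<integral>\<^sup>+x. ennreal (\<psi> x) \<partial>lborel) = 1"
proof -
  \<comment> \<open>The classical bump exp(-1/(\<epsilon>^2 - |x|^2)). The quadratic argument is
    smooth at the origin as well and positive exactly in the open ball.\<close>
  define \<eta> :: "'a \<Rightarrow> real" where "\<eta> x = flat_exp 0 (\<epsilon>\<^sup>2 - x \<bullet> x)" for x
  have [simp]: "0 \<le> \<eta> x" for x by (simp add: \<eta>_def flat_exp_nonneg)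
  have C: "Ck k \<eta>" for k unfolding \<eta>_def by (rule Ck_flat_exp_ball)
  have [measurable]: "\<eta> \<in> borel_measurable borel"
    using continuous_on_Ck[OF C] by (rule borel_measurable_continuous_onI)
  have zero: "\<eta> x = 0" if "\<epsilon> < norm x" for x
    using that \<epsilon> power_strict_mono[of \<epsilon> "norm x" 2] by (simp add: \<eta>_def flat_exp_def power2_norm_eq_inner)
  have pos: "0 < \<eta> x" if "x \<in> ball 0 \<epsilon>" for x
    using that \<epsilon> power_strict_mono[of "norm x" \<epsilon> 2] by (simp add: \<eta>_def flat_exp_def power2_norm_eq_inner)
  define I where "I = (\<integral>\<^sup>+x. ennreal (\<eta> x) \<partial>lborel)"
  have "I \<le> (\<integral>\<^sup>+x. indicator (cball (0::'a) \<epsilon>) x \<partial>lborel)"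
    unfolding I_def
  proof (intro nn_integral_mono)
    fix x :: 'a
    have "\<eta> x \<le> 1" by (simp add: \<eta>_def flat_exp_def)
    then show "ennreal (\<eta> x) \<le> indicator (cball 0 \<epsilon>) x"
      using zero[of x] by (cases "x \<in> cball 0 \<epsilon>") (auto simp: ennreal_le_1)
  qed
  also have "\<dots> < \<infinity>"
    using emeasure_lborel_cball_finite[of 0 \<epsilon>] by simp
  finally have fin: "I < \<infinity>" .
  \<comment> \<open>\<eta> is positive on a ball of positive measure, so dividing by its integral is
    a legitimate normalisation.\<close>
  have "I \<noteq> 0"
  proof
    assume "I = 0"
    then have "AE x in lborel. \<eta> x = 0"
      by (simp add: I_def nn_integral_0_iff_AE order_antisym_conv)
    then have "AE x in lborel. x \<notin> ball (0::'a) \<epsilon>"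
      by (rule AE_mp) (use pos in force)
    then have "emeasure lborel (ball (0::'a) \<epsilon>) = 0"
      by (subst (asm) AE_iff_measurable[OF _ refl]) (auto simp: ball_def)
    then show False using \<epsilon> unit_ball_vol_pos[of "real DIM('a)"] by (simp add: emeasure_ball)
  qed
  with fin obtain r where r: "I = ennreal r" "0 < r"
    by (cases I) (auto simp: less_le)
  show ?thesis
  proof
    show "Ck k (\<lambda>x. (1 / r) * \<eta> x)" for k by (intro Ck_mult C Ck_const)
    show "(\<integral>\<^sup>+x. ennreal ((1 / r) * \<eta> x) \<partial>lborel) = 1"
    proof -
      have "(\<integral>\<^sup>+x. ennreal ((1 / r) * \<eta> x) \<partial>lborel) = (\<integral>\<^sup>+x. ennreal (1 / r) * ennreal (\<eta> x) \<partial>lborel)"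
        using r by (intro nn_integral_cong ennreal_mult) auto
      also have "\<dots> = ennreal (1 / r) * I" unfolding I_def by (rule nn_integral_cmult) simp
      also have "\<dots> = 1" unfolding r(1) using r(2) by (subst ennreal_mult[symmetric]) auto
      finally show ?thesis .
    qed
    show "0 \<le> 1 / r * \<eta> x" for x using r by simp
    show "1 / r * \<eta> x = 0" if "\<epsilon> < norm x" for x using zero[OF that] by simp
  qed
qed

lemma continuous_vanishing_bounded:
  fixes \<psi> :: "'a::euclidean_space \<Rightarrow> real"
  assumes "continuous_on UNIV \<psi>" "\<And>x. \<epsilon> < norm x \<Longrightarrow> \<psi> x = 0"
  obtains B where "0 \<le> B" "\<And>x. \<bar>\<psi> x\<bar> \<le> B"
proof -
  have "compact (\<psi> ` cball 0 \<epsilon>)"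
    using assms(1) by (intro compact_continuous_image) (auto intro: continuous_on_subset)
  then have "bounded (\<psi> ` cball 0 \<epsilon>)" by (rule compact_imp_bounded)
  then obtain B where "\<forall>y\<in>\<psi> ` cball 0 \<epsilon>. norm y \<le> B" unfolding bounded_iff ..
  then have B: "\<bar>\<psi> x\<bar> \<le> B" if "x \<in> cball 0 \<epsilon>" for x using that by auto
  show ?thesis
  proof (rule that[of "max 0 B"])
    show "\<bar>\<psi> x\<bar> \<le> max 0 B" for x
      using B[of x] assms(2)[of x] by (cases "x \<in> cball 0 \<epsilon>") auto
  qed simp
qed

lemma continuous_vanishing_uniformly_continuous:
  fixes \<psi> :: "'a::euclidean_space \<Rightarrow> real"
  assumes cont: "continuous_on UNIV \<psi>" and zero: "\<And>x. \<epsilon> < norm x \<Longrightarrow> \<psi> x = 0" and e: "0 < e"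
  obtains d where "0 < d" "\<And>x y. norm (x - y) < d \<Longrightarrow> \<bar>\<psi> x - \<psi> y\<bar> < e"
proof -
  \<comment> \<open>The margin 1 matches the \<open>min d 1\<close> below: two points at distance
    below 1 either both lie in the larger ball or both lie where \<psi> vanishes.\<close>
  have "uniformly_continuous_on (cball 0 (\<epsilon> + 1)) \<psi>"
    using cont by (intro compact_uniformly_continuous) (auto intro: continuous_on_subset)
  then obtain d where d: "0 < d"
    "\<And>x y. x \<in> cball 0 (\<epsilon> + 1) \<Longrightarrow> y \<in> cball 0 (\<epsilon> + 1) \<Longrightarrow> dist y x < d \<Longrightarrow> dist (\<psi> y) (\<psi> x) < e"
    using e unfolding uniformly_continuous_on_def by metis
  show ?thesis
  proof (rule that[of "min d 1"])
    fix x y :: 'a assume *: "norm (x - y) < min d 1"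
    show "\<bar>\<psi> x - \<psi> y\<bar> < e"
    proof (cases "norm x \<le> \<epsilon> + 1 \<and> norm y \<le> \<epsilon> + 1")
      case True
      then show ?thesis using d(2)[of y x] * by (auto simp: dist_norm)
    next
      case False
      then have "\<epsilon> < norm x" "\<epsilon> < norm y"
        using * norm_triangle_ineq2[of x y] norm_triangle_ineq3[of x y] by auto
      then show ?thesis using zero e by simp
    qed
  qed (use d in auto)
qed

lemma integrable_convolution_integrand:
  fixes \<psi> g :: "'a::euclidean_space \<Rightarrow> real"
  assumes "continuous_on UNIV \<psi>" "\<And>x. \<epsilon> < norm x \<Longrightarrow> \<psi> x = 0" "integrable lborel g"
  shows "integrable lborel (\<lambda>y. \<psi> (x - y) * g y)"
proof -
  obtain B where B: "0 \<le> B" "\<And>x. \<bar>\<psi> x\<bar> \<le> B"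
    using continuous_vanishing_bounded[OF assms(1,2)] by blast
  have [measurable]: "\<psi> \<in> borel_measurable borel"
    using assms(1) by (rule borel_measurable_continuous_onI)
  show ?thesis
  proof (rule Bochner_Integration.integrable_bound[of lborel "\<lambda>y. B * g y"])
    show "AE y in lborel. norm (\<psi> (x - y) * g y) \<le> norm (B * g y)"
      using B by (auto simp: abs_mult intro!: mult_right_mono)
  qed (use assms(3) in auto)
qed

text \<open>The complement of the closed ball is open and \<psi> is constantly 0 there. Partial
  derivatives thus inherit the vanishing condition and can take the place of \<psi> in a
  convolution.\<close>

lemma frechet_derivative_vanishing:
  fixes \<psi> :: "'a::euclidean_space \<Rightarrow> real"
  assumes zero: "\<And>x. \<epsilon> < norm x \<Longrightarrow> \<psi> x = 0" and x: "\<epsilon> < norm x"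
  shows "frechet_derivative \<psi> (at x) b = 0"
proof -
  have "(\<psi> has_derivative (\<lambda>_. 0)) (at x)"
  proof (rule has_derivative_transform_within_open)
    show "((\<lambda>_. 0) has_derivative (\<lambda>_. 0)) (at x)" by (rule has_derivative_const)
    show "open (- cball 0 \<epsilon>)" by auto
  qed (use zero x in auto)
  from frechet_derivative_at[OF this] show ?thesis by (simp add: fun_eq_iff)
qed

text \<open>The partial derivatives of \<psi> are uniformly continuous, so the remainder of the
  linearisation is small uniformly in the base point. Integrated against \<open>g\<close> it is
  bounded by a small multiple of the L^1 norm of \<open>g\<close>.\<close>

lemma convolution_has_derivative:
  fixes \<psi> g :: "'a::euclidean_space \<Rightarrow> real"
  assumes C: "\<And>k. Ck k \<psi>" and zero: "\<And>x. \<epsilon> < norm x \<Longrightarrow> \<psi> x = 0" and g: "integrable lborel g"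
  shows "((\<lambda>x. \<integral>y. \<psi> (x - y) * g y \<partial>lborel) has_derivative
    (\<lambda>v. \<Sum>b\<in>Basis. (v \<bullet> b) * (\<integral>y. frechet_derivative \<psi> (at (x - y)) b * g y \<partial>lborel))) (at x)"
proof -
  define D where "D b x = frechet_derivative \<psi> (at x) b" for b x
  have Dc: "continuous_on UNIV (D b)" if "b \<in> Basis" for b
    unfolding D_def using C[of "Suc 0"] that by simp
  have Dz: "D b x = 0" if "\<epsilon> < norm x" for b x
    unfolding D_def using zero that by (rule frechet_derivative_vanishing)
  have der: "(\<psi> has_derivative (\<lambda>v. \<Sum>b\<in>Basis. (v \<bullet> b) * D b u)) (at u)" for u
  proof -
    have 1: "(\<psi> has_derivative frechet_derivative \<psi> (at u)) (at u)"
      using has_derivative_Ck_Suc C by blast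
    interpret bounded_linear "frechet_derivative \<psi> (at u)"
      using 1 by (rule has_derivative_bounded_linear)
    have "frechet_derivative \<psi> (at u) v = (\<Sum>b\<in>Basis. (v \<bullet> b) * D b u)" for v
      by (subst euclidean_representation[of v, symmetric]) (simp add: sum scale D_def)
    then show ?thesis using 1 by presburger
  qed
  note Int = integrable_convolution_integrand[OF Dc Dz g]
  note Int0 = integrable_convolution_integrand[OF continuous_on_Ck[OF C] zero g]
  define L where "L x v = (\<Sum>b\<in>Basis. (v \<bullet> b) * (\<integral>y. D b (x - y) * g y \<partial>lborel))" for x v
  have L: "L x v = (\<integral>y. (\<Sum>b\<in>Basis. (v \<bullet> b) * D b (x - y)) * g y \<partial>lborel)" for v
    unfolding L_def using Int by (simp add: sum_distrib_right Bochner_Integration.integral_sum mult.assoc)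
  have LI: "integrable lborel (\<lambda>y. (\<Sum>b\<in>Basis. (v \<bullet> b) * D b (x - y)) * g y)" for v
    using Int by (simp add: sum_distrib_right Bochner_Integration.integrable_sum mult.assoc)
  have "((\<lambda>x. \<integral>y. \<psi> (x - y) * g y \<partial>lborel) has_derivative L x) (at x)"
    unfolding has_derivative_at_alt
  proof (intro conjI allI impI)
    show "bounded_linear (L x)" unfolding L_def
      by (intro bounded_linear_sum bounded_linear_mult_const bounded_linear_inner_left)
    fix e :: real assume e: "0 < e"
    define G where "G = (\<integral>y. \<bar>g y\<bar> \<partial>lborel)"
    have G: "0 \<le> G" by (simp add: G_def)
    \<comment> \<open>The tolerance is shared among the coordinates and divided by the L^1 norm of
      \<open>g\<close>; the summand 1 avoids division by 0.\<close>
    define e' where "e' = e / (DIM('a) * (G + 1))"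
    have e': "0 < e'" using e G by (simp add: e'_def add_nonneg_pos)
    have "\<exists>d>0. \<forall>u w. norm (u - w) < d \<longrightarrow> \<bar>D b u - D b w\<bar> < e'" if b: "b \<in> Basis" for b
      using continuous_vanishing_uniformly_continuous[OF Dc[OF b] Dz e'] by metis
    then obtain d where d: "\<And>b. b \<in> Basis \<Longrightarrow> 0 < d b"
      "\<And>b u w. b \<in> Basis \<Longrightarrow> norm (u - w) < d b \<Longrightarrow> \<bar>D b u - D b w\<bar> < e'"
      by metis
    define d0 where "d0 = Min (d ` Basis)"
    have d0: "0 < d0" "\<And>b. b \<in> Basis \<Longrightarrow> d0 \<le> d b" using d(1) by (auto simp: d0_def)
    have key: "\<bar>\<psi> (u + h) - \<psi> u - (\<Sum>b\<in>Basis. (h \<bullet> b) * D b u)\<bar> \<le> norm h * (DIM('a) * e')"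
      if h: "norm h < d0" for u h
    proof -
      have "norm (\<psi> (u + h) - \<psi> u - (\<Sum>b\<in>Basis. (((u + h) - u) \<bullet> b) * D b u)) \<le> norm ((u + h) - u) * (DIM('a) * e')"
      proof (rule differentiable_bound_linearization[where S = "ball u d0" and f' = "\<lambda>u v. \<Sum>b\<in>Basis. (v \<bullet> b) * D b u"])
        show "u + t *\<^sub>R (u + h - u) \<in> ball u d0" if "t \<in> {0..1}" for t
        proof -
          have "\<bar>t\<bar> * norm h \<le> 1 * norm h" using that by (intro mult_right_mono) auto
          then show ?thesis using h by (simp add: dist_norm)
        qed
        show "(\<psi> has_derivative (\<lambda>v. \<Sum>b\<in>Basis. v \<bullet> b * D b w)) (at w within ball u d0)" for w
          using der has_derivative_at_withinI by blast
        show "u \<in> ball u d0" using d0 by simp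
        fix w assume w: "w \<in> ball u d0"
        show "onorm ((\<lambda>v. \<Sum>b\<in>Basis. v \<bullet> b * D b w) - (\<lambda>v. \<Sum>b\<in>Basis. v \<bullet> b * D b u)) \<le> DIM('a) * e'"
        proof (rule onorm_le)
          fix v :: 'a
          have "norm (((\<lambda>v. \<Sum>b\<in>Basis. v \<bullet> b * D b w) - (\<lambda>v. \<Sum>b\<in>Basis. v \<bullet> b * D b u)) v)
              = \<bar>\<Sum>b\<in>Basis. (v \<bullet> b) * (D b w - D b u)\<bar>"
            by (simp add: sum_subtractf right_diff_distrib)
          also have "\<dots> \<le> (\<Sum>b\<in>(Basis::'a set). norm v * e')"
          proof (rule order_trans[OF sum_abs], rule sum_mono)
            fix b :: 'a assume b: "b \<in> Basis"
            have "norm (w - u) < d b" using w d0(2)[OF b] by (auto simp: dist_norm norm_minus_commute)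
            from d(2)[OF b this] have "\<bar>D b w - D b u\<bar> \<le> e'" by simp
            then show "\<bar>v \<bullet> b * (D b w - D b u)\<bar> \<le> norm v * e'"
              using Basis_le_norm[OF b, of v] by (auto simp: abs_mult intro!: mult_mono)
          qed
          finally show "norm (((\<lambda>v. \<Sum>b\<in>Basis. v \<bullet> b * D b w) - (\<lambda>v. \<Sum>b\<in>Basis. v \<bullet> b * D b u)) v) \<le> DIM('a) * e' * norm v"
            by (simp add: mult_ac)
        qed
      qed
      then show ?thesis by simp
    qed
    show "\<exists>d>0. \<forall>z. norm (z - x) < d \<longrightarrow> norm ((\<integral>y. \<psi> (z - y) * g y \<partial>lborel) - (\<integral>y. \<psi> (x - y) * g y \<partial>lborel) - L x (z - x)) \<le> e * norm (z - x)"
    proof (intro exI[of _ d0] conjI allI impI d0)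
      fix z assume z: "norm (z - x) < d0"
      have "(\<integral>y. \<psi> (z - y) * g y \<partial>lborel) - (\<integral>y. \<psi> (x - y) * g y \<partial>lborel) - L x (z - x)
         = (\<integral>y. \<psi> (z - y) * g y - \<psi> (x - y) * g y - (\<Sum>b\<in>Basis. ((z - x) \<bullet> b) * D b (x - y)) * g y \<partial>lborel)"
        unfolding L using Int0 LI by simp
      also have "norm \<dots> \<le> (\<integral>y. norm (z - x) * (DIM('a) * e') * \<bar>g y\<bar> \<partial>lborel)"
      proof (rule order_trans[OF integral_norm_bound], rule integral_mono)
        show "integrable lborel (\<lambda>y. norm (\<psi> (z - y) * g y - \<psi> (x - y) * g y - (\<Sum>b\<in>Basis. ((z - x) \<bullet> b) * D b (x - y)) * g y))"
          using Int0 LI by (intro integrable_norm Bochner_Integration.integrable_diff)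
        show "integrable lborel (\<lambda>y. norm (z - x) * (DIM('a) * e') * \<bar>g y\<bar>)" using g by simp
        fix y
        have "norm (\<psi> (z - y) * g y - \<psi> (x - y) * g y - (\<Sum>b\<in>Basis. ((z - x) \<bullet> b) * D b (x - y)) * g y)
           = \<bar>\<psi> ((x - y) + (z - x)) - \<psi> (x - y) - (\<Sum>b\<in>Basis. ((z - x) \<bullet> b) * D b (x - y))\<bar> * \<bar>g y\<bar>"
          by (simp add: algebra_simps flip: abs_mult)
        also have "\<dots> \<le> norm (z - x) * (DIM('a) * e') * \<bar>g y\<bar>"
          by (intro mult_right_mono key z) auto
        finally show "norm (\<psi> (z - y) * g y - \<psi> (x - y) * g y - (\<Sum>b\<in>Basis. ((z - x) \<bullet> b) * D b (x - y)) * g y)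
           \<le> norm (z - x) * (DIM('a) * e') * \<bar>g y\<bar>" .
      qed
      also have "\<dots> = (e * (G / (G + 1))) * norm (z - x)"
      proof -
        have "DIM('a) * e' = e / (G + 1)" using G by (simp add: e'_def)
        then show ?thesis by (simp add: G_def)
      qed
      also have "\<dots> \<le> (e * 1) * norm (z - x)"
        using e G by (intro mult_right_mono mult_left_mono) auto
      finally show "norm ((\<integral>y. \<psi> (z - y) * g y \<partial>lborel) - (\<integral>y. \<psi> (x - y) * g y \<partial>lborel) - L x (z - x)) \<le> e * norm (z - x)"
        by simp
    qed
  qed
  then show ?thesis unfolding L_def[abs_def] D_def .
qed

text \<open>Induction over all \<psi> at once, because a derivative of the convolution with \<psi>
  is the convolution with a partial derivative of \<psi>.\<close>

lemma Ck_convolution: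
  fixes \<psi> g :: "'a::euclidean_space \<Rightarrow> real"
  assumes "\<And>k. Ck k \<psi>" "\<And>x. \<epsilon> < norm x \<Longrightarrow> \<psi> x = 0" "integrable lborel g"
  shows "Ck k (\<lambda>x. \<integral>y. \<psi> (x - y) * g y \<partial>lborel)"
  using assms(1,2)
proof (induction k arbitrary: \<psi>)
  case 0
  have "isCont (\<lambda>x. \<integral>y. \<psi> (x - y) * g y \<partial>lborel) x" for x
    by (rule has_derivative_continuous[OF convolution_has_derivative[OF 0 assms(3)]])
  then show ?case by (simp add: continuous_at_imp_continuous_on)
next
  case (Suc k)
  show ?case
  proof (rule Ck_SucI)
    show "((\<lambda>x. \<integral>y. \<psi> (x - y) * g y \<partial>lborel) has_derivative
      (\<lambda>v. \<Sum>b\<in>Basis. (v \<bullet> b) * (\<integral>y. frechet_derivative \<psi> (at (x - y)) b * g y \<partial>lborel))) (at x)" for x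
      by (rule convolution_has_derivative[OF Suc.prems assms(3)])
  next
    fix b :: 'a assume b: "b \<in> Basis"
    have "Ck k (\<lambda>x. \<integral>y. frechet_derivative \<psi> (at (x - y)) b * g y \<partial>lborel)"
    proof (rule Suc.IH)
      show "Ck j (\<lambda>x. frechet_derivative \<psi> (at x) b)" for j
        using Suc.prems(1)[of "Suc j"] b by simp
    qed (rule frechet_derivative_vanishing[OF Suc.prems(2)])
    \<comment> \<open>The derivative is a sum over all coordinates; at a basis vector only one
      summand survives.\<close>
    moreover have "(\<Sum>i\<in>Basis. (b \<bullet> i) * X i) = X b" for X :: "'a \<Rightarrow> real"
    proof -
      have "(\<Sum>i\<in>Basis. (b \<bullet> i) * X i) = (\<Sum>i\<in>Basis. if i = b then X i else 0)"
        using b by (intro sum.cong) (auto simp: inner_Basis)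
      then show ?thesis using b by simp
    qed
    ultimately show "Ck k (\<lambda>x. \<Sum>i\<in>Basis. (b \<bullet> i) * (\<integral>y. frechet_derivative \<psi> (at (x - y)) i * g y \<partial>lborel))"
      by presburger
  qed
qed

section \<open>Convolution with a mollifier\<close>

definition mollify :: "('a::euclidean_space \<Rightarrow> real) \<Rightarrow> ('a \<Rightarrow> real) \<Rightarrow> 'a \<Rightarrow> real" where
  "mollify \<psi> g x = (\<integral>y. \<psi> (x - y) * g y \<partial>lborel)"

text \<open>A smooth probability density supported in the closed ball of radius \<epsilon>.
  Convergence is later stated uniformly over all such densities instead of along the rescalings of
  one bump.\<close>

definition mollifier :: "real \<Rightarrow> ('a::euclidean_space \<Rightarrow> real) \<Rightarrow> bool" where
  "mollifier \<epsilon> \<psi> \<longleftrightarrow> (\<forall>k. Ck k \<psi>) \<and> (\<forall>x. 0 \<le> \<psi> x) \<and> (\<forall>x. \<epsilon> < norm x \<longrightarrow> \<psi> x = 0) \<and>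
    (\<integral>\<^sup>+x. ennreal (\<psi> x) \<partial>lborel) = 1"

lemma lborel_reflect: "distr lborel borel (\<lambda>z. x - z) = (lborel :: 'a::euclidean_space measure)"
  by (subst (2) lborel_affine[of "-1" x]) (auto simp: density_1)

lemma nn_integral_shift:
  fixes f :: "'a::euclidean_space \<Rightarrow> ennreal"
  assumes [measurable]: "f \<in> borel_measurable borel"
  shows "(\<integral>\<^sup>+z. f (z - x) \<partial>lborel) = (\<integral>\<^sup>+z. f z \<partial>lborel)"
  by (subst (2) lborel_distr_plus[of "- x", symmetric]) (simp add: nn_integral_distr)

text \<open>In this form the averaging measure is fixed and \<open>g\<close> is translated, which
  suits Jensen's inequality and translation invariance.\<close>

lemma mollify_altdef:
  fixes \<psi> g :: "'a::euclidean_space \<Rightarrow> real"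
  assumes [measurable]: "\<psi> \<in> borel_measurable borel" "g \<in> borel_measurable borel"
  shows "mollify \<psi> g x = (\<integral>z. \<psi> z * g (x - z) \<partial>lborel)"
  unfolding mollify_def
  by (subst lborel_reflect[of x, symmetric]) (simp add: integral_distr)

lemma mollifier_measurable: "mollifier \<epsilon> \<psi> \<Longrightarrow> \<psi> \<in> borel_measurable borel"
  unfolding mollifier_def by (meson continuous_on_Ck borel_measurable_continuous_onI)

lemma integrable_mollifier_mult:
  fixes \<psi> g :: "'a::euclidean_space \<Rightarrow> real"
  assumes \<psi>: "mollifier \<epsilon> \<psi>" and g: "integrable lborel g"
  shows "integrable lborel (\<lambda>y. \<psi> (x - y) * g y)" "integrable lborel (\<lambda>z. \<psi> z * g (x - z))"
proof -
  note [measurable] = mollifier_measurable[OF \<psi>] borel_measurable_integrable[OF g]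
  have [measurable]: "g \<in> borel_measurable borel" using g by measurable
  show 1: "integrable lborel (\<lambda>y. \<psi> (x - y) * g y)" for x
    using \<psi> g unfolding mollifier_def
    by (intro integrable_convolution_integrand[where \<epsilon> = \<epsilon>]) (auto intro: continuous_on_Ck)
  show "integrable lborel (\<lambda>z. \<psi> z * g (x - z))"
    using 1[of x] by (subst (asm) lborel_reflect[of x, symmetric], subst (asm) integrable_distr_eq) auto
qed

lemma Ck_mollify:
  assumes "mollifier \<epsilon> \<psi>" "integrable lborel g"
  shows "Ck k (mollify \<psi> g)"
  using Ck_convolution[of \<psi> \<epsilon> g k] assms unfolding mollifier_def mollify_def[abs_def] by auto

lemma mollify_diff:
  assumes "mollifier \<epsilon> \<psi>" "integrable lborel g" "integrable lborel h"
  shows "mollify \<psi> (\<lambda>x. g x - h x) x = mollify \<psi> g x - mollify \<psi> h x"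
  using integrable_mollifier_mult[OF assms(1,2)] integrable_mollifier_mult[OF assms(1,3)]
  by (simp add: mollify_def right_diff_distrib)

lemma mollify_vanishes:
  fixes \<psi> g :: "'a::euclidean_space \<Rightarrow> real"
  assumes "mollifier \<epsilon> \<psi>" "\<And>y. norm (x - y) \<le> \<epsilon> \<Longrightarrow> g y = 0"
  shows "mollify \<psi> g x = 0"
proof -
  have "(\<lambda>y. \<psi> (x - y) * g y) = (\<lambda>_. 0)"
  proof
    show "\<psi> (x - y) * g y = 0" for y
      using assms unfolding mollifier_def by (cases "norm (x - y) \<le> \<epsilon>") auto
  qed
  then show ?thesis by (simp add: mollify_def)
qed

text \<open>An average of translates: Jensen's inequality at each point, then Tonelli and
  translation invariance.\<close>

lemma nn_integral_mollify_le:
  fixes g :: "'a::euclidean_space \<Rightarrow> real"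
  assumes p: "1 \<le> p" and \<psi>: "mollifier \<epsilon> \<psi>" and g: "integrable lborel g"
  shows "(\<integral>\<^sup>+x. ennreal (\<bar>mollify \<psi> g x\<bar> powr p) \<partial>lborel) \<le> (\<integral>\<^sup>+x. ennreal (\<bar>g x\<bar> powr p) \<partial>lborel)"
proof -
  note [measurable] = mollifier_measurable[OF \<psi>]
  have [measurable]: "g \<in> borel_measurable borel" using borel_measurable_integrable[OF g] by simp
  have nn: "0 \<le> \<psi> z" and one: "(\<integral>\<^sup>+x. ennreal (\<psi> x) \<partial>lborel) = 1" for z
    using \<psi> by (auto simp: mollifier_def)
  have "(\<integral>\<^sup>+x. ennreal (\<bar>mollify \<psi> g x\<bar> powr p) \<partial>lborel)
    \<le> (\<integral>\<^sup>+x. \<integral>\<^sup>+z. ennreal (\<psi> z * \<bar>g (x - z)\<bar> powr p) \<partial>lborel \<partial>lborel)"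
    by (intro nn_integral_mono, subst mollify_altdef)
      (auto intro!: jensen_powr p nn one integrable_mollifier_mult[OF \<psi> g])
  also have "\<dots> = (\<integral>\<^sup>+z. \<integral>\<^sup>+x. ennreal (\<psi> z) * ennreal (\<bar>g (x - z)\<bar> powr p) \<partial>lborel \<partial>lborel)"
    by (subst lborel_pair.Fubini') (auto simp: ennreal_mult nn)
  also have "\<dots> = (\<integral>\<^sup>+z. ennreal (\<psi> z) * (\<integral>\<^sup>+x. ennreal (\<bar>g (x - z)\<bar> powr p) \<partial>lborel) \<partial>lborel)"
    by (intro nn_integral_cong nn_integral_cmult) auto
  also have "\<dots> = (\<integral>\<^sup>+z. ennreal (\<psi> z) * (\<integral>\<^sup>+x. ennreal (\<bar>g x\<bar> powr p) \<partial>lborel) \<partial>lborel)"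
    by (subst nn_integral_shift[where f = "\<lambda>x. ennreal (\<bar>g x\<bar> powr p)"]) auto
  also have "\<dots> = (\<integral>\<^sup>+x. ennreal (\<bar>g x\<bar> powr p) \<partial>lborel)"
    using one by (simp add: nn_integral_multc)
  finally show ?thesis .
qed

text \<open>The kernel depends on x - y only and is unchanged when both points are shifted by z.
  After Jensen and Tonelli every shift contributes the same double integral, which weights in x or y
  would prevent.\<close>

lemma nn_integral_mollify_diff_le:
  fixes g :: "'a::euclidean_space \<Rightarrow> real" and k :: "'a \<Rightarrow> ennreal"
  assumes p: "1 \<le> p" and \<psi>: "mollifier \<epsilon> \<psi>" and g: "integrable lborel g"
    and [measurable]: "k \<in> borel_measurable borel"
  shows "(\<integral>\<^sup>+x. \<integral>\<^sup>+y. ennreal (\<bar>mollify \<psi> g x - mollify \<psi> g y\<bar> powr p) * k (x - y) \<partial>lborel \<partial>lborel)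
    \<le> (\<integral>\<^sup>+x. \<integral>\<^sup>+y. ennreal (\<bar>g x - g y\<bar> powr p) * k (x - y) \<partial>lborel \<partial>lborel)" (is "_ \<le> ?E")
proof -
  note [measurable] = mollifier_measurable[OF \<psi>]
  have [measurable]: "g \<in> borel_measurable borel" using borel_measurable_integrable[OF g] by simp
  have nn: "0 \<le> \<psi> z" and one: "(\<integral>\<^sup>+x. ennreal (\<psi> x) \<partial>lborel) = 1" for z
    using \<psi> by (auto simp: mollifier_def)
  define F where "F x y = ennreal (\<bar>g x - g y\<bar> powr p) * k (x - y)" for x y
  have F[measurable]: "(\<lambda>w. F (fst w) (snd w)) \<in> borel_measurable (borel \<Otimes>\<^sub>M borel)"
    unfolding F_def by measurable
  have "ennreal (\<bar>mollify \<psi> g x - mollify \<psi> g y\<bar> powr p)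
      \<le> (\<integral>\<^sup>+z. ennreal (\<psi> z * \<bar>g (x - z) - g (y - z)\<bar> powr p) \<partial>lborel)" for x y
  proof -
    have i: "integrable lborel (\<lambda>z. \<psi> z * (g (x - z) - g (y - z)))"
      using integrable_mollifier_mult(2)[OF \<psi> g] by (simp add: right_diff_distrib)
    have "mollify \<psi> g x - mollify \<psi> g y = (\<integral>z. \<psi> z * (g (x - z) - g (y - z)) \<partial>lborel)"
      using integrable_mollifier_mult(2)[OF \<psi> g] by (simp add: mollify_altdef right_diff_distrib)
    then show ?thesis
      using jensen_powr[OF p _ _ nn one i] by simp
  qed
  then have "ennreal (\<bar>mollify \<psi> g x - mollify \<psi> g y\<bar> powr p) * k (x - y)
      \<le> (\<integral>\<^sup>+z. ennreal (\<psi> z * \<bar>g (x - z) - g (y - z)\<bar> powr p) \<partial>lborel) * k (x - y)" for x y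
    by (intro mult_right_mono) auto
  \<comment> \<open>By x - y = (x - z) - (y - z) the kernel moves under the integral and becomes
    part of \<open>F\<close> at the shifted pair.\<close>
  also have "(\<integral>\<^sup>+z. ennreal (\<psi> z * \<bar>g (x - z) - g (y - z)\<bar> powr p) \<partial>lborel) * k (x - y)
     = (\<integral>\<^sup>+z. ennreal (\<psi> z) * F (x - z) (y - z) \<partial>lborel)" for x y
    by (subst nn_integral_multc[symmetric]) (auto simp: F_def ennreal_mult nn mult.assoc)
  finally have "(\<integral>\<^sup>+x. \<integral>\<^sup>+y. ennreal (\<bar>mollify \<psi> g x - mollify \<psi> g y\<bar> powr p) * k (x - y) \<partial>lborel \<partial>lborel)
    \<le> (\<integral>\<^sup>+x. \<integral>\<^sup>+y. \<integral>\<^sup>+z. ennreal (\<psi> z) * F (x - z) (y - z) \<partial>lborel \<partial>lborel \<partial>lborel)"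
    by (intro nn_integral_mono)
  also have "\<dots> = (\<integral>\<^sup>+x. \<integral>\<^sup>+z. \<integral>\<^sup>+y. ennreal (\<psi> z) * F (x - z) (y - z) \<partial>lborel \<partial>lborel \<partial>lborel)"
    by (rule nn_integral_cong, rule lborel_pair.Fubini'[symmetric], unfold F_def, measurable)
  also have "\<dots> = (\<integral>\<^sup>+x. \<integral>\<^sup>+z. ennreal (\<psi> z) * (\<integral>\<^sup>+y. F (x - z) y \<partial>lborel) \<partial>lborel \<partial>lborel)"
  proof (intro nn_integral_cong)
    fix x z
    have "(\<integral>\<^sup>+y. ennreal (\<psi> z) * F (x - z) (y - z) \<partial>lborel) = ennreal (\<psi> z) * (\<integral>\<^sup>+y. F (x - z) (y - z) \<partial>lborel)"
      by (rule nn_integral_cmult, unfold F_def, measurable)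
    then show "(\<integral>\<^sup>+y. ennreal (\<psi> z) * F (x - z) (y - z) \<partial>lborel) = ennreal (\<psi> z) * (\<integral>\<^sup>+y. F (x - z) y \<partial>lborel)"
      by (subst (asm) nn_integral_shift[where f = "F (x - z)"], unfold F_def, measurable)
  qed
  also have "\<dots> = (\<integral>\<^sup>+z. \<integral>\<^sup>+x. ennreal (\<psi> z) * (\<integral>\<^sup>+y. F (x - z) y \<partial>lborel) \<partial>lborel \<partial>lborel)"
    by (rule lborel_pair.Fubini'[symmetric], unfold F_def, measurable)
  also have "\<dots> = (\<integral>\<^sup>+z. ennreal (\<psi> z) * ?E \<partial>lborel)"
  proof (intro nn_integral_cong)
    fix z
    have "(\<integral>\<^sup>+x. ennreal (\<psi> z) * (\<integral>\<^sup>+y. F (x - z) y \<partial>lborel) \<partial>lborel) = ennreal (\<psi> z) * (\<integral>\<^sup>+x. (\<integral>\<^sup>+y. F (x - z) y \<partial>lborel) \<partial>lborel)"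
      by (rule nn_integral_cmult, unfold F_def, measurable)
    then show "(\<integral>\<^sup>+x. ennreal (\<psi> z) * (\<integral>\<^sup>+y. F (x - z) y \<partial>lborel) \<partial>lborel) = ennreal (\<psi> z) * ?E"
      by (subst (asm) nn_integral_shift[where f = "\<lambda>x. \<integral>\<^sup>+y. F x y \<partial>lborel"], unfold F_def, measurable)
  qed
  also have "\<dots> = ?E"
    using one by (simp add: nn_integral_multc)
  finally show ?thesis .
qed

text \<open>Where |g| \<le> 1 the bound 1 on a ball is integrable; elsewhere |g| \<le> |g|^p.
  Mollification is a Bochner integral and therefore asks for integrability of \<open>g\<close>
  itself.\<close>

lemma integrable_of_powr_integrable:
  fixes g :: "'a::euclidean_space \<Rightarrow> real"
  assumes p: "1 \<le> p" and [measurable]: "g \<in> borel_measurable borel"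
    and fin: "(\<integral>\<^sup>+x. ennreal (\<bar>g x\<bar> powr p) \<partial>lborel) < \<infinity>" and supp: "\<And>x. R < norm x \<Longrightarrow> g x = 0"
  shows "integrable lborel g"
proof (rule integrableI_bounded)
  have "(\<integral>\<^sup>+x. ennreal (norm (g x)) \<partial>lborel) \<le> (\<integral>\<^sup>+x. ennreal (\<bar>g x\<bar> powr p) + indicator (cball 0 R) x \<partial>lborel)"
  proof (rule nn_integral_mono)
    fix x
    show "ennreal (norm (g x)) \<le> ennreal (\<bar>g x\<bar> powr p) + indicator (cball 0 R) x"
    proof (cases "\<bar>g x\<bar> \<le> 1")
      case True
      then show ?thesis using supp[of x] by (cases "norm x \<le> R") (auto simp: add_increasing)
    next
      case False
      then have "\<bar>g x\<bar> powr 1 \<le> \<bar>g x\<bar> powr p" using p by (intro powr_mono) auto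
      then have "ennreal (norm (g x)) \<le> ennreal (\<bar>g x\<bar> powr p)" using False by (intro ennreal_leI) auto
      then show ?thesis by (rule add_increasing2[rotated]) auto
    qed
  qed
  also have "\<dots> < \<infinity>"
    using fin emeasure_lborel_cball_finite[of "0::'a" R] by (subst nn_integral_add) (auto intro: borel_measurable_indicator borel_closed)
  finally show "(\<integral>\<^sup>+x. ennreal (norm (g x)) \<partial>lborel) < \<infinity>" .
qed simp

section \<open>Density of continuous functions and convergence of mollifications in L^p\<close>

lemma nn_integral_add_powr_le:
  assumes p: "1 \<le> p" and [measurable]: "u \<in> borel_measurable M" "v \<in> borel_measurable M"
  shows "(\<integral>\<^sup>+x. ennreal (\<bar>u x + v x\<bar> powr p) \<partial>M)
    \<le> ennreal (2 powr p) * ((\<integral>\<^sup>+x. ennreal (\<bar>u x\<bar> powr p) \<partial>M) + (\<integral>\<^sup>+x. ennreal (\<bar>v x\<bar> powr p) \<partial>M))"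
proof -
  have "(\<integral>\<^sup>+x. ennreal (\<bar>u x + v x\<bar> powr p) \<partial>M)
      \<le> (\<integral>\<^sup>+x. ennreal (2 powr p) * (ennreal (\<bar>u x\<bar> powr p) + ennreal (\<bar>v x\<bar> powr p)) \<partial>M)"
    by (intro nn_integral_mono) (auto intro!: ennreal_leI powr_abs_add_le p simp flip: ennreal_mult ennreal_plus)
  also have "\<dots> = ennreal (2 powr p) * ((\<integral>\<^sup>+x. ennreal (\<bar>u x\<bar> powr p) \<partial>M) + (\<integral>\<^sup>+x. ennreal (\<bar>v x\<bar> powr p) \<partial>M))"
    by (simp add: nn_integral_cmult nn_integral_add)
  finally show ?thesis .
qed

definition clamp_real :: "real \<Rightarrow> real \<Rightarrow> real" where
  "clamp_real M t = max (- M) (min M t)"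

lemma clamp_real_measurable [measurable]: "clamp_real M \<in> borel_measurable borel"
  unfolding clamp_real_def[abs_def] by measurable

text \<open>Two limits by dominated convergence. Truncations in height are dominated by |g|^p. A
  truncation is an almost everywhere limit of continuous functions, and forcing these to share its
  bound and a bounded support gives a constant on a ball as majorant.\<close>

lemma continuous_compact_support_dense_Lp:
  fixes g :: "'a::euclidean_space \<Rightarrow> real"
  assumes p: "1 \<le> p" and [measurable]: "g \<in> borel_measurable borel"
    and fin: "(\<integral>\<^sup>+x. ennreal (\<bar>g x\<bar> powr p) \<partial>lborel) < \<infinity>" and supp: "\<And>x. R < norm x \<Longrightarrow> g x = 0"
    and \<delta>: "0 < (\<delta> :: real)"
  obtains h where "continuous_on UNIV h" "\<And>x. R + 1 < norm x \<Longrightarrow> h x = 0"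
    "(\<integral>\<^sup>+x. ennreal (\<bar>g x - h x\<bar> powr p) \<partial>lborel) < ennreal \<delta>"
proof -
  have lim0: "(\<lambda>n. ennreal (\<bar>a n\<bar> powr p)) \<longlonglongrightarrow> 0" if "a \<longlonglongrightarrow> 0" for a :: "nat \<Rightarrow> real"
    using tendsto_ennrealI[OF tendsto_powr'[OF tendsto_rabs_zero[OF that] tendsto_const[of p]]] p by simp
  \<comment> \<open>Each of the two errors will be below \<open>D\<close>; with the factor
    \<open>2 powr p\<close> they total at most \<delta> / 2, hence strictly less than
    \<delta>.\<close>
  define D where "D = \<delta> / (4 * 2 powr p)"
  have D: "0 < D" "\<delta> / 2 = 2 powr p * (D + D)" using \<delta> by (auto simp: D_def field_simps)
  define \<delta>' where "\<delta>' = ennreal D"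
  have \<delta>': "0 < \<delta>'" using D by (simp add: \<delta>'_def)
  have "(\<lambda>n. \<integral>\<^sup>+x. ennreal (\<bar>g x - clamp_real (real n) (g x)\<bar> powr p) \<partial>lborel) \<longlonglongrightarrow> (\<integral>\<^sup>+x. 0 \<partial>(lborel :: 'a measure))"
  proof (rule nn_integral_dominated_convergence[where w = "\<lambda>x. ennreal (\<bar>g x\<bar> powr p)"])
    show "AE x in lborel. ennreal (\<bar>g x - clamp_real (real n) (g x)\<bar> powr p) \<le> ennreal (\<bar>g x\<bar> powr p)" for n
      using p by (intro AE_I2 ennreal_leI powr_mono2) (auto simp: clamp_real_def)
    show "AE x in lborel. (\<lambda>n. ennreal (\<bar>g x - clamp_real (real n) (g x)\<bar> powr p)) \<longlonglongrightarrow> 0"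
    proof (intro AE_I2 lim0)
      fix x
      have "eventually (\<lambda>n. g x - clamp_real (real n) (g x) = 0) sequentially"
        using eventually_ge_at_top[of "nat \<lceil>\<bar>g x\<bar>\<rceil>"]
        by eventually_elim (auto simp: clamp_real_def nat_ceiling_le_eq)
      then show "(\<lambda>n. g x - clamp_real (real n) (g x)) \<longlonglongrightarrow> 0" by (rule tendsto_eventually)
    qed
  qed (use fin in auto)
  from order_tendstoD(2)[OF this, of \<delta>'] \<delta>'
  have "eventually (\<lambda>n. (\<integral>\<^sup>+x. ennreal (\<bar>g x - clamp_real (real n) (g x)\<bar> powr p) \<partial>lborel) < \<delta>') sequentially"
    by simp
  then obtain n where n: "(\<integral>\<^sup>+x. ennreal (\<bar>g x - clamp_real (real n) (g x)\<bar> powr p) \<partial>lborel) < \<delta>'"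
    by (auto simp: eventually_sequentially)
  define M where "M = real n"
  define u where "u x = clamp_real M (g x)" for x
  have u[measurable]: "u \<in> borel_measurable borel" unfolding u_def by measurable
  have uM: "clamp_real M (u x) = u x" for x by (simp add: u_def clamp_real_def M_def)
  have u0: "u x = 0" if "R < norm x" for x using supp[OF that] by (simp add: u_def clamp_real_def M_def)
  \<comment> \<open>\<open>measurable_on\<close> means being the limit of continuous functions off a
    negligible set.\<close>
  have "u measurable_on UNIV"
    by (rule lebesgue_measurable_imp_measurable_on) (auto intro: measurable_completion)
  then obtain N H where N: "negligible N" and H: "\<And>j. continuous_on UNIV (H j)"
    "\<And>x. x \<notin> N \<Longrightarrow> (\<lambda>j. H j x) \<longlonglongrightarrow> u x" unfolding measurable_on_def by auto
  \<comment> \<open>Clamping and the tent factor do not change the limit, because \<open>u\<close>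
    is bounded by \<open>M\<close> and vanishes where the factor is below 1.\<close>
  define k where "k j x = clamp_real M (H j x) * max 0 (min 1 (R + 1 - norm x))" for j x
  have kc: "continuous_on UNIV (k j)" for j
    unfolding k_def clamp_real_def using H(1) by (intro continuous_intros) auto
  have [measurable]: "k j \<in> borel_measurable borel" for j
    using kc by (rule borel_measurable_continuous_onI)
  have k0: "k j x = 0" if "R + 1 < norm x" for j x using that by (simp add: k_def)
  have "(\<lambda>j. \<integral>\<^sup>+x. ennreal (\<bar>u x - k j x\<bar> powr p) \<partial>lborel) \<longlonglongrightarrow> (\<integral>\<^sup>+x. 0 \<partial>(lborel :: 'a measure))"
  proof (rule nn_integral_dominated_convergence[where w = "\<lambda>x. ennreal ((2 * M) powr p) * indicator (cball 0 (R + 1)) x"])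
    show "(\<integral>\<^sup>+x. ennreal ((2 * M) powr p) * indicator (cball (0::'a) (R + 1)) x \<partial>lborel) < \<infinity>"
      using emeasure_lborel_cball_finite[of "0::'a" "R + 1"]
      by (simp add: nn_integral_cmult_indicator ennreal_mult_less_top)
    show "AE x in lborel. ennreal (\<bar>u x - k j x\<bar> powr p) \<le> ennreal ((2 * M) powr p) * indicator (cball 0 (R + 1)) x" for j
    proof (intro AE_I2)
      fix x
      have "\<bar>k j x\<bar> \<le> M * 1"
        unfolding k_def abs_mult by (intro mult_mono) (auto simp: clamp_real_def M_def)
      moreover have "\<bar>u x\<bar> \<le> M" by (auto simp: u_def clamp_real_def M_def)
      ultimately have "\<bar>u x - k j x\<bar> \<le> 2 * M" by linarith
      then have "\<bar>u x - k j x\<bar> powr p \<le> (2 * M) powr p" using p by (intro powr_mono2) auto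
      then show "ennreal (\<bar>u x - k j x\<bar> powr p) \<le> ennreal ((2 * M) powr p) * indicator (cball 0 (R + 1)) x"
        using k0[of x j] u0[of x] by (cases "norm x \<le> R + 1") (auto intro: ennreal_leI)
    qed
    have "AE x in lebesgue. x \<notin> N" using N by (auto simp: negligible_iff_null_sets intro: AE_not_in)
    then have "AE x in lborel. x \<notin> N" by (simp add: AE_completion_iff)
    then show "AE x in lborel. (\<lambda>j. ennreal (\<bar>u x - k j x\<bar> powr p)) \<longlonglongrightarrow> 0"
    proof (rule AE_mp, intro AE_I2 impI lim0)
      fix x assume "x \<notin> N"
      have "(\<lambda>j. clamp_real M (H j x)) \<longlonglongrightarrow> clamp_real M (u x)"
        unfolding clamp_real_def by (intro tendsto_intros H(2) \<open>x \<notin> N\<close>)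
      then have "(\<lambda>j. u x - k j x) \<longlonglongrightarrow> u x - u x * max 0 (min 1 (R + 1 - norm x))"
        unfolding k_def uM by (intro tendsto_intros)
      moreover have "u x * max 0 (min 1 (R + 1 - norm x)) = u x" using u0[of x] by (cases "norm x \<le> R") auto
      ultimately show "(\<lambda>j. u x - k j x) \<longlonglongrightarrow> 0" by simp
    qed
    show "(\<lambda>x. ennreal (\<bar>u x - k j x\<bar> powr p)) \<in> borel_measurable lborel" for j
      by measurable
    show "(\<lambda>x. ennreal ((2 * M) powr p) * indicator (cball 0 (R + 1)) x) \<in> borel_measurable (lborel :: 'a measure)"
      by (intro borel_measurable_times_ennreal borel_measurable_const borel_measurable_indicator) simp
    show "(\<lambda>x. 0) \<in> borel_measurable (lborel :: 'a measure)" by simp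
  qed
  from order_tendstoD(2)[OF this, of \<delta>'] \<delta>'
  have "eventually (\<lambda>j. (\<integral>\<^sup>+x. ennreal (\<bar>u x - k j x\<bar> powr p) \<partial>lborel) < \<delta>') sequentially"
    by simp
  then obtain j where j: "(\<integral>\<^sup>+x. ennreal (\<bar>u x - k j x\<bar> powr p) \<partial>lborel) < \<delta>'"
    by (auto simp: eventually_sequentially)
  show ?thesis
  proof (rule that[of "k j"])
    have "(\<integral>\<^sup>+x. ennreal (\<bar>g x - k j x\<bar> powr p) \<partial>lborel) = (\<integral>\<^sup>+x. ennreal (\<bar>(g x - u x) + (u x - k j x)\<bar> powr p) \<partial>lborel)"
      by simp
    also have "\<dots> \<le> ennreal (2 powr p) * ((\<integral>\<^sup>+x. ennreal (\<bar>g x - u x\<bar> powr p) \<partial>lborel) + (\<integral>\<^sup>+x. ennreal (\<bar>u x - k j x\<bar> powr p) \<partial>lborel))"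
      by (intro nn_integral_add_powr_le p) auto
    also have "\<dots> \<le> ennreal (2 powr p) * (\<delta>' + \<delta>')"
      using n j by (intro mult_left_mono add_mono) (auto simp: u_def M_def)
    also have "\<dots> = ennreal (\<delta> / 2)"
    proof -
      show ?thesis
        unfolding D(2) \<delta>'_def using D(1) by (subst ennreal_plus[symmetric]) (auto simp: ennreal_mult')
    qed
    also have "\<dots> < ennreal \<delta>" using \<delta> by (intro ennreal_lessI) auto
    finally show "(\<integral>\<^sup>+x. ennreal (\<bar>g x - k j x\<bar> powr p) \<partial>lborel) < ennreal \<delta>" .
  qed (use kc k0 in auto)
qed

lemma mollify_uniform_approx:
  fixes h :: "'a::euclidean_space \<Rightarrow> real"
  assumes \<psi>: "mollifier \<epsilon> \<psi>" and h: "integrable lborel h"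
    and e: "\<And>x y. norm (x - y) \<le> \<epsilon> \<Longrightarrow> \<bar>h x - h y\<bar> \<le> e"
  shows "\<bar>h x - mollify \<psi> h x\<bar> \<le> e"
proof -
  note [measurable] = mollifier_measurable[OF \<psi>]
  have [measurable]: "h \<in> borel_measurable borel" using borel_measurable_integrable[OF h] by simp
  have nn: "0 \<le> \<psi> z" and one: "(\<integral>\<^sup>+x. ennreal (\<psi> x) \<partial>lborel) = 1" for z
    using \<psi> by (auto simp: mollifier_def)
  have i: "integrable lborel \<psi>" using nn one by (intro integrableI_nonneg) auto
  have I: "(\<integral>z. \<psi> z \<partial>lborel) = 1" using one nn by (simp add: integral_eq_nn_integral)
  note i2 = integrable_mollifier_mult(2)[OF \<psi> h, of x]
  have "h x - mollify \<psi> h x = (\<integral>z. \<psi> z * h x \<partial>lborel) - (\<integral>z. \<psi> z * h (x - z) \<partial>lborel)"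
    using I i by (simp add: mollify_altdef)
  also have "\<dots> = (\<integral>z. \<psi> z * (h x - h (x - z)) \<partial>lborel)"
    using i i2 by (subst Bochner_Integration.integral_diff[symmetric]) (auto simp: right_diff_distrib)
  also have "\<bar>\<dots>\<bar> \<le> (\<integral>z. \<psi> z * e \<partial>lborel)"
  proof (rule order_trans[OF integral_abs_bound], rule integral_mono)
    show "integrable lborel (\<lambda>z. \<bar>\<psi> z * (h x - h (x - z))\<bar>)"
      using i i2 by (simp add: right_diff_distrib)
    show "integrable lborel (\<lambda>z. \<psi> z * e)" using i by simp
    fix z
    show "\<bar>\<psi> z * (h x - h (x - z))\<bar> \<le> \<psi> z * e"
    proof (cases "norm z \<le> \<epsilon>")
      case True
      then show ?thesis using e[of x "x - z"] nn[of z] by (auto simp: abs_mult intro: mult_left_mono)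
    next
      case False
      then show ?thesis using \<psi> by (simp add: mollifier_def)
    qed
  qed
  also have "\<dots> = e" using I i by simp
  finally show ?thesis .
qed

text \<open>Three errors: g - h and its mollification are small because mollification contracts L^p,
  and the continuous function h is uniformly close to its own mollification. The threshold
  \<open>d\<close> is the same for all mollifiers.\<close>

lemma mollify_tendsto_Lp:
  fixes g :: "'a::euclidean_space \<Rightarrow> real"
  assumes p: "1 \<le> p" and [measurable]: "g \<in> borel_measurable borel"
    and fin: "(\<integral>\<^sup>+x. ennreal (\<bar>g x\<bar> powr p) \<partial>lborel) < \<infinity>" and supp: "\<And>x. R < norm x \<Longrightarrow> g x = 0"
    and \<delta>: "0 < (\<delta> :: real)"
  obtains d where "0 < d" "\<And>\<epsilon> \<psi>. \<epsilon> < d \<Longrightarrow> mollifier \<epsilon> \<psi> \<Longrightarrow>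
    (\<integral>\<^sup>+x. ennreal (\<bar>g x - mollify \<psi> g x\<bar> powr p) \<partial>lborel) < ennreal \<delta>"
proof -
  \<comment> \<open>The factor from using the triangle inequality for p-th powers twice, on three
    errors of size at most \<open>\<delta>'\<close>.\<close>
  define C where "C = 2 powr p * (1 + 2 powr p * 2)"
  have C: "0 < C" by (simp add: C_def add_pos_nonneg)
  define \<delta>' where "\<delta>' = \<delta> / (2 * C)"
  have \<delta>': "0 < \<delta>'" using \<delta> C by (simp add: \<delta>'_def)
  obtain h where h: "continuous_on UNIV h" and h0: "\<And>x. R + 1 < norm x \<Longrightarrow> h x = 0"
    and gh: "(\<integral>\<^sup>+x. ennreal (\<bar>g x - h x\<bar> powr p) \<partial>lborel) < ennreal \<delta>'"
    using continuous_compact_support_dense_Lp[OF p _ fin supp \<delta>'] by auto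
  have [measurable]: "h \<in> borel_measurable borel" using h by (rule borel_measurable_continuous_onI)
  have g_int: "integrable lborel g"
    by (rule integrable_of_powr_integrable[OF p _ fin supp]) auto
  have h_int: "integrable lborel h"
  proof -
    obtain B where B: "0 \<le> B" "\<And>x. \<bar>h x\<bar> \<le> B" using continuous_vanishing_bounded[OF h h0] by blast
    have "integrable lborel (\<lambda>x. B * indicator (cball (0::'a) (R + 1)) x)"
      using emeasure_lborel_cball_finite[of "0::'a" "R + 1"] by (intro integrable_mult_right) simp
    then show ?thesis
    proof (rule Bochner_Integration.integrable_bound)
      show "AE x in lborel. norm (h x) \<le> norm (B * indicator (cball 0 (R + 1)) x)"
      proof (intro AE_I2)
        fix x
        show "norm (h x) \<le> norm (B * indicator (cball 0 (R + 1)) x)"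
          using B(1) B(2)[of x] h0[of x] by (cases "norm x \<le> R + 1") auto
      qed
    qed simp
  qed
  \<comment> \<open>Radius R + 2, since \<open>h\<close> lives in the ball of radius R + 1 and the
    mollification radius will be below 1.\<close>
  define V where "V = measure lborel (cball (0::'a) (R + 2))"
  define e where "e = (\<delta>' / (V + 1)) powr (1 / p)"
  have e: "0 < e" "e powr p * V \<le> \<delta>'"
  proof -
    have V: "0 \<le> V" by (simp add: V_def)
    show "0 < e" using \<delta>' V by (simp add: e_def)
    have "e powr p = \<delta>' / (V + 1)" using p \<delta>' V by (simp add: e_def powr_powr)
    moreover have "\<delta>' / (V + 1) * V \<le> \<delta>'" using \<delta>' V by (simp add: field_simps)
    ultimately show "e powr p * V \<le> \<delta>'" by simp
  qed
  obtain d where d: "0 < d" "\<And>x y. norm (x - y) < d \<Longrightarrow> \<bar>h x - h y\<bar> < e"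
    using continuous_vanishing_uniformly_continuous[OF h h0 e(1)] by blast
  show ?thesis
  proof (rule that[of "min d 1"])
    fix \<epsilon> :: real and \<psi> :: "'a \<Rightarrow> real" assume \<epsilon>: "\<epsilon> < min d 1" and \<psi>: "mollifier \<epsilon> \<psi>"
    note [measurable] = mollifier_measurable[OF \<psi>]
    have [measurable]: "mollify \<psi> g \<in> borel_measurable borel" "mollify \<psi> h \<in> borel_measurable borel"
      using continuous_on_Ck[OF Ck_mollify[OF \<psi> g_int]] continuous_on_Ck[OF Ck_mollify[OF \<psi> h_int]]
      by (auto intro: borel_measurable_continuous_onI)
    have 1: "(\<integral>\<^sup>+x. ennreal (\<bar>h x - mollify \<psi> h x\<bar> powr p) \<partial>lborel) \<le> ennreal \<delta>'"
    proof -
      have "(\<integral>\<^sup>+x. ennreal (\<bar>h x - mollify \<psi> h x\<bar> powr p) \<partial>lborel)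
          \<le> (\<integral>\<^sup>+x. ennreal (e powr p) * indicator (cball (0::'a) (R + 2)) x \<partial>lborel)"
      proof (rule nn_integral_mono)
        fix x :: 'a
        show "ennreal (\<bar>h x - mollify \<psi> h x\<bar> powr p) \<le> ennreal (e powr p) * indicator (cball (0::'a) (R + 2)) x"
        proof (cases "norm x \<le> R + 2")
          case True
          have "\<bar>h x - mollify \<psi> h x\<bar> \<le> e"
            using d(2) \<epsilon> by (intro mollify_uniform_approx[OF \<psi> h_int]) (meson le_less_trans less_imp_le min_less_iff_conj)
          then show ?thesis using True p by (auto intro!: ennreal_leI powr_mono2)
        next
          case False
          have "h y = 0" if "norm (x - y) \<le> \<epsilon>" for y
            using False that \<epsilon> norm_triangle_ineq2[of x "x - y"] by (intro h0) auto
          then have "mollify \<psi> h x = 0" by (intro mollify_vanishes[OF \<psi>]) auto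
          moreover have "h x = 0" using False by (intro h0) auto
          ultimately show ?thesis using p by simp
        qed
      qed
      also have "\<dots> = ennreal (e powr p) * ennreal V"
      proof -
        have "emeasure lborel (cball (0::'a) (R + 2)) \<noteq> top"
          using emeasure_lborel_cball_finite[of "0::'a" "R + 2"] by simp
        then show ?thesis
          unfolding V_def by (subst nn_integral_cmult_indicator) (auto simp: emeasure_eq_ennreal_measure)
      qed
      also have "\<dots> \<le> ennreal \<delta>'" using e by (subst ennreal_mult[symmetric]) (auto simp: V_def intro: ennreal_leI)
      finally show ?thesis .
    qed
    have 2: "(\<integral>\<^sup>+x. ennreal (\<bar>mollify \<psi> (\<lambda>x. h x - g x) x\<bar> powr p) \<partial>lborel) \<le> ennreal \<delta>'"
      using nn_integral_mollify_le[OF p \<psi>, of "\<lambda>x. h x - g x"] g_int h_int gh by (auto simp: abs_minus_commute)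
    have "(\<integral>\<^sup>+x. ennreal (\<bar>g x - mollify \<psi> g x\<bar> powr p) \<partial>lborel)
      = (\<integral>\<^sup>+x. ennreal (\<bar>(g x - h x) + ((h x - mollify \<psi> h x) + mollify \<psi> (\<lambda>x. h x - g x) x)\<bar> powr p) \<partial>lborel)"
      by (simp add: mollify_diff[OF \<psi> h_int g_int])
    also have "\<dots> \<le> ennreal (2 powr p) * ((\<integral>\<^sup>+x. ennreal (\<bar>g x - h x\<bar> powr p) \<partial>lborel) +
        (\<integral>\<^sup>+x. ennreal (\<bar>(h x - mollify \<psi> h x) + mollify \<psi> (\<lambda>x. h x - g x) x\<bar> powr p) \<partial>lborel))"
      by (intro nn_integral_add_powr_le p) (auto simp: mollify_diff[OF \<psi> h_int g_int])
    also have "\<dots> \<le> ennreal (2 powr p) * (ennreal \<delta>' + ennreal (2 powr p) * (ennreal \<delta>' + ennreal \<delta>'))"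
    proof (intro mult_left_mono add_mono order_trans[OF nn_integral_add_powr_le[OF p]] 1 2)
    qed (use gh in \<open>auto simp: mollify_diff[OF \<psi> h_int g_int]\<close>)
    also have "\<dots> = ennreal (C * \<delta>')"
    proof -
      have "C * \<delta>' = 2 powr p * (\<delta>' + 2 powr p * (\<delta>' + \<delta>'))" by (simp add: C_def algebra_simps)
      moreover have "ennreal \<delta>' + ennreal \<delta>' = ennreal (\<delta>' + \<delta>')"
        using \<delta>' by (intro ennreal_plus[symmetric]) auto
      moreover have "ennreal (2 powr p) * ennreal (\<delta>' + \<delta>') = ennreal (2 powr p * (\<delta>' + \<delta>'))"
        using \<delta>' by (intro ennreal_mult[symmetric]) auto
      moreover have "ennreal \<delta>' + ennreal (2 powr p * (\<delta>' + \<delta>')) = ennreal (\<delta>' + 2 powr p * (\<delta>' + \<delta>'))"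
        using \<delta>' by (intro ennreal_plus[symmetric]) auto
      moreover have "ennreal (2 powr p) * ennreal (\<delta>' + 2 powr p * (\<delta>' + \<delta>')) =
          ennreal (2 powr p * (\<delta>' + 2 powr p * (\<delta>' + \<delta>')))"
        using \<delta>' by (intro ennreal_mult[symmetric]) auto
      ultimately show ?thesis by presburger
    qed
    also have "\<dots> < ennreal \<delta>" using \<delta> C by (intro ennreal_lessI) (auto simp: \<delta>'_def)
    finally show "(\<integral>\<^sup>+x. ennreal (\<bar>g x - mollify \<psi> g x\<bar> powr p) \<partial>lborel) < ennreal \<delta>" .
  qed (use d in auto)
qed

section \<open>Distance to the boundary\<close>

locale bounded_open_set =
  fixes \<Omega> :: "'a::euclidean_space set"
  assumes nonempty: "\<Omega> \<noteq> {}" and bounded: "bounded \<Omega>" and open_domain: "open \<Omega>"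
begin

abbreviation d :: "'a \<Rightarrow> real" where "d \<equiv> bdist \<Omega>"

lemma vol_pos: "0 < unit_ball_vol (real DIM('a))" by simp

lemma domain_measurable [measurable]: "\<Omega> \<in> sets borel"
  using open_domain by simp

lemma domain_ball_measurable [measurable]:
  "\<Omega> \<inter> ball z r \<in> sets borel" "\<Omega> \<inter> cball z r \<in> sets borel"
  using open_domain by auto

text \<open>A bounded set misses the far points of the ray, and the segment to such a point crosses
  the boundary. Two opposite directions yield a boundary of positive diameter; otherwise the
  codimension conditions, which concern radii below the diameter, would be empty.\<close>

lemma frontier_on_ray: 
  assumes "x \<in> \<Omega>" "v \<noteq> 0"
  obtains t where "0 < t" "x + t *\<^sub>R v \<in> frontier \<Omega>"
proof -
  obtain B where B: "\<And>y. y \<in> \<Omega> \<Longrightarrow> norm y \<le> B" using bounded unfolding bounded_iff by blast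
  define T where "T = (B + norm x + 1) / norm v"
  have "0 \<le> B" using B[OF assms(1)] norm_ge_zero order_trans by blast
  then have T: "0 < T" using assms(2) by (auto simp: T_def add_nonneg_pos)
  have "norm (x + T *\<^sub>R v) \<ge> norm (T *\<^sub>R v) - norm x"
    using norm_triangle_ineq2[of "T *\<^sub>R v" "- x"] by (simp add: add.commute)
  moreover have "norm (T *\<^sub>R v) = B + norm x + 1" using T assms(2) \<open>0 \<le> B\<close> by (simp add: T_def)
  ultimately have "x + T *\<^sub>R v \<notin> \<Omega>" using B[of "x + T *\<^sub>R v"] by auto
  then have "closed_segment x (x + T *\<^sub>R v) \<inter> frontier \<Omega> \<noteq> {}"
    using assms(1) by (intro connected_Int_frontier) auto
  then obtain u where u: "0 \<le> u" "u \<le> 1" "(1 - u) *\<^sub>R x + u *\<^sub>R (x + T *\<^sub>R v) \<in> frontier \<Omega>"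
    by (auto simp: closed_segment_def)
  have "(1 - u) *\<^sub>R x + u *\<^sub>R (x + T *\<^sub>R v) = x + (u * T) *\<^sub>R v" by (simp add: algebra_simps)
  with u have f: "x + (u * T) *\<^sub>R v \<in> frontier \<Omega>" by simp
  moreover have "u \<noteq> 0"
  proof
    assume "u = 0"
    then show False using f assms(1) open_domain by (simp add: frontier_def interior_open)
  qed
  ultimately show ?thesis using that[of "u * T"] T u by auto
qed

lemma frontier_nonempty: "frontier \<Omega> \<noteq> {}"
proof -
  obtain x where "x \<in> \<Omega>" using nonempty by auto
  then show ?thesis using frontier_on_ray[of x "SOME b. b \<in> Basis"] nonzero_Basis SOME_Basis by blast
qed

lemma frontier_compact: "compact (frontier \<Omega>)"
  using bounded by (simp add: compact_frontier_bounded)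

lemma diameter_frontier_pos: "0 < diameter (frontier \<Omega>)"
proof -
  obtain x where x: "x \<in> \<Omega>" using nonempty by auto
  obtain b :: 'a where b: "b \<in> Basis" using SOME_Basis by blast
  then have b0: "b \<noteq> 0" "norm b = 1" by auto
  obtain t where t: "0 < t" "x + t *\<^sub>R b \<in> frontier \<Omega>" using frontier_on_ray[OF x b0(1)] by blast
  obtain u where u: "0 < u" "x + u *\<^sub>R (- b) \<in> frontier \<Omega>" using frontier_on_ray[OF x, of "- b"] b0 by auto
  have "dist (x + t *\<^sub>R b) (x + u *\<^sub>R (- b)) = norm ((t + u) *\<^sub>R b)"
    by (simp add: dist_norm algebra_simps)
  also have "\<dots> = t + u" using t u b0 by simp
  finally have "t + u \<le> diameter (frontier \<Omega>)"
    using diameter_bounded_bound[OF compact_imp_bounded[OF frontier_compact] t(2) u(2)] by simp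
  then show ?thesis using t u by linarith
qed

lemma d_pos: "x \<in> \<Omega> \<Longrightarrow> 0 < d x"
  unfolding bdist_def using open_domain frontier_nonempty
  by (intro infdist_pos_not_in_closed) (auto simp: frontier_def interior_open)

lemma d_lipschitz: "\<bar>d x - d y\<bar> \<le> norm (x - y)"
  unfolding bdist_def using infdist_triangle_abs[of x "frontier \<Omega>" y] by (simp add: dist_norm)

lemma d_le_dist: "z \<in> frontier \<Omega> \<Longrightarrow> d x \<le> norm (x - z)"
  unfolding bdist_def using infdist_le[of z "frontier \<Omega>" x] by (simp add: dist_norm)

lemma d_attained: obtains z where "z \<in> frontier \<Omega>" "d x = norm (x - z)"
  unfolding bdist_def using infdist_attains_inf[of "frontier \<Omega>" x] frontier_nonempty
  by (auto simp: dist_norm frontier_closed)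

lemma continuous_d: "continuous_on A d"
  unfolding bdist_def[abs_def] by (intro continuous_intros)

lemma d_measurable [measurable]: "d \<in> borel_measurable borel"
  by (rule borel_measurable_continuous_onI[OF continuous_d])

text \<open>A segment that leaves the domain meets the boundary, at a distance of at least
  \<open>d x\<close> from its start.\<close>

lemma mem_domain_of_near:
  assumes "x \<in> \<Omega>" "norm (x - y) < d x"
  shows "y \<in> \<Omega>"
proof (rule ccontr)
  assume "y \<notin> \<Omega>"
  then have "closed_segment x y \<inter> frontier \<Omega> \<noteq> {}"
    using assms(1) by (intro connected_Int_frontier) auto
  then obtain z where z: "z \<in> closed_segment x y" "z \<in> frontier \<Omega>" by auto
  have "norm (x - z) \<le> norm (x - y)" using segment_bound1[OF z(1)] by (simp add: norm_minus_commute)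
  then show False using d_le_dist[OF z(2), of x] assms by linarith
qed

lemma emeasure_ball_vol: "0 \<le> r \<Longrightarrow> emeasure lborel (ball (x::'a) r) = ennreal (unit_ball_vol (real DIM('a)) * r powr real DIM('a))"
  by (cases "r = 0") (auto simp: emeasure_ball powr_realpow)

lemma emeasure_cball_vol: "0 \<le> r \<Longrightarrow> emeasure lborel (cball (x::'a) r) = ennreal (unit_ball_vol (real DIM('a)) * r powr real DIM('a))"
  by (cases "r = 0") (auto simp: emeasure_cball powr_realpow)

lemma measure_ball_vol: "0 \<le> r \<Longrightarrow> measure lebesgue (ball (x::'a) r) = unit_ball_vol (real DIM('a)) * r powr real DIM('a)"
  by (cases "r = 0") (auto simp: content_ball powr_realpow)

section \<open>Assouad codimensions and integrals of powers of the distance\<close>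

lemma closed_nbhd_measurable [measurable]: "closed_nbhd (frontier \<Omega>) r \<in> sets borel"
proof -
  have "closed_nbhd (frontier \<Omega>) r = {x. d x \<le> r}" by (simp add: closed_nbhd_def bdist_def)
  then show ?thesis by simp
qed

lemma measure_closed_nbhd:
  "ennreal (measure lebesgue (closed_nbhd (frontier \<Omega>) r \<inter> ball z R)) =
   emeasure lborel (closed_nbhd (frontier \<Omega>) r \<inter> ball z R)"
proof -
  have "emeasure lborel (closed_nbhd (frontier \<Omega>) r \<inter> ball z R) \<le> emeasure lborel (ball z R)"
    by (intro emeasure_mono) auto
  also have "\<dots> < \<infinity>" by (rule emeasure_lborel_ball_finite)
  finally show ?thesis by (subst emeasure_eq_ennreal_measure) (auto simp: measure_completion)
qed

text \<open>The supremum yields an admissible exponent strictly above \<alpha>, and this gap makes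
  the later dyadic sums converge. The case r = R is included at no cost because C \<ge> 1. An
  exponent of at most the dimension N ensures \<alpha> < N, so that powers with exponent N -
  \<alpha> increase.\<close>

lemma lower_codim_obtain:
  assumes "ereal \<alpha> < lower_assouad_codim (frontier \<Omega>)"
  obtains q C where "\<alpha> < q" "0 \<le> q" "1 \<le> C" "q \<le> real DIM('a)"
    "\<And>z r R. z \<in> frontier \<Omega> \<Longrightarrow> 0 < r \<Longrightarrow> r \<le> R \<Longrightarrow> R < diameter (frontier \<Omega>) \<Longrightarrow>
      emeasure lborel (closed_nbhd (frontier \<Omega>) r \<inter> ball z R) \<le> ennreal (C * unit_ball_vol (real DIM('a)) * R powr (real DIM('a) - q) * r powr q)"
proof -
  obtain q C where q: "\<alpha> < q" "0 \<le> q" and C: "1 \<le> C"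
    and *: "\<And>z r R. z \<in> frontier \<Omega> \<Longrightarrow> 0 < r \<Longrightarrow> r < R \<Longrightarrow> R < diameter (frontier \<Omega>) \<Longrightarrow>
        measure lebesgue (closed_nbhd (frontier \<Omega>) r \<inter> ball z R)
          \<le> C * measure lebesgue (ball z R) * (r / R) powr q"
    using assms unfolding lower_assouad_codim_def less_SUP_iff by auto
  have main: "emeasure lborel (closed_nbhd (frontier \<Omega>) r \<inter> ball z R) \<le> ennreal (C * unit_ball_vol (real DIM('a)) * R powr (real DIM('a) - q) * r powr q)"
    if z: "z \<in> frontier \<Omega>" and r: "0 < r" "r \<le> R" "R < diameter (frontier \<Omega>)" for z r R
  proof -
    have eq: "C * (unit_ball_vol (real DIM('a)) * R powr real DIM('a)) * (r / R) powr q = C * unit_ball_vol (real DIM('a)) * R powr (real DIM('a) - q) * r powr q"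
      using r by (simp add: powr_divide powr_diff)
    show ?thesis
    proof (cases "r < R")
      case True
      have "measure lebesgue (closed_nbhd (frontier \<Omega>) r \<inter> ball z R) \<le> C * unit_ball_vol (real DIM('a)) * R powr (real DIM('a) - q) * r powr q"
        using *[OF z r(1) True r(3)] r unfolding measure_ball_vol[OF order_trans[OF less_imp_le[OF r(1)] r(2)]] eq by simp
      then show ?thesis unfolding measure_closed_nbhd[symmetric] by (rule ennreal_leI)
    next
      case False
      then have [simp]: "r = R" using r by simp
      have "emeasure lborel (closed_nbhd (frontier \<Omega>) r \<inter> ball z R) \<le> emeasure lborel (ball z R)"
        by (intro emeasure_mono) auto
      also have "\<dots> = ennreal (1 * (unit_ball_vol (real DIM('a)) * R powr real DIM('a)))" using r by (simp add: emeasure_ball_vol)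
      also have "\<dots> \<le> ennreal (C * (unit_ball_vol (real DIM('a)) * R powr real DIM('a)))"
        using C vol_pos by (intro ennreal_leI mult_right_mono) auto
      also have "C * (unit_ball_vol (real DIM('a)) * R powr real DIM('a)) = C * unit_ball_vol (real DIM('a)) * R powr (real DIM('a) - q) * r powr q"
        using r by (simp flip: powr_add)
      finally show ?thesis .
    qed
  qed
  \<comment> \<open>the neighbourhood of radius \<open>t R\<close> contains a ball of that radius\<close>
  have "q \<le> real DIM('a)"
  proof (rule ccontr)
    assume "\<not> q \<le> real DIM('a)"
    \<comment> \<open>Chosen with t^(N - q) = 2 C, which contradicts the bound by \<open>C\<close>;
      the exponent is negative and 2 C > 1, hence t < 1.\<close>
    define t where "t = (2 * C) powr (1 / (real DIM('a) - q))"
    have t: "0 < t" "t < 1"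
      using C \<open>\<not> q \<le> real DIM('a)\<close> powr_less_mono[of "1 / (real DIM('a) - q)" 0 "2 * C"] by (auto simp: t_def divide_less_0_iff)
    obtain z where z: "z \<in> frontier \<Omega>" using frontier_nonempty by auto
    define R where "R = diameter (frontier \<Omega>) / 2"
    have R: "0 < R" "R < diameter (frontier \<Omega>)" using diameter_frontier_pos by (auto simp: R_def)
    have "ball z (t * R) \<subseteq> closed_nbhd (frontier \<Omega>) (t * R) \<inter> ball z R"
    proof
      fix y assume "y \<in> ball z (t * R)"
      then have y: "norm (y - z) < t * R" by (simp add: dist_norm norm_minus_commute)
      moreover have "t * R < 1 * R" using t R by (intro mult_strict_right_mono) auto
      ultimately show "y \<in> closed_nbhd (frontier \<Omega>) (t * R) \<inter> ball z R"
        using d_le_dist[OF z, of y] by (simp add: closed_nbhd_def bdist_def dist_norm norm_minus_commute)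
    qed
    then have "emeasure lborel (ball z (t * R)) \<le> emeasure lborel (closed_nbhd (frontier \<Omega>) (t * R) \<inter> ball z R)"
      by (intro emeasure_mono) auto
    also have "\<dots> \<le> ennreal (C * unit_ball_vol (real DIM('a)) * R powr (real DIM('a) - q) * (t * R) powr q)"
      using t R z by (intro main) (auto simp: mult_le_cancel_right1)
    also have "emeasure lborel (ball z (t * R)) = ennreal (unit_ball_vol (real DIM('a)) * (t * R) powr real DIM('a))"
      using t R by (simp add: emeasure_ball_vol)
    finally have "unit_ball_vol (real DIM('a)) * (t * R) powr real DIM('a) \<le> C * unit_ball_vol (real DIM('a)) * R powr (real DIM('a) - q) * (t * R) powr q"
      using C vol_pos by (subst (asm) ennreal_le_iff) auto
    also have "\<dots> = unit_ball_vol (real DIM('a)) * (C * R powr real DIM('a) * t powr q)"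
      using t R by (simp add: powr_mult powr_diff)
    finally have "(t * R) powr real DIM('a) \<le> C * R powr real DIM('a) * t powr q" using vol_pos by simp
    then have "t powr real DIM('a) \<le> C * t powr q" using t R by (simp add: powr_mult mult_ac)
    then have "t powr (real DIM('a) - q) \<le> C" using t by (simp add: powr_diff field_simps)
    moreover have "t powr (real DIM('a) - q) = 2 * C" using C \<open>\<not> q \<le> real DIM('a)\<close> by (simp add: t_def powr_powr)
    ultimately show False using C by simp
  qed
  with q C main that show ?thesis by blast
qed

text \<open>The Aikawa condition for the boundary. Inside the ball the sublevel sets of
  \<open>d\<close> are neighbourhoods of the boundary whose measure is of order r^q, and \<alpha> <
  q lets the dyadic sum converge.\<close>

lemma aikawa_boundary_ball:
  assumes "0 \<le> \<alpha>" "ereal \<alpha> < lower_assouad_codim (frontier \<Omega>)"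
  obtains K where "0 < K"
    "\<And>z R. z \<in> frontier \<Omega> \<Longrightarrow> 0 < R \<Longrightarrow> R < diameter (frontier \<Omega>) \<Longrightarrow>
      (\<integral>\<^sup>+y. ennreal (d y powr - \<alpha>) * indicator (\<Omega> \<inter> ball z R) y \<partial>lborel) \<le> ennreal (K * R powr (real DIM('a) - \<alpha>))"
proof -
  obtain q C where q: "\<alpha> < q" "0 \<le> q" and C: "1 \<le> C" "q \<le> real DIM('a)"
    and *: "\<And>z r R. z \<in> frontier \<Omega> \<Longrightarrow> 0 < r \<Longrightarrow> r \<le> R \<Longrightarrow> R < diameter (frontier \<Omega>) \<Longrightarrow>
      emeasure lborel (closed_nbhd (frontier \<Omega>) r \<inter> ball z R) \<le> ennreal (C * unit_ball_vol (real DIM('a)) * R powr (real DIM('a) - q) * r powr q)"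
    by (fact lower_codim_obtain[OF assms(2)])
  define K where "K = 2 powr \<bar>\<alpha>\<bar> / (1 - 2 powr (\<alpha> - q)) * (C * unit_ball_vol (real DIM('a)))"
  have "2 powr (\<alpha> - q) < 1" using q powr_less_mono[of "\<alpha> - q" 0 "2::real"] by simp
  then have K: "0 < K" using C by (simp add: K_def)
  show ?thesis
  proof (rule that[OF K])
    fix z R assume z: "z \<in> frontier \<Omega>" and R: "0 < R" "R < diameter (frontier \<Omega>)"
    \<comment> \<open>The value 0 elsewhere turns the positive sublevel sets into the pieces of the
      domain inside the ball.\<close>
    define g where "g y = (if y \<in> \<Omega> \<inter> ball z R then d y else 0)" for y
    have [measurable]: "g \<in> borel_measurable lborel" unfolding g_def by (rule measurable_If_set) auto
    have set: "{y \<in> space lborel. 0 < g y \<and> g y \<le> r} = \<Omega> \<inter> ball z R \<inter> {y. d y \<le> r}" for r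
      using d_pos by (auto simp: g_def)
    have "(\<integral>\<^sup>+y. ennreal (d y powr - \<alpha>) * indicator (\<Omega> \<inter> ball z R) y \<partial>lborel)
      = (\<integral>\<^sup>+y\<in>{y \<in> space lborel. 0 < g y \<and> g y \<le> R}. ennreal (g y powr - \<alpha>) \<partial>lborel)"
      unfolding set
    proof (intro nn_integral_cong)
      fix y
      have "d y \<le> R" if "y \<in> ball z R"
        using d_le_dist[OF z, of y] that by (simp add: dist_norm norm_minus_commute)
      then show "ennreal (d y powr - \<alpha>) * indicator (\<Omega> \<inter> ball z R) y =
          ennreal (g y powr - \<alpha>) * indicator (\<Omega> \<inter> ball z R \<inter> {y. d y \<le> R}) y"
        by (auto simp: g_def indicator_def)
    qed
    also have "\<dots> \<le> ennreal (2 powr \<bar>\<alpha>\<bar> / (1 - 2 powr (\<alpha> - q)) * (C * unit_ball_vol (real DIM('a)) * R powr (real DIM('a) - q)) * R powr (q - \<alpha>))"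
    proof (rule nn_integral_powr_sublevel)
      fix r assume r: "0 < r" "r \<le> R"
      have "emeasure lborel {y \<in> space lborel. 0 < g y \<and> g y \<le> r} \<le> emeasure lborel (closed_nbhd (frontier \<Omega>) r \<inter> ball z R)"
      proof (rule emeasure_mono)
        show "{y \<in> space lborel. 0 < g y \<and> g y \<le> r} \<subseteq> closed_nbhd (frontier \<Omega>) r \<inter> ball z R"
          unfolding set by (auto simp: closed_nbhd_def bdist_def)
      qed simp
      also note *[OF z r R(2)]
      finally show "emeasure lborel {y \<in> space lborel. 0 < g y \<and> g y \<le> r} \<le> ennreal (C * unit_ball_vol (real DIM('a)) * R powr (real DIM('a) - q) * r powr q)" .
    qed (use R q C in auto)
    also have "2 powr \<bar>\<alpha>\<bar> / (1 - 2 powr (\<alpha> - q)) * (C * unit_ball_vol (real DIM('a)) * R powr (real DIM('a) - q)) * R powr (q - \<alpha>) = K * R powr (real DIM('a) - \<alpha>)"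
    proof -
      have "R powr (real DIM('a) - \<alpha>) = R powr (real DIM('a) - q) * R powr (q - \<alpha>)" by (simp flip: powr_add)
      then show ?thesis by (simp add: K_def)
    qed
    finally show "(\<integral>\<^sup>+y. ennreal (d y powr - \<alpha>) * indicator (\<Omega> \<inter> ball z R) y \<partial>lborel) \<le> ennreal (K * R powr (real DIM('a) - \<alpha>))" .
  qed
qed

lemma emeasure_domain_finite: "emeasure lborel \<Omega> < \<infinity>"
  using emeasure_bounded_finite[OF bounded] by simp

text \<open>Near the boundary, compactness leaves finitely many balls of the previous estimate;
  elsewhere the power is bounded and the domain has finite measure.\<close>

lemma nn_integral_d_powr_finite:
  assumes \<alpha>: "0 \<le> \<alpha>" "ereal \<alpha> < lower_assouad_codim (frontier \<Omega>)"
  shows "(\<integral>\<^sup>+y. ennreal (d y powr - \<alpha>) * indicator \<Omega> y \<partial>lborel) < \<infinity>"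
proof -
  obtain K where K: "0 < K"
    "\<And>z R. z \<in> frontier \<Omega> \<Longrightarrow> 0 < R \<Longrightarrow> R < diameter (frontier \<Omega>) \<Longrightarrow>
      (\<integral>\<^sup>+y. ennreal (d y powr - \<alpha>) * indicator (\<Omega> \<inter> ball z R) y \<partial>lborel) \<le> ennreal (K * R powr (real DIM('a) - \<alpha>))"
    by (fact aikawa_boundary_ball[OF \<alpha>])
  define R where "R = diameter (frontier \<Omega>) / 2"
  have R: "0 < R" "R < diameter (frontier \<Omega>)" using diameter_frontier_pos by (auto simp: R_def)
  \<comment> \<open>Half radii: a point with d < R / 2 lies within \<open>R\<close> of the centre of
    the small ball that contains its nearest boundary point.\<close>
  have cov: "frontier \<Omega> \<subseteq> (\<Union>z\<in>frontier \<Omega>. ball z (R / 2))"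
    using R by (auto intro: bexI[rotated])
  obtain F where F: "F \<subseteq> frontier \<Omega>" "finite F" "frontier \<Omega> \<subseteq> (\<Union>z\<in>F. ball z (R / 2))"
    by (rule compactE_image[OF frontier_compact _ cov]) auto
  have "(\<integral>\<^sup>+y. ennreal (d y powr - \<alpha>) * indicator \<Omega> y \<partial>lborel) \<le>
    (\<integral>\<^sup>+y. ennreal ((R / 2) powr - \<alpha>) * indicator \<Omega> y + (\<Sum>z\<in>F. ennreal (d y powr - \<alpha>) * indicator (\<Omega> \<inter> ball z R) y) \<partial>lborel)"
  proof (rule nn_integral_mono)
    fix y
    show "ennreal (d y powr - \<alpha>) * indicator \<Omega> y \<le>
      ennreal ((R / 2) powr - \<alpha>) * indicator \<Omega> y + (\<Sum>z\<in>F. ennreal (d y powr - \<alpha>) * indicator (\<Omega> \<inter> ball z R) y)"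
    proof (cases "y \<in> \<Omega>")
      case True
      show ?thesis
      proof (cases "R / 2 \<le> d y")
        case True
        then have "d y powr - \<alpha> \<le> (R / 2) powr - \<alpha>" using R \<alpha> by (intro powr_mono2') auto
        then show ?thesis using \<open>y \<in> \<Omega>\<close> by (auto intro!: add_increasing2 ennreal_leI)
      next
        case False
        obtain w where w: "w \<in> frontier \<Omega>" "d y = norm (y - w)" using d_attained by blast
        then obtain z where z: "z \<in> F" "w \<in> ball z (R / 2)" using F by auto
        have "norm (z - y) \<le> norm (z - w) + norm (y - w)"
          using norm_triangle_ineq4[of "z - w" "y - w"] by simp
        then have "y \<in> ball z R" using z(2) w(2) False by (simp add: dist_norm)
        then have "ennreal (d y powr - \<alpha>) * indicator \<Omega> y \<le> (\<Sum>z\<in>{z}. ennreal (d y powr - \<alpha>) * indicator (\<Omega> \<inter> ball z R) y)"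
          using True by simp
        also have "\<dots> \<le> (\<Sum>z\<in>F. ennreal (d y powr - \<alpha>) * indicator (\<Omega> \<inter> ball z R) y)"
          using z F by (intro sum_mono2) auto
        finally show ?thesis by (rule add_increasing[rotated]) auto
      qed
    qed simp
  qed
  also have "\<dots> = ennreal ((R / 2) powr - \<alpha>) * emeasure lborel \<Omega> +
      (\<Sum>z\<in>F. \<integral>\<^sup>+y. ennreal (d y powr - \<alpha>) * indicator (\<Omega> \<inter> ball z R) y \<partial>lborel)"
    by (subst nn_integral_add) (auto simp: nn_integral_cmult_indicator nn_integral_sum
      intro!: borel_measurable_sum borel_measurable_times_ennreal borel_measurable_indicator)
  also have "\<dots> \<le> ennreal ((R / 2) powr - \<alpha>) * emeasure lborel \<Omega> + (\<Sum>z\<in>F. ennreal (K * R powr (real DIM('a) - \<alpha>)))"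
    using K(2) R F(1) by (intro add_left_mono sum_mono) auto
  also have "\<dots> < \<infinity>"
    using emeasure_domain_finite K by (simp add: ennreal_mult_less_top ennreal_of_nat_eq_real_of_nat)
  finally show ?thesis .
qed

text \<open>By r \<ge> d(x)/2, a small ball lies in the ball of radius 4 r about the boundary point
  nearest to \<open>x\<close>, since 2 r + r < 4 r. Once 4 r reaches the diameter \<open>D\<close>
  of the boundary, the total integral serves as a bound, because (4 r / D)^(N - \<alpha>) \<ge>
  1.\<close>

lemma aikawa_ball:
  assumes \<alpha>: "0 \<le> \<alpha>" "ereal \<alpha> < lower_assouad_codim (frontier \<Omega>)"
  obtains K where "0 < K"
    "\<And>x r. x \<in> \<Omega> \<Longrightarrow> d x / 2 \<le> r \<Longrightarrow>
      (\<integral>\<^sup>+y. ennreal (d y powr - \<alpha>) * indicator (\<Omega> \<inter> cball x r) y \<partial>lborel) \<le> ennreal (K * r powr (real DIM('a) - \<alpha>))"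
proof -
  obtain K where K: "0 < K"
    "\<And>z R. z \<in> frontier \<Omega> \<Longrightarrow> 0 < R \<Longrightarrow> R < diameter (frontier \<Omega>) \<Longrightarrow>
      (\<integral>\<^sup>+y. ennreal (d y powr - \<alpha>) * indicator (\<Omega> \<inter> ball z R) y \<partial>lborel) \<le> ennreal (K * R powr (real DIM('a) - \<alpha>))"
    by (fact aikawa_boundary_ball[OF \<alpha>])
  obtain I where I: "0 \<le> I" "(\<integral>\<^sup>+y. ennreal (d y powr - \<alpha>) * indicator \<Omega> y \<partial>lborel) = ennreal I"
    using nn_integral_d_powr_finite[OF \<alpha>] by (cases "\<integral>\<^sup>+y. ennreal (d y powr - \<alpha>) * indicator \<Omega> y \<partial>lborel") auto
  have aN: "\<alpha> \<le> real DIM('a)" by (rule lower_codim_obtain[OF \<alpha>(2)]) linarith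
  define D where "D = diameter (frontier \<Omega>)"
  have D: "0 < D" using diameter_frontier_pos by (simp add: D_def)
  define K' where "K' = K * 4 powr (real DIM('a) - \<alpha>) + I * (4 / D) powr (real DIM('a) - \<alpha>)"
  have K': "0 < K'" using K I D by (simp add: K'_def add_pos_nonneg)
  show ?thesis
  proof (rule that[OF K'])
    fix x r assume x: "x \<in> \<Omega>" and r: "d x / 2 \<le> r"
    have r0: "0 < r" using r d_pos[OF x] by linarith
    show "(\<integral>\<^sup>+y. ennreal (d y powr - \<alpha>) * indicator (\<Omega> \<inter> cball x r) y \<partial>lborel) \<le> ennreal (K' * r powr (real DIM('a) - \<alpha>))"
    proof (cases "4 * r < D")
      case True
      obtain z where z: "z \<in> frontier \<Omega>" "d x = norm (x - z)" using d_attained by blast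
      have sub: "\<Omega> \<inter> cball x r \<subseteq> \<Omega> \<inter> ball z (4 * r)"
      proof
        fix y assume y: "y \<in> \<Omega> \<inter> cball x r"
        have "norm (z - y) \<le> norm (x - z) + norm (x - y)"
          using norm_triangle_ineq4[of "x - y" "x - z"] by (simp add: norm_minus_commute)
        then show "y \<in> \<Omega> \<inter> ball z (4 * r)" using y z r r0 by (simp add: dist_norm)
      qed
      have "(\<integral>\<^sup>+y. ennreal (d y powr - \<alpha>) * indicator (\<Omega> \<inter> cball x r) y \<partial>lborel)
         \<le> (\<integral>\<^sup>+y. ennreal (d y powr - \<alpha>) * indicator (\<Omega> \<inter> ball z (4 * r)) y \<partial>lborel)"
        using sub by (intro nn_integral_mono mult_left_mono) (auto simp: indicator_def)
      also have "\<dots> \<le> ennreal (K * (4 * r) powr (real DIM('a) - \<alpha>))"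
        using K(2)[OF z(1), of "4 * r"] r0 True by (simp add: D_def)
      also have "\<dots> \<le> ennreal (K' * r powr (real DIM('a) - \<alpha>))"
        using I r0 by (intro ennreal_leI) (simp add: K'_def powr_mult distrib_right)
      finally show ?thesis .
    next
      case False
      have "(\<integral>\<^sup>+y. ennreal (d y powr - \<alpha>) * indicator (\<Omega> \<inter> cball x r) y \<partial>lborel)
         \<le> (\<integral>\<^sup>+y. ennreal (d y powr - \<alpha>) * indicator \<Omega> y \<partial>lborel)"
        by (intro nn_integral_mono mult_left_mono) (auto simp: indicator_def)
      also have "\<dots> = ennreal (I * 1)" using I by simp
      also have "\<dots> \<le> ennreal (I * ((4 / D) * r) powr (real DIM('a) - \<alpha>))"
        using I False D aN by (intro ennreal_leI mult_left_mono ge_one_powr_ge_zero) (auto simp: field_simps)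
      also have "\<dots> = ennreal (I * (4 / D) powr (real DIM('a) - \<alpha>) * r powr (real DIM('a) - \<alpha>))"
        using D r0 by (simp only: powr_mult mult.assoc)
      also have "\<dots> \<le> ennreal (K' * r powr (real DIM('a) - \<alpha>))"
        using K by (intro ennreal_leI mult_right_mono) (auto simp: K'_def)
      finally show ?thesis .
    qed
  qed
qed

text \<open>
  On a uniform curve from a point near \<open>z\<close> to a point far away, any point at distance \<open>r / 2\<close>
  from the start is a corkscrew point.
\<close>

lemma corkscrew:
  assumes "uniform_domain \<Omega>"
  obtains \<kappa> r0 where "0 < \<kappa>" "\<kappa> \<le> 1" "0 < r0"
    "\<And>z r. z \<in> frontier \<Omega> \<Longrightarrow> 0 < r \<Longrightarrow> r < r0 \<Longrightarrow> \<exists>y\<in>\<Omega>. norm (y - z) \<le> r \<and> \<kappa> * r \<le> d y"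
proof -
  obtain C where C: "1 \<le> C" and path: "\<forall>x\<in>\<Omega>. \<forall>y\<in>\<Omega>. \<exists>l\<ge>0. \<exists>\<gamma>.
        arc_length_parameterized \<gamma> l \<and> \<gamma> ` {0..l} \<subseteq> \<Omega> \<and> \<gamma> 0 = x \<and> \<gamma> l = y \<and>
        l \<le> C * norm (x - y) \<and>
        (\<forall>z\<in>\<gamma> ` {0..l}. bdist \<Omega> z \<ge> 1 / C * min (norm (z - x)) (norm (z - y)))"
    using assms unfolding uniform_domain_def by (elim conjE exE) (rule that)
  obtain a where a: "a \<in> \<Omega>" using nonempty by auto
  obtain e where e: "0 < e" "ball a e \<subseteq> \<Omega>" using open_domain a openE by blast
  obtain v :: 'a where v: "v \<in> Basis" using SOME_Basis by blast
  \<comment> \<open>Two points of the domain at distance e / 2: a ball of radius r < e / 4 cannot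
    contain both, so every start has a target at distance at least \<open>r\<close>.\<close>
  define b where "b = a + (e / 2) *\<^sub>R v"
  have D: "norm (a - b) = e / 2" using v e by (simp add: b_def)
  then have b: "b \<in> \<Omega>" using e by (intro subsetD[OF e(2)]) (simp add: dist_norm)
  show ?thesis
  proof (rule that[of "1 / (2 * C)" "e / 4"])
    fix z r assume z: "z \<in> frontier \<Omega>" and r: "0 < r" "r < e / 4"
    then have "z \<in> closure \<Omega>" by (simp add: frontier_def)
    then obtain x where x: "x \<in> \<Omega>" "norm (x - z) < r / 2"
      using r unfolding closure_approachable by (auto simp: dist_norm dest!: spec[of _ "r / 2"])
    have "\<exists>w\<in>\<Omega>. r \<le> norm (w - x)"
    proof (rule ccontr)
      assume "\<not> ?thesis"
      then have "norm (a - x) < r" "norm (b - x) < r" using a b by auto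
      then show False using norm_triangle_ineq4[of "a - x" "b - x"] D r by simp
    qed
    then obtain w where w: "w \<in> \<Omega>" "r \<le> norm (w - x)" by blast
    from bspec[OF bspec[OF path x(1)] w(1)]
    obtain l \<gamma> where l: "0 \<le> l" and g: "arc_length_parameterized \<gamma> l" "\<gamma> ` {0..l} \<subseteq> \<Omega>" "\<gamma> 0 = x" "\<gamma> l = w"
      "\<forall>z\<in>\<gamma> ` {0..l}. bdist \<Omega> z \<ge> 1 / C * min (norm (z - x)) (norm (z - w))"
      by (elim conjE exE) (rule that)
    have "continuous_on {0..l} \<gamma>" using g(1) by (simp add: arc_length_parameterized_def)
    then have "continuous_on {0..l} (\<lambda>t. norm (\<gamma> t - x))" by (intro continuous_intros)
    \<comment> \<open>The curve starts at distance 0 from \<open>x\<close> and ends at distance at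
      least \<open>r\<close>, so it passes through distance r / 2.\<close>
    then obtain t where t: "0 \<le> t" "t \<le> l" "norm (\<gamma> t - x) = r / 2"
      using IVT'[of "\<lambda>t. norm (\<gamma> t - x)" 0 "r / 2" l] l g(3,4) w r by auto
    define y where "y = \<gamma> t"
    have y: "y \<in> \<gamma> ` {0..l}" "norm (y - x) = r / 2" using t by (auto simp: y_def)
    have "norm (w - x) \<le> norm (y - w) + norm (y - x)"
      using norm_triangle_ineq4[of "y - x" "y - w"] by simp
    then have "r / 2 \<le> norm (y - w)" using w y(2) by linarith
    then have "1 / C * (r / 2) \<le> 1 / C * min (norm (y - x)) (norm (y - w))"
      using C y(2) by (intro mult_left_mono) auto
    also have "\<dots> \<le> d y" by (rule bspec[OF g(5) y(1)])
    finally have "1 / (2 * C) * r \<le> d y" by simp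
    moreover have "norm (y - z) \<le> r"
      using norm_triangle_ineq[of "y - x" "x - z"] y(2) x(2) by simp
    ultimately show "\<exists>y\<in>\<Omega>. norm (y - z) \<le> r \<and> 1 / (2 * C) * r \<le> d y"
      using y(1) g(2) by blast
  qed (use C e in auto)
qed

section \<open>Mass of boundary layers inside the domain\<close>

lemma upper_codim_obtain:
  assumes "upper_assouad_codim (frontier \<Omega>) < ereal \<sigma>"
  obtains q c where "q < \<sigma>" "0 \<le> q" "0 < c"
    "\<And>z r R. z \<in> frontier \<Omega> \<Longrightarrow> 0 < r \<Longrightarrow> r < R \<Longrightarrow> R < diameter (frontier \<Omega>) \<Longrightarrow>
      ennreal (c * unit_ball_vol (real DIM('a)) * R powr real DIM('a) * (r / R) powr q) \<le> emeasure lborel (closed_nbhd (frontier \<Omega>) r \<inter> ball z R)"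
proof -
  obtain q c where q: "q < \<sigma>" "0 \<le> q" and c: "0 < c"
    and *: "\<And>z r R. z \<in> frontier \<Omega> \<Longrightarrow> 0 < r \<Longrightarrow> r < R \<Longrightarrow> R < diameter (frontier \<Omega>) \<Longrightarrow>
        measure lebesgue (closed_nbhd (frontier \<Omega>) r \<inter> ball z R)
          \<ge> c * measure lebesgue (ball z R) * (r / R) powr q"
    using assms unfolding upper_assouad_codim_def INF_less_iff by auto
  show ?thesis
  proof (rule that[OF q c])
    fix z r R assume z: "z \<in> frontier \<Omega>" and r: "0 < r" "r < R" "R < diameter (frontier \<Omega>)"
    have "c * unit_ball_vol (real DIM('a)) * R powr real DIM('a) * (r / R) powr q \<le> measure lebesgue (closed_nbhd (frontier \<Omega>) r \<inter> ball z R)"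
      using *[OF z r] r unfolding measure_ball_vol[OF less_imp_le[OF order_less_trans[OF r(1,2)]]] by (simp add: mult.assoc)
    then show "ennreal (c * unit_ball_vol (real DIM('a)) * R powr real DIM('a) * (r / R) powr q) \<le> emeasure lborel (closed_nbhd (frontier \<Omega>) r \<inter> ball z R)"
      unfolding measure_closed_nbhd[symmetric] by (rule ennreal_leI)
  qed
qed

text \<open>Read for fixed \<open>x\<close>, the set carries the mass over which values are
  averaged. Read for fixed \<open>y\<close>, the same inequalities bound d(x) from below and confine
  \<open>x\<close> to a ball around \<open>y\<close> of radius comparable to d(y)/\<rho>.\<close>

definition layer :: "real \<Rightarrow> real \<Rightarrow> 'a \<Rightarrow> 'a set" where
  "layer \<kappa> \<rho> x = {y\<in>\<Omega>. \<kappa> * \<rho> * d x / 2 \<le> d y \<and> d y \<le> 2 * \<rho> * d x \<and> norm (x - y) \<le> 5 * d x}"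

text \<open>
  Each point of the boundary neighbourhood has a corkscrew ball inside the layer nearby. Integrating
  this over the neighbourhood and exchanging the order of integration replaces a covering argument.
\<close>

lemma layer_measure:
  assumes "uniform_domain \<Omega>" "upper_assouad_codim (frontier \<Omega>) < ereal \<sigma>"
  obtains q \<kappa> r0 c where "q < \<sigma>" "0 < \<kappa>" "\<kappa> \<le> 1" "0 < r0" "0 < c"
    "\<And>x \<rho>. x \<in> \<Omega> \<Longrightarrow> d x < r0 \<Longrightarrow> 0 < \<rho> \<Longrightarrow> \<rho> < 1 \<Longrightarrow>
      ennreal (c * \<rho> powr q * d x powr real DIM('a)) \<le> emeasure lborel (layer \<kappa> \<rho> x)"
proof -
  obtain q c where q: "q < \<sigma>" "0 \<le> q" and c: "0 < c"
    and E: "\<And>z r R. z \<in> frontier \<Omega> \<Longrightarrow> 0 < r \<Longrightarrow> r < R \<Longrightarrow> R < diameter (frontier \<Omega>) \<Longrightarrow>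
      ennreal (c * unit_ball_vol (real DIM('a)) * R powr real DIM('a) * (r / R) powr q) \<le> emeasure lborel (closed_nbhd (frontier \<Omega>) r \<inter> ball z R)"
    by (fact upper_codim_obtain[OF assms(2)])
  obtain \<kappa> r0 where \<kappa>: "0 < \<kappa>" "\<kappa> \<le> 1" "0 < r0" and cork:
    "\<And>z r. z \<in> frontier \<Omega> \<Longrightarrow> 0 < r \<Longrightarrow> r < r0 \<Longrightarrow> \<exists>y\<in>\<Omega>. norm (y - z) \<le> r \<and> \<kappa> * r \<le> d y"
    by (fact corkscrew[OF assms(1)])
  \<comment> \<open>(\<kappa> / 6)^N is the ratio of the volumes of balls of radius \<kappa> r / 2
    and 3 r.\<close>
  define c' where "c' = (\<kappa> / 6) powr real DIM('a) * c * unit_ball_vol (real DIM('a))"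
  show ?thesis
  proof (rule that[OF q(1) \<kappa>(1,2), of "min r0 (diameter (frontier \<Omega>))" c'])
    show "0 < min r0 (diameter (frontier \<Omega>))" using \<kappa> diameter_frontier_pos by simp
    show "0 < c'" using \<kappa> c vol_pos by (simp add: c'_def)
    fix x and \<rho> :: real assume x: "x \<in> \<Omega>" "d x < min r0 (diameter (frontier \<Omega>))" and \<rho>: "0 < \<rho>" "\<rho> < 1"
    define t r where "t = d x" and "r = \<rho> * t"
    have t: "0 < t" "t < r0" "t < diameter (frontier \<Omega>)" using x d_pos by (auto simp: t_def)
    have r: "0 < r" "r < t" using \<rho> t by (auto simp: r_def)
    obtain z where z: "z \<in> frontier \<Omega>" "t = norm (x - z)" using d_attained unfolding t_def by blast
    define T where "T = closed_nbhd (frontier \<Omega>) r \<inter> ball z t"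
    define S where "S = layer \<kappa> \<rho> x"
    have [measurable]: "T \<in> sets borel" unfolding T_def by measurable
    have S[measurable]: "S \<in> sets borel" unfolding S_def layer_def by measurable
    \<comment> \<open>The corkscrew point is taken at the boundary point nearest to
      \<open>w\<close>, and half of its clearance \<kappa> r is the radius of the ball. The distance
      from \<open>x\<close> adds up to at most t + t + 3 r, which explains the factor 5 in
      \<open>layer\<close>.\<close>
    have inner: "\<exists>y0. ball y0 (\<kappa> * r / 2) \<subseteq> {y\<in>S. norm (y - w) \<le> 3 * r}" if w: "w \<in> T" for w
    proof -
      have dw: "d w \<le> r" and wz: "norm (w - z) < t"
        using w by (auto simp: T_def closed_nbhd_def bdist_def dist_norm norm_minus_commute)
      obtain w' where w': "w' \<in> frontier \<Omega>" "d w = norm (w - w')" using d_attained by blast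
      obtain y0 where y0: "y0 \<in> \<Omega>" "norm (y0 - w') \<le> r" "\<kappa> * r \<le> d y0"
        using cork[OF w'(1) r(1)] r t by auto
      have kr: "0 < \<kappa> * r" "\<kappa> * r \<le> r" using \<kappa> r by (auto simp: mult_le_cancel_right1)
      show ?thesis
      proof (intro exI[of _ y0] subsetI)
        fix y assume "y \<in> ball y0 (\<kappa> * r / 2)"
        then have y: "norm (y0 - y) < \<kappa> * r / 2" by (simp add: dist_norm)
        have "y \<in> \<Omega>" using mem_domain_of_near[OF y0(1), of y] y y0 kr by linarith
        have 1: "\<kappa> * r / 2 \<le> d y" using d_lipschitz[of y0 y] y y0(3) by linarith
        have 2: "norm (y - w') \<le> r / 2 + r"
          using norm_triangle_ineq[of "y - y0" "y0 - w'"] y y0(2) kr by (simp add: norm_minus_commute)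
        then have 3: "d y \<le> 2 * r" using d_le_dist[OF w'(1), of y] r by linarith
        have 4: "norm (y - w) \<le> 3 * r"
          using norm_triangle_ineq4[of "y - w'" "w - w'"] 2 w'(2) dw r by simp
        have "norm (x - y) \<le> norm (x - z) + (norm (w - z) + norm (y - w))"
          using norm_triangle_ineq4[of "x - z" "y - z"] norm_triangle_ineq[of "y - w" "w - z"] by simp
        then have "norm (x - y) \<le> 5 * t" using z(2) wz 4 r by linarith
        then show "y \<in> {y\<in>S. norm (y - w) \<le> 3 * r}"
          using \<open>y \<in> \<Omega>\<close> 1 3 4 by (simp add: S_def layer_def r_def t_def mult_ac)
      qed
    qed
    have "ennreal (unit_ball_vol (real DIM('a)) * (\<kappa> * r / 2) powr real DIM('a)) * emeasure lborel T
        = (\<integral>\<^sup>+w. ennreal (unit_ball_vol (real DIM('a)) * (\<kappa> * r / 2) powr real DIM('a)) * indicator T w \<partial>lborel)"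
      by (simp add: nn_integral_cmult_indicator)
    also have "\<dots> \<le> (\<integral>\<^sup>+w. \<integral>\<^sup>+y. indicator S y * indicator (cball y (3 * r)) w \<partial>lborel \<partial>lborel)"
    proof (rule nn_integral_mono)
      fix w
      show "ennreal (unit_ball_vol (real DIM('a)) * (\<kappa> * r / 2) powr real DIM('a)) * indicator T w \<le> (\<integral>\<^sup>+y. indicator S y * indicator (cball y (3 * r)) w \<partial>lborel)"
      proof (cases "w \<in> T")
        case True
        then obtain y0 where y0: "ball y0 (\<kappa> * r / 2) \<subseteq> {y\<in>S. norm (y - w) \<le> 3 * r}" using inner by blast
        have "ennreal (unit_ball_vol (real DIM('a)) * (\<kappa> * r / 2) powr real DIM('a)) = emeasure lborel (ball y0 (\<kappa> * r / 2))"
          using \<kappa> r by (intro emeasure_ball_vol[symmetric]) auto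
        also have "\<dots> = (\<integral>\<^sup>+y. indicator (ball y0 (\<kappa> * r / 2)) y \<partial>lborel)" by simp
        also have "\<dots> \<le> (\<integral>\<^sup>+y. indicator S y * indicator (cball y (3 * r)) w \<partial>lborel)"
          using y0 by (intro nn_integral_mono) (auto simp: indicator_def dist_norm)
        finally show ?thesis using True by simp
      qed simp
    qed
    also have "\<dots> = (\<integral>\<^sup>+y. \<integral>\<^sup>+w. indicator S y * indicator (cball y (3 * r)) w \<partial>lborel \<partial>lborel)"
    proof (rule lborel_pair.Fubini')
      have "closed {z :: 'a \<times> 'a. dist (fst z) (snd z) \<le> 3 * r}"
        by (intro closed_Collect_le continuous_intros)
      then have "{z :: 'a \<times> 'a. dist (fst z) (snd z) \<le> 3 * r} \<in> sets (borel \<Otimes>\<^sub>M borel)"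
        unfolding borel_prod by simp
      then have [measurable]: "(\<lambda>z. indicator {z :: 'a \<times> 'a. dist (fst z) (snd z) \<le> 3 * r} z :: ennreal) \<in> borel_measurable (borel \<Otimes>\<^sub>M borel)"
        by simp
      have "(\<lambda>(y, w). indicator S y * indicator (cball y (3 * r)) w :: ennreal)
        = (\<lambda>z. indicator S (fst z) * indicator {z. dist (fst z) (snd z) \<le> 3 * r} z)"
        by (auto simp: indicator_def fun_eq_iff)
      then show "(\<lambda>(y, w). indicator S y * indicator (cball y (3 * r)) w :: ennreal) \<in> borel_measurable (lborel \<Otimes>\<^sub>M lborel)"
        by simp
    qed
    also have "\<dots> = (\<integral>\<^sup>+y. indicator S y * ennreal (unit_ball_vol (real DIM('a)) * (3 * r) powr real DIM('a)) \<partial>lborel)"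
      using r by (intro nn_integral_cong) (subst nn_integral_cmult_indicator, auto simp: emeasure_cball_vol)
    also have "\<dots> = emeasure lborel S * ennreal (unit_ball_vol (real DIM('a)) * (3 * r) powr real DIM('a))"
      by (simp add: nn_integral_multc)
    finally have A: "ennreal (unit_ball_vol (real DIM('a)) * (\<kappa> * r / 2) powr real DIM('a)) * emeasure lborel T \<le> emeasure lborel S * ennreal (unit_ball_vol (real DIM('a)) * (3 * r) powr real DIM('a))" .
    have B: "ennreal (c * unit_ball_vol (real DIM('a)) * t powr real DIM('a) * \<rho> powr q) \<le> emeasure lborel T"
      using E[OF z(1) r t(3)] t unfolding T_def by (simp add: r_def)
    \<comment> \<open>Finite measure lets the common volume factor be cancelled among reals.\<close>
    have "emeasure lborel S \<le> emeasure lborel \<Omega>" by (intro emeasure_mono) (auto simp: S_def layer_def)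
    then obtain m where m: "0 \<le> m" "emeasure lborel S = ennreal m"
      using emeasure_domain_finite by (cases "emeasure lborel S") auto
    have "ennreal (unit_ball_vol (real DIM('a)) * (\<kappa> * r / 2) powr real DIM('a)) * ennreal (c * unit_ball_vol (real DIM('a)) * t powr real DIM('a) * \<rho> powr q) \<le> ennreal m * ennreal (unit_ball_vol (real DIM('a)) * (3 * r) powr real DIM('a))"
      by (rule order_trans[OF mult_left_mono[OF B] A[unfolded m(2)]]) simp
    then have A1: "unit_ball_vol (real DIM('a)) * (\<kappa> * r / 2) powr real DIM('a) * (c * unit_ball_vol (real DIM('a)) * t powr real DIM('a) * \<rho> powr q) \<le> m * (unit_ball_vol (real DIM('a)) * (3 * r) powr real DIM('a))"
      using m(1) vol_pos c by (simp flip: ennreal_mult)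
    have eq: "(\<kappa> * r / 2) powr real DIM('a) = (\<kappa> / 6) powr real DIM('a) * (3 * r) powr real DIM('a)"
      using \<kappa> r by (simp flip: powr_mult)
    have A2: "unit_ball_vol (real DIM('a)) * (\<kappa> * r / 2) powr real DIM('a) * (c * unit_ball_vol (real DIM('a)) * t powr real DIM('a) * \<rho> powr q)
        = unit_ball_vol (real DIM('a)) * (3 * r) powr real DIM('a) * (c' * \<rho> powr q * t powr real DIM('a))"
      unfolding eq c'_def by (simp only: mult_ac)
    have "unit_ball_vol (real DIM('a)) * (3 * r) powr real DIM('a) * (c' * \<rho> powr q * t powr real DIM('a))
        \<le> unit_ball_vol (real DIM('a)) * (3 * r) powr real DIM('a) * m"
      using A1 unfolding A2 by (simp only: mult_ac)
    moreover have "0 < unit_ball_vol (real DIM('a)) * (3 * r) powr real DIM('a)"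
      using r vol_pos by (intro mult_pos_pos) auto
    ultimately have "c' * \<rho> powr q * t powr real DIM('a) \<le> m"
      by (rule mult_left_le_imp_le)
    then show "ennreal (c' * \<rho> powr q * d x powr real DIM('a)) \<le> emeasure lborel (layer \<kappa> \<rho> x)"
      using m by (simp add: S_def t_def ennreal_leI)
  qed
qed

end

section \<open>The fractional Hardy inequality\<close>

locale weighted_domain = bounded_open_set \<Omega> for \<Omega> :: "'a::euclidean_space set" +
  fixes s p \<alpha> \<beta> :: real
  assumes s: "0 < s" "s < 1" and p: "1 \<le> p" and \<alpha>: "0 \<le> \<alpha>" and \<beta>: "0 \<le> \<beta>"
begin

section \<open>The norms and the Hardy integral as integrals over the whole space\<close>

definition kernel :: "'a \<Rightarrow> 'a \<Rightarrow> real" where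
  "kernel x y = d y powr - \<alpha> * d x powr - \<beta> / norm (x - y) powr (real DIM('a) + s * p)"

text \<open>These functionals are p-th powers with values in the extended nonnegative reals.
  Integrating over the whole space with an indicator makes Tonelli's theorem for
  \<open>lborel\<close> directly applicable.\<close>

definition Lp :: "('a \<Rightarrow> real) \<Rightarrow> ennreal" where
  "Lp f = (\<integral>\<^sup>+x. ennreal (\<bar>f x\<bar> powr p) * indicator \<Omega> x \<partial>lborel)"

definition energy :: "('a \<Rightarrow> real) \<Rightarrow> ennreal" where
  "energy f = (\<integral>\<^sup>+x. \<integral>\<^sup>+y. ennreal (\<bar>f x - f y\<bar> powr p * kernel x y) * (indicator \<Omega> x * indicator \<Omega> y) \<partial>lborel \<partial>lborel)"

definition hardy :: "('a \<Rightarrow> real) \<Rightarrow> ennreal" where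
  "hardy f = (\<integral>\<^sup>+x. ennreal (\<bar>f x\<bar> powr p * d x powr - (s * p + \<alpha> + \<beta>)) * indicator \<Omega> x \<partial>lborel)"

lemma kernel_nonneg: "0 \<le> kernel x y"
  by (simp add: kernel_def)

lemma kernel_measurable [measurable]: "case_prod kernel \<in> borel_measurable (borel \<Otimes>\<^sub>M borel)"
  unfolding kernel_def by measurable

lemma nn_integral_lebesgue_on:
  "(\<integral>\<^sup>+x. f x \<partial>lebesgue_on \<Omega>) = (\<integral>\<^sup>+x. f x * indicator \<Omega> x \<partial>lborel)"
  by (subst nn_integral_restrict_space) (auto simp: nn_integral_completion open_domain)

lemma Lp_eq: "(\<integral>\<^sup>+x. ennreal (\<bar>f x\<bar> powr p) \<partial>lebesgue_on \<Omega>) = Lp f"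
  by (simp add: Lp_def nn_integral_lebesgue_on)

lemma energy_eq: "gagliardo_energy \<Omega> s p \<alpha> \<beta> f = energy f"
  unfolding gagliardo_energy_def energy_def nn_integral_lebesgue_on
proof (intro nn_integral_cong)
  fix x
  show "(\<integral>\<^sup>+y. ennreal (\<bar>f x - f y\<bar> powr p / norm (x - y) powr (real DIM('a) + s * p) * bdist \<Omega> y powr - \<alpha> * bdist \<Omega> x powr - \<beta>) * indicator \<Omega> y \<partial>lborel) * indicator \<Omega> x
    = (\<integral>\<^sup>+y. ennreal (\<bar>f x - f y\<bar> powr p * kernel x y) * (indicator \<Omega> x * indicator \<Omega> y) \<partial>lborel)"
    by (cases "x \<in> \<Omega>") (auto simp: kernel_def mult_ac intro!: nn_integral_cong)
qed

lemma hardy_eq: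
  "(\<integral>\<^sup>+x. ennreal (\<bar>f x\<bar> powr p / bdist \<Omega> x powr (s * p + \<alpha> + \<beta>)) \<partial>lebesgue_on \<Omega>) = hardy f"
  unfolding hardy_def nn_integral_lebesgue_on
  by (intro nn_integral_cong) (simp only: powr_minus divide_inverse)

text \<open>Permits replacing a Lebesgue measurable function by a Borel representative, as product
  measurability in Tonelli's theorem demands.\<close>

lemma AE_cong_functionals:
  assumes "AE x in lborel. x \<in> \<Omega> \<longrightarrow> f x = g x"
  shows "Lp f = Lp g" "energy f = energy g" "hardy f = hardy g"
proof -
  show "Lp f = Lp g" unfolding Lp_def
    by (rule nn_integral_cong_AE, use assms in eventually_elim) (auto simp: indicator_def)
  show "hardy f = hardy g" unfolding hardy_def
    by (rule nn_integral_cong_AE, use assms in eventually_elim) (auto simp: indicator_def)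
  show "energy f = energy g" unfolding energy_def
  proof (rule nn_integral_cong_AE, use assms in eventually_elim)
    fix x assume x: "x \<in> \<Omega> \<longrightarrow> f x = g x"
    show "(\<integral>\<^sup>+y. ennreal (\<bar>f x - f y\<bar> powr p * kernel x y) * (indicator \<Omega> x * indicator \<Omega> y) \<partial>lborel) =
      (\<integral>\<^sup>+y. ennreal (\<bar>g x - g y\<bar> powr p * kernel x y) * (indicator \<Omega> x * indicator \<Omega> y) \<partial>lborel)"
      by (rule nn_integral_cong_AE, use assms in eventually_elim) (use x in \<open>auto simp: indicator_def\<close>)
  qed
qed

lemma Lp_add:
  assumes [measurable]: "f \<in> borel_measurable borel" "g \<in> borel_measurable borel"
  shows "Lp (\<lambda>x. f x + g x) \<le> ennreal (2 powr p) * (Lp f + Lp g)"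
proof -
  have "Lp (\<lambda>x. f x + g x) \<le> (\<integral>\<^sup>+x. ennreal (2 powr p) * (ennreal (\<bar>f x\<bar> powr p) * indicator \<Omega> x + ennreal (\<bar>g x\<bar> powr p) * indicator \<Omega> x) \<partial>lborel)"
    unfolding Lp_def
    by (intro nn_integral_mono) (auto simp: indicator_def intro!: ennreal_leI powr_abs_add_le p simp flip: ennreal_mult ennreal_plus)
  also have "\<dots> = ennreal (2 powr p) * (Lp f + Lp g)"
    by (simp add: nn_integral_cmult nn_integral_add Lp_def)
  finally show ?thesis .
qed

lemma energy_add:
  assumes [measurable]: "f \<in> borel_measurable borel" "g \<in> borel_measurable borel"
  shows "energy (\<lambda>x. f x + g x) \<le> ennreal (2 powr p) * (energy f + energy g)"
proof -
  have *: "\<bar>f x + g x - (f y + g y)\<bar> powr p * kernel x y \<le>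
     2 powr p * (\<bar>f x - f y\<bar> powr p * kernel x y + \<bar>g x - g y\<bar> powr p * kernel x y)" for x y
    using mult_right_mono[OF powr_abs_add_le[OF p, of "f x - f y" "g x - g y"] kernel_nonneg[of x y]]
    by (simp add: algebra_simps)
  have "energy (\<lambda>x. f x + g x) \<le> (\<integral>\<^sup>+x. \<integral>\<^sup>+y. ennreal (2 powr p) * (ennreal (\<bar>f x - f y\<bar> powr p * kernel x y) * (indicator \<Omega> x * indicator \<Omega> y)
      + ennreal (\<bar>g x - g y\<bar> powr p * kernel x y) * (indicator \<Omega> x * indicator \<Omega> y)) \<partial>lborel \<partial>lborel)"
    unfolding energy_def
    by (intro nn_integral_mono) (use * kernel_nonneg in \<open>auto simp: indicator_def intro!: ennreal_leI simp flip: ennreal_mult ennreal_plus\<close>)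
  also have "\<dots> = ennreal (2 powr p) * (energy f + energy g)"
    by (simp add: nn_integral_cmult nn_integral_add energy_def)
  finally show ?thesis .
qed

lemma functionals_uminus: "Lp (\<lambda>x. - f x) = Lp f" "hardy (\<lambda>x. - f x) = hardy f" "energy (\<lambda>x. - f x) = energy f"
  by (auto simp: Lp_def hardy_def energy_def abs_minus_commute)

lemma Lp_diff:
  assumes [measurable]: "f \<in> borel_measurable borel" "g \<in> borel_measurable borel"
  shows "Lp (\<lambda>x. f x - g x) \<le> ennreal (2 powr p) * (Lp f + Lp g)"
  using Lp_add[of f "\<lambda>x. - g x"] by (simp add: functionals_uminus)

lemma energy_diff:
  assumes [measurable]: "f \<in> borel_measurable borel" "g \<in> borel_measurable borel"
  shows "energy (\<lambda>x. f x - g x) \<le> ennreal (2 powr p) * (energy f + energy g)"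
  using energy_add[of f "\<lambda>x. - g x"] by (simp add: functionals_uminus)

text \<open>On the support the weight is at most a power of \<delta>. This supplies the finiteness
  that absorption presupposes.\<close>

lemma hardy_finite_of_support:
  assumes Lp: "Lp f < \<infinity>" and \<delta>: "0 < \<delta>" "\<And>x. x \<in> \<Omega> \<Longrightarrow> f x \<noteq> 0 \<Longrightarrow> \<delta> \<le> d x"
    and [measurable]: "f \<in> borel_measurable borel"
  shows "hardy f < \<infinity>"
proof -
  have "hardy f \<le> (\<integral>\<^sup>+x. ennreal (\<delta> powr - (s * p + \<alpha> + \<beta>)) * (ennreal (\<bar>f x\<bar> powr p) * indicator \<Omega> x) \<partial>lborel)"
    unfolding hardy_def
  proof (intro nn_integral_mono)
    fix x
    have "0 \<le> s * p + \<alpha> + \<beta>" using s p \<alpha> \<beta> by simp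
    then have "d x powr - (s * p + \<alpha> + \<beta>) \<le> \<delta> powr - (s * p + \<alpha> + \<beta>)" if "x \<in> \<Omega>" "f x \<noteq> 0"
      using \<delta>(1) \<delta>(2)[OF that] by (intro powr_mono2') auto
    then show "ennreal (\<bar>f x\<bar> powr p * d x powr - (s * p + \<alpha> + \<beta>)) * indicator \<Omega> x
      \<le> ennreal (\<delta> powr - (s * p + \<alpha> + \<beta>)) * (ennreal (\<bar>f x\<bar> powr p) * indicator \<Omega> x)"
      by (cases "f x = 0") (auto simp: indicator_def mult.commute intro!: ennreal_leI mult_left_mono simp flip: ennreal_mult)
  qed
  also have "\<dots> = ennreal (\<delta> powr - (s * p + \<alpha> + \<beta>)) * Lp f"
    by (simp add: nn_integral_cmult Lp_def)
  also have "\<dots> < \<infinity>" using Lp by (simp add: ennreal_mult_less_top)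
  finally show ?thesis .
qed

section \<open>Averaging over boundary layers and absorption\<close>

lemma layer_indicator_measurable [measurable]:
  "(\<lambda>(x, y). indicator (layer \<kappa> \<rho> x) y :: ennreal) \<in> borel_measurable (borel \<Otimes>\<^sub>M borel)"
proof -
  have "(\<lambda>(x, y). indicator (layer \<kappa> \<rho> x) y :: ennreal) =
    (\<lambda>z. if snd z \<in> \<Omega> \<and> \<kappa> * \<rho> * d (fst z) / 2 \<le> d (snd z) \<and> d (snd z) \<le> 2 * \<rho> * d (fst z) \<and>
      norm (fst z - snd z) \<le> 5 * d (fst z) then 1 else 0)"
    by (auto simp: layer_def indicator_def fun_eq_iff)
  then show ?thesis by simp
qed

lemma layer_measurable [measurable]: "layer \<kappa> \<rho> x \<in> sets borel"
  unfolding layer_def by measurable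

text \<open>Here d(x) is at least d(y)/(2 \<rho>) and \<open>x\<close> lies in a ball of radius 10
  d(y)/(\<kappa> \<rho>). The N-th powers of d(y)/\<rho> from volume and weight cancel, and the gain
  \<rho>^\<gamma> remains together with the weight at \<open>y\<close>.\<close>

lemma layer_section_bound:
  assumes y: "y \<in> \<Omega>" and \<kappa>: "0 < \<kappa>" and \<rho>: "0 < \<rho>" and \<gamma>: "0 \<le> \<gamma>"
  shows "(\<integral>\<^sup>+x. ennreal (d x powr - (\<gamma> + real DIM('a))) * (indicator \<Omega> x * indicator (layer \<kappa> \<rho> x) y) \<partial>lborel)
    \<le> ennreal (unit_ball_vol (real DIM('a)) * 2 powr (\<gamma> + real DIM('a)) * (10 / \<kappa>) powr real DIM('a) * \<rho> powr \<gamma> * d y powr - \<gamma>)"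
proof -
  have dy: "0 < d y" using y by (rule d_pos)
  have "(\<integral>\<^sup>+x. ennreal (d x powr - (\<gamma> + real DIM('a))) * (indicator \<Omega> x * indicator (layer \<kappa> \<rho> x) y) \<partial>lborel)
    \<le> (\<integral>\<^sup>+x. ennreal ((d y / (2 * \<rho>)) powr - (\<gamma> + real DIM('a))) * indicator (cball y (10 * d y / (\<kappa> * \<rho>))) x \<partial>lborel)"
  proof (intro nn_integral_mono)
    fix x
    show "ennreal (d x powr - (\<gamma> + real DIM('a))) * (indicator \<Omega> x * indicator (layer \<kappa> \<rho> x) y)
      \<le> ennreal ((d y / (2 * \<rho>)) powr - (\<gamma> + real DIM('a))) * indicator (cball y (10 * d y / (\<kappa> * \<rho>))) x"
    proof (cases "x \<in> \<Omega> \<and> y \<in> layer \<kappa> \<rho> x")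
      case True
      then have l: "\<kappa> * \<rho> * d x / 2 \<le> d y" "d y \<le> 2 * \<rho> * d x" "norm (x - y) \<le> 5 * d x" by (auto simp: layer_def)
      have "d y / (2 * \<rho>) \<le> d x" using l(2) \<rho> by (simp add: field_simps)
      then have 1: "d x powr - (\<gamma> + real DIM('a)) \<le> (d y / (2 * \<rho>)) powr - (\<gamma> + real DIM('a))"
        using dy \<rho> \<gamma> by (intro powr_mono2') auto
      have "d x \<le> 2 * d y / (\<kappa> * \<rho>)" using l(1) \<kappa> \<rho> by (simp add: field_simps)
      then have "norm (x - y) \<le> 10 * d y / (\<kappa> * \<rho>)" using l(3) by simp
      then show ?thesis using True 1 by (auto simp: dist_norm norm_minus_commute intro: ennreal_leI)
    qed (auto simp: indicator_def)
  qed
  also have "\<dots> = ennreal ((d y / (2 * \<rho>)) powr - (\<gamma> + real DIM('a))) * ennreal (unit_ball_vol (real DIM('a)) * (10 * d y / (\<kappa> * \<rho>)) powr real DIM('a))"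
    using dy \<kappa> \<rho> by (subst nn_integral_cmult_indicator) (auto simp: emeasure_cball_vol)
  also have "\<dots> = ennreal ((d y / (2 * \<rho>)) powr - (\<gamma> + real DIM('a)) * (unit_ball_vol (real DIM('a)) * (10 * d y / (\<kappa> * \<rho>)) powr real DIM('a)))"
    by (rule ennreal_mult[symmetric]) auto
  also have "(d y / (2 * \<rho>)) powr - (\<gamma> + real DIM('a)) * (unit_ball_vol (real DIM('a)) * (10 * d y / (\<kappa> * \<rho>)) powr real DIM('a))
     = unit_ball_vol (real DIM('a)) * 2 powr (\<gamma> + real DIM('a)) * (10 / \<kappa>) powr real DIM('a) * \<rho> powr \<gamma> * d y powr - \<gamma>"
  proof -
    have "(d y / (2 * \<rho>)) powr - e = 2 powr e * \<rho> powr e * d y powr - e" for e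
      using dy \<rho> by (simp add: powr_divide powr_minus powr_mult divide_simps)
    note this[of "\<gamma> + real DIM('a)"]
    moreover have "\<rho> powr (\<gamma> + real DIM('a)) = \<rho> powr \<gamma> * \<rho> powr real DIM('a)" by (rule powr_add)
    moreover have "d y powr - (\<gamma> + real DIM('a)) = d y powr - \<gamma> * d y powr - real DIM('a)"
      by (simp flip: powr_add)
    ultimately have a: "(d y / (2 * \<rho>)) powr - (\<gamma> + real DIM('a)) = 2 powr (\<gamma> + real DIM('a)) * (\<rho> powr \<gamma> * \<rho> powr real DIM('a)) * (d y powr - \<gamma> * d y powr - real DIM('a))"
      by presburger
    have b: "(10 * d y / (\<kappa> * \<rho>)) powr real DIM('a) = (10 / \<kappa>) powr real DIM('a) * d y powr real DIM('a) * \<rho> powr - real DIM('a)"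
      using dy \<rho> \<kappa> by (simp add: powr_divide powr_minus powr_mult field_simps)
    have "\<rho> powr real DIM('a) * \<rho> powr - real DIM('a) = 1" "d y powr - real DIM('a) * d y powr real DIM('a) = 1"
      using dy \<rho> by (simp_all flip: powr_add)
    then show ?thesis unfolding a b by (simp add: mult_ac)
  qed
  finally show ?thesis .
qed

text \<open>Exchanging the integrals gains \<rho>^\<sigma>, dividing by the mass of the layer costs
  \<rho>^q, and the net factor \<rho>^(\<sigma> - q) becomes small because q < \<sigma>. Half of the
  Hardy integral is then subtracted, which its assumed finiteness permits.\<close>

lemma fractional_hardy_inequality:
  assumes "uniform_domain \<Omega>" and "upper_assouad_codim (frontier \<Omega>) < ereal (s * p + \<alpha> + \<beta>)"
  obtains C :: real where "0 < C"
    "\<And>\<phi>. \<phi> \<in> borel_measurable borel \<Longrightarrow> hardy \<phi> < \<infinity> \<Longrightarrow> hardy \<phi> \<le> ennreal C * (Lp \<phi> + energy \<phi>)"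
proof -
  define \<sigma> where "\<sigma> = s * p + \<alpha> + \<beta>"
  define n where "n = real DIM('a)"
  have \<sigma>: "0 < \<sigma>" using s p \<alpha> \<beta> by (simp add: \<sigma>_def add_pos_nonneg)
  have n: "0 < n" by (simp add: n_def)
  obtain q \<kappa> r0 c where q: "q < \<sigma>" and \<kappa>: "0 < \<kappa>" "\<kappa> \<le> 1" and r0: "0 < r0" and c: "0 < c" and lay:
    "\<And>x \<rho>. x \<in> \<Omega> \<Longrightarrow> d x < r0 \<Longrightarrow> 0 < \<rho> \<Longrightarrow> \<rho> < 1 \<Longrightarrow>
      ennreal (c * \<rho> powr q * d x powr real DIM('a)) \<le> emeasure lborel (layer \<kappa> \<rho> x)"
    by (fact layer_measure[OF assms, folded \<sigma>_def])
  \<comment> \<open>\<open>C1\<close> does not depend on \<open>\<rho>\<close>, so that \<open>\<rho>\<close> can be chosen afterwards\<close>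
  define C1 where "C1 = 2 powr p / c * (unit_ball_vol n * 2 powr (\<sigma> + n) * (10 / \<kappa>) powr n)"
  have C1: "0 < C1" using c \<kappa> n by (simp add: C1_def)
  \<comment> \<open>The second entry solves C1 \<rho>^(\<sigma> - q) = 1/2; the first keeps \<rho>
    below 1.\<close>
  define \<rho> where "\<rho> = min (1/2) ((1 / (2 * C1)) powr (1 / (\<sigma> - q)))"
  have \<rho>: "0 < \<rho>" "\<rho> < 1" using C1 by (auto simp: \<rho>_def)
  have absorb: "C1 * \<rho> powr (\<sigma> - q) \<le> 1 / 2"
  proof -
    have "\<rho> powr (\<sigma> - q) \<le> ((1 / (2 * C1)) powr (1 / (\<sigma> - q))) powr (\<sigma> - q)"
      using \<rho> q by (intro powr_mono2) (auto simp: \<rho>_def)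
    also have "\<dots> = 1 / (2 * C1)" using q C1 by (simp add: powr_powr)
    finally show ?thesis using C1 by (simp add: field_simps)
  qed
  \<comment> \<open>\<open>A\<close> is \<open>2 powr p\<close> over the constant in the layer mass,
    \<open>C2\<close> includes the comparison of the weight with the kernel, and \<open>C3\<close>
    bounds the weight at distance at least \<open>r0\<close> from the boundary.\<close>
  define A where "A = 2 powr p / (c * \<rho> powr q)"
  have A: "0 < A" using c \<rho> by (simp add: A_def)
  define C2 where "C2 = A * ((2 * \<rho>) powr \<alpha> * 5 powr (n + s * p))"
  define C3 where "C3 = r0 powr - \<sigma>"
  have C2: "0 < C2" using A \<rho> by (simp add: C2_def)
  have C3: "0 < C3" using r0 by (simp add: C3_def)
  show ?thesis
  proof (rule that[of "2 * (C2 + C3)"])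
    show "0 < 2 * (C2 + C3)" using C2 C3 by simp
    fix \<phi> :: "'a \<Rightarrow> real" assume [measurable]: "\<phi> \<in> borel_measurable borel" and fin: "hardy \<phi> < \<infinity>"
    define F where "F x y = ennreal (\<bar>\<phi> y\<bar> powr p) * indicator \<Omega> y * (ennreal (d x powr - (\<sigma> + n)) * (indicator \<Omega> x * indicator (layer \<kappa> \<rho> x) y))" for x y
    define G where "G x y = ennreal (\<bar>\<phi> x - \<phi> y\<bar> powr p * kernel x y) * (indicator \<Omega> x * indicator \<Omega> y)" for x y
    have [measurable]: "case_prod F \<in> borel_measurable (lborel \<Otimes>\<^sub>M lborel)" unfolding F_def by measurable
    have [measurable]: "case_prod G \<in> borel_measurable (lborel \<Otimes>\<^sub>M lborel)" unfolding G_def by measurable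
    have pw: "ennreal (\<bar>\<phi> x\<bar> powr p * d x powr - \<sigma>) * indicator \<Omega> x
        \<le> ennreal C3 * (ennreal (\<bar>\<phi> x\<bar> powr p) * indicator \<Omega> x)
          + (ennreal A * (\<integral>\<^sup>+y. F x y \<partial>lborel) + ennreal C2 * (\<integral>\<^sup>+y. G x y \<partial>lborel))" for x
    proof (cases "x \<in> \<Omega>")
      case x: True
      have dx: "0 < d x" using x by (rule d_pos)
      show ?thesis
      proof (cases "d x < r0")
        case False
        have "d x powr - \<sigma> \<le> C3" using False r0 \<sigma> unfolding C3_def by (intro powr_mono2') auto
        then have "ennreal (\<bar>\<phi> x\<bar> powr p * d x powr - \<sigma>) \<le> ennreal (C3 * \<bar>\<phi> x\<bar> powr p)"
          by (intro ennreal_leI, subst mult.commute) (intro mult_right_mono, auto)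
        also have "\<dots> = ennreal C3 * ennreal (\<bar>\<phi> x\<bar> powr p)" using C3 by (intro ennreal_mult) auto
        finally show ?thesis using x by - (rule add_increasing2, simp_all)
      next
        case True
        define L where "L = layer \<kappa> \<rho> x"
        \<comment> \<open>Normalised so that \<open>w\<close> times the lower bound for the mass of
          the layer is the Hardy weight at \<open>x\<close>.\<close>
        define w where "w = A * d x powr - (\<sigma> + n) / 2 powr p"
        have w: "0 \<le> w" using A by (simp add: w_def)
        have "\<bar>\<phi> x\<bar> powr p * d x powr - \<sigma> = \<bar>\<phi> x\<bar> powr p * w * (c * \<rho> powr q * d x powr n)"
        proof -
          have "d x powr - \<sigma> = d x powr - (\<sigma> + n) * d x powr n" by (simp flip: powr_add)
          then show ?thesis using c \<rho> by (simp add: w_def A_def)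
        qed
        then have "ennreal (\<bar>\<phi> x\<bar> powr p * d x powr - \<sigma>) = ennreal (\<bar>\<phi> x\<bar> powr p * w) * ennreal (c * \<rho> powr q * d x powr n)"
          using w c by (simp only:) (rule ennreal_mult; simp)
        also have "\<dots> \<le> ennreal (\<bar>\<phi> x\<bar> powr p * w) * emeasure lborel L"
          using lay[OF x True \<rho>] unfolding L_def n_def by (intro mult_left_mono) auto
        also have "\<dots> = (\<integral>\<^sup>+y. ennreal (\<bar>\<phi> x\<bar> powr p * w) * indicator L y \<partial>lborel)"
          unfolding L_def by (simp add: nn_integral_cmult_indicator)
        also have "\<dots> \<le> (\<integral>\<^sup>+y. ennreal A * F x y + ennreal C2 * G x y \<partial>lborel)"
        proof (intro nn_integral_mono)
          fix y
          show "ennreal (\<bar>\<phi> x\<bar> powr p * w) * indicator L y \<le> ennreal A * F x y + ennreal C2 * G x y"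
          proof (cases "y \<in> L")
            case True
            then have y: "y \<in> \<Omega>" and l: "d y \<le> 2 * \<rho> * d x" "norm (x - y) \<le> 5 * d x"
              by (auto simp: L_def layer_def)
            have dy: "0 < d y" using y by (rule d_pos)
            \<comment> \<open>By d(y) \<le> 2 \<rho> d(x) and |x - y| \<le> 5 d(x), the weight is at
              most a constant times the kernel off the diagonal. At x = y the kernel is 0 by
              division by 0, so the difference of \<phi> is kept as a factor: it makes both sides
              vanish.\<close>
            have k: "\<bar>\<phi> x - \<phi> y\<bar> powr p * d x powr - (\<sigma> + n) \<le> \<bar>\<phi> x - \<phi> y\<bar> powr p * ((2 * \<rho>) powr \<alpha> * 5 powr (n + s * p) * kernel x y)"
            proof (cases "x = y")
              case False
              have k1: "norm (x - y) powr (n + s * p) \<le> (5 * d x) powr (n + s * p)"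
                using l(2) n s p by (intro powr_mono2) auto
              have k2: "(2 * \<rho> * d x) powr - \<alpha> \<le> d y powr - \<alpha>"
                using dy l(1) \<alpha> by (intro powr_mono2') auto
              have "d x powr - (\<sigma> + n) = (2 * \<rho>) powr \<alpha> * 5 powr (n + s * p) * ((2 * \<rho> * d x) powr - \<alpha> * d x powr - \<beta> / (5 * d x) powr (n + s * p))"
              proof -
                have "- (\<sigma> + n) = - \<alpha> + (- \<beta> + - (n + s * p))" by (simp add: \<sigma>_def)
                then have "d x powr - (\<sigma> + n) = d x powr - \<alpha> * (d x powr - \<beta> * d x powr - (n + s * p))"
                  by (simp only: powr_add)
                moreover have "(2 * \<rho> * d x) powr - \<alpha> = (2 * \<rho>) powr - \<alpha> * d x powr - \<alpha>"
                  using dx \<rho> by (simp only: powr_mult)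
                moreover have "(5 * d x) powr (n + s * p) = 5 powr (n + s * p) * d x powr (n + s * p)"
                  using dx by (simp only: powr_mult)
                moreover have "(2 * \<rho>) powr \<alpha> * (2 * \<rho>) powr - \<alpha> = 1"
                  using \<rho> by (simp flip: powr_add)
                moreover have "d x powr (n + s * p) * d x powr - (n + s * p) = 1"
                  using dx by (simp flip: powr_add)
                ultimately show ?thesis using dx by (simp add: field_simps)
              qed
              also have "\<dots> \<le> (2 * \<rho>) powr \<alpha> * 5 powr (n + s * p) * kernel x y"
                unfolding kernel_def n_def[symmetric] using k1 k2 False
                by (intro mult_left_mono frac_le mult_right_mono) auto
              finally show ?thesis by (intro mult_left_mono) auto
            qed (use p in simp)
            have "\<bar>\<phi> x\<bar> powr p \<le> 2 powr p * (\<bar>\<phi> y\<bar> powr p + \<bar>\<phi> x - \<phi> y\<bar> powr p)"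
              using powr_abs_add_le[OF p, of "\<phi> y" "\<phi> x - \<phi> y"] by simp
            then have "\<bar>\<phi> x\<bar> powr p * w \<le> 2 powr p * (\<bar>\<phi> y\<bar> powr p + \<bar>\<phi> x - \<phi> y\<bar> powr p) * w"
              using w by (rule mult_right_mono)
            also have "\<dots> = A * (\<bar>\<phi> y\<bar> powr p * d x powr - (\<sigma> + n)) + A * (\<bar>\<phi> x - \<phi> y\<bar> powr p * d x powr - (\<sigma> + n))"
              by (simp add: w_def algebra_simps)
            also have "\<dots> \<le> A * (\<bar>\<phi> y\<bar> powr p * d x powr - (\<sigma> + n)) + A * (\<bar>\<phi> x - \<phi> y\<bar> powr p * ((2 * \<rho>) powr \<alpha> * 5 powr (n + s * p) * kernel x y))"
              by (rule add_left_mono, rule mult_left_mono[OF k]) (use A in simp)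
            also have "\<dots> = A * (\<bar>\<phi> y\<bar> powr p * d x powr - (\<sigma> + n)) + C2 * (\<bar>\<phi> x - \<phi> y\<bar> powr p * kernel x y)"
              by (simp add: C2_def mult_ac)
            finally have "ennreal (\<bar>\<phi> x\<bar> powr p * w) \<le> ennreal (A * (\<bar>\<phi> y\<bar> powr p * d x powr - (\<sigma> + n)) + C2 * (\<bar>\<phi> x - \<phi> y\<bar> powr p * kernel x y))"
              by (rule ennreal_leI)
            also have "\<dots> = ennreal A * F x y + ennreal C2 * G x y"
              using True x y A C2 kernel_nonneg[of x y]
              by (simp add: F_def G_def L_def[symmetric] ennreal_plus ennreal_mult)
            finally show ?thesis using True by simp
          qed simp
        qed
        also have "\<dots> = ennreal A * (\<integral>\<^sup>+y. F x y \<partial>lborel) + ennreal C2 * (\<integral>\<^sup>+y. G x y \<partial>lborel)"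
          by (subst nn_integral_add) (auto simp: nn_integral_cmult)
        finally show ?thesis using x by - (rule add_increasing, simp_all)
      qed
    qed simp
    \<comment> \<open>With \<open>y\<close> fixed, the section bound recreates the Hardy weight at
      \<open>y\<close>, so the Hardy integral of \<phi> itself appears on the right.\<close>
    have "(\<integral>\<^sup>+x. \<integral>\<^sup>+y. F x y \<partial>lborel \<partial>lborel) = (\<integral>\<^sup>+y. \<integral>\<^sup>+x. F x y \<partial>lborel \<partial>lborel)"
      by (rule lborel_pair.Fubini'[symmetric]) simp
    also have "\<dots> \<le> (\<integral>\<^sup>+y. ennreal (C1 * c / 2 powr p * \<rho> powr \<sigma>) * (ennreal (\<bar>\<phi> y\<bar> powr p * d y powr - \<sigma>) * indicator \<Omega> y) \<partial>lborel)"
    proof (intro nn_integral_mono)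
      fix y
      have "(\<integral>\<^sup>+x. F x y \<partial>lborel) = ennreal (\<bar>\<phi> y\<bar> powr p) * indicator \<Omega> y *
        (\<integral>\<^sup>+x. ennreal (d x powr - (\<sigma> + n)) * (indicator \<Omega> x * indicator (layer \<kappa> \<rho> x) y) \<partial>lborel)"
        unfolding F_def by (rule nn_integral_cmult) measurable
      also have "\<dots> \<le> ennreal (C1 * c / 2 powr p * \<rho> powr \<sigma>) * (ennreal (\<bar>\<phi> y\<bar> powr p * d y powr - \<sigma>) * indicator \<Omega> y)"
      proof (cases "y \<in> \<Omega>")
        case True
        have "ennreal (\<bar>\<phi> y\<bar> powr p) * (\<integral>\<^sup>+x. ennreal (d x powr - (\<sigma> + n)) * (indicator \<Omega> x * indicator (layer \<kappa> \<rho> x) y) \<partial>lborel)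
          \<le> ennreal (\<bar>\<phi> y\<bar> powr p) * ennreal (unit_ball_vol n * 2 powr (\<sigma> + n) * (10 / \<kappa>) powr n * \<rho> powr \<sigma> * d y powr - \<sigma>)"
          unfolding n_def by (intro mult_left_mono layer_section_bound[OF True \<kappa>(1) \<rho>(1) less_imp_le[OF \<sigma>]]) auto
        also have "\<dots> = ennreal (\<bar>\<phi> y\<bar> powr p * (unit_ball_vol n * 2 powr (\<sigma> + n) * (10 / \<kappa>) powr n * \<rho> powr \<sigma> * d y powr - \<sigma>))"
          by (rule ennreal_mult[symmetric]) (use n in auto)
        also have "\<bar>\<phi> y\<bar> powr p * (unit_ball_vol n * 2 powr (\<sigma> + n) * (10 / \<kappa>) powr n * \<rho> powr \<sigma> * d y powr - \<sigma>)
          = C1 * c / 2 powr p * \<rho> powr \<sigma> * (\<bar>\<phi> y\<bar> powr p * d y powr - \<sigma>)"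
          using c by (simp add: C1_def)
        also have "ennreal \<dots> = ennreal (C1 * c / 2 powr p * \<rho> powr \<sigma>) * ennreal (\<bar>\<phi> y\<bar> powr p * d y powr - \<sigma>)"
          by (rule ennreal_mult) (use C1 c in auto)
        finally show ?thesis using True by simp
      qed simp
      finally show "(\<integral>\<^sup>+x. F x y \<partial>lborel) \<le> ennreal (C1 * c / 2 powr p * \<rho> powr \<sigma>) * (ennreal (\<bar>\<phi> y\<bar> powr p * d y powr - \<sigma>) * indicator \<Omega> y)" .
    qed
    also have "\<dots> = ennreal (C1 * c / 2 powr p * \<rho> powr \<sigma>) * hardy \<phi>"
      unfolding hardy_def \<sigma>_def[symmetric] by (rule nn_integral_cmult) measurable
    finally have FB: "(\<integral>\<^sup>+x. \<integral>\<^sup>+y. F x y \<partial>lborel \<partial>lborel) \<le> ennreal (C1 * c / 2 powr p * \<rho> powr \<sigma>) * hardy \<phi>" .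
    have "hardy \<phi> \<le> (\<integral>\<^sup>+x. ennreal C3 * (ennreal (\<bar>\<phi> x\<bar> powr p) * indicator \<Omega> x)
          + (ennreal A * (\<integral>\<^sup>+y. F x y \<partial>lborel) + ennreal C2 * (\<integral>\<^sup>+y. G x y \<partial>lborel)) \<partial>lborel)"
      unfolding hardy_def \<sigma>_def[symmetric] by (intro nn_integral_mono pw)
    also have "\<dots> = ennreal C3 * Lp \<phi> + (ennreal A * (\<integral>\<^sup>+x. \<integral>\<^sup>+y. F x y \<partial>lborel \<partial>lborel) + ennreal C2 * energy \<phi>)"
      unfolding energy_def G_def[symmetric] Lp_def by (simp add: nn_integral_add nn_integral_cmult)
    also have "\<dots> \<le> ennreal C3 * Lp \<phi> + (ennreal A * (ennreal (C1 * c / 2 powr p * \<rho> powr \<sigma>) * hardy \<phi>) + ennreal C2 * energy \<phi>)"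
      by (intro add_left_mono add_right_mono mult_left_mono FB) auto
    finally have main: "hardy \<phi> \<le> ennreal C3 * Lp \<phi> + (ennreal A * (ennreal (C1 * c / 2 powr p * \<rho> powr \<sigma>) * hardy \<phi>) + ennreal C2 * energy \<phi>)" .
    obtain h where h: "0 \<le> h" "hardy \<phi> = ennreal h" using fin by (cases "hardy \<phi>") auto
    have "ennreal A * (ennreal (C1 * c / 2 powr p * \<rho> powr \<sigma>) * hardy \<phi>) = ennreal (A * (C1 * c / 2 powr p * \<rho> powr \<sigma> * h))"
      unfolding h(2) using A C1 c h(1) by (subst ennreal_mult[symmetric], simp, simp)+ simp
    also have "A * (C1 * c / 2 powr p * \<rho> powr \<sigma> * h) = C1 * \<rho> powr (\<sigma> - q) * h"
      using c \<rho> by (simp add: A_def powr_diff)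
    also have "ennreal \<dots> \<le> ennreal (1 / 2 * h)"
      using absorb h by (intro ennreal_leI mult_right_mono) auto
    finally have "ennreal A * (ennreal (C1 * c / 2 powr p * \<rho> powr \<sigma>) * hardy \<phi>) + ennreal C2 * energy \<phi>
        \<le> ennreal (1 / 2 * h) + ennreal C2 * energy \<phi>"
      by (rule add_right_mono)
    then have "ennreal C3 * Lp \<phi> + (ennreal A * (ennreal (C1 * c / 2 powr p * \<rho> powr \<sigma>) * hardy \<phi>) + ennreal C2 * energy \<phi>)
      \<le> ennreal C3 * Lp \<phi> + (ennreal (1 / 2 * h) + ennreal C2 * energy \<phi>)"
      by (rule add_left_mono)
    from order_trans[OF main this] have est: "hardy \<phi> \<le> ennreal C3 * Lp \<phi> + (ennreal (1 / 2 * h) + ennreal C2 * energy \<phi>)" .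
    show "hardy \<phi> \<le> ennreal (2 * (C2 + C3)) * (Lp \<phi> + energy \<phi>)"
    proof (cases "Lp \<phi> < \<infinity> \<and> energy \<phi> < \<infinity>")
      case True
      then obtain l e where l: "0 \<le> l" "Lp \<phi> = ennreal l" and e: "0 \<le> e" "energy \<phi> = ennreal e"
        by (cases "Lp \<phi>"; cases "energy \<phi>") auto
      have "ennreal C3 * ennreal l + (ennreal (1 / 2 * h) + ennreal C2 * ennreal e) = ennreal (C3 * l + (1 / 2 * h + C2 * e))"
        using l e h C2 C3 by (simp add: ennreal_mult)
      with est have "ennreal h \<le> ennreal (C3 * l + (1 / 2 * h + C2 * e))" unfolding l(2) e(2) h(2) by simp
      then have "h \<le> C3 * l + (1 / 2 * h + C2 * e)" using l e h C2 C3 by (subst (asm) ennreal_le_iff) auto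
      moreover have "0 \<le> C3 * e" "0 \<le> C2 * l" using C2 C3 l e by auto
      ultimately have "h \<le> 2 * (C2 + C3) * (l + e)" by (simp add: algebra_simps)
      then have "ennreal h \<le> ennreal (2 * (C2 + C3) * (l + e))" by (rule ennreal_leI)
      also have "\<dots> = ennreal (2 * (C2 + C3)) * (ennreal l + ennreal e)"
        using l e C2 C3 by (simp add: ennreal_mult'' flip: ennreal_plus)
      finally show ?thesis unfolding l(2) e(2) h(2) .
    next
      case False
      then have "Lp \<phi> + energy \<phi> = \<infinity>" by (auto simp flip: less_top)
      moreover have "ennreal (2 * (C2 + C3)) * \<infinity> = \<infinity>" using C2 C3 by (simp add: ennreal_mult_eq_top_iff)
      ultimately have "ennreal (2 * (C2 + C3)) * (Lp \<phi> + energy \<phi>) = top"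
        by (simp only: infinity_ennreal_def)
      then show ?thesis by (simp only: top_greatest)
    qed
  qed
qed

section \<open>Cut-offs\<close>

text \<open>The factor |x - y|^p of a Lipschitz difference lowers the exponent to N + s p - p, which
  is below N because s < 1.\<close>

lemma near_kernel_bound:
  obtains K :: real where "0 < K"
    "\<And>x::'a. \<And>r. 0 < r \<Longrightarrow>
      (\<integral>\<^sup>+y\<in>{y. 0 < norm (x - y) \<and> norm (x - y) \<le> r}. ennreal (norm (x - y) powr - (real DIM('a) + s * p - p)) \<partial>lborel)
      \<le> ennreal (K * r powr (p - s * p))"
proof -
  define \<gamma> where "\<gamma> = real DIM('a) + s * p - p"
  have \<gamma>: "\<gamma> < real DIM('a)" using s p by (simp add: \<gamma>_def)
  define K where "K = 2 powr \<bar>\<gamma>\<bar> / (1 - 2 powr (\<gamma> - real DIM('a))) * unit_ball_vol (real DIM('a))"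
  have "2 powr (\<gamma> - real DIM('a)) < 1" using \<gamma> powr_less_mono[of "\<gamma> - real DIM('a)" 0 "2::real"] by simp
  then have K: "0 < K" by (simp add: K_def)
  show ?thesis
  proof (rule that[OF K])
    fix x :: 'a and r :: real assume r: "0 < r"
    have "(\<integral>\<^sup>+y\<in>{y \<in> space lborel. 0 < norm (x - y) \<and> norm (x - y) \<le> r}. ennreal (norm (x - y) powr - \<gamma>) \<partial>lborel)
      \<le> ennreal (2 powr \<bar>\<gamma>\<bar> / (1 - 2 powr (\<gamma> - real DIM('a))) * unit_ball_vol (real DIM('a)) * r powr (real DIM('a) - \<gamma>))"
    proof (rule nn_integral_powr_sublevel)
      fix r' :: real assume r': "0 < r'" "r' \<le> r"
      have "emeasure lborel {y \<in> space lborel. 0 < norm (x - y) \<and> norm (x - y) \<le> r'} \<le> emeasure lborel (cball x r')"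
        by (intro emeasure_mono) (auto simp: dist_norm)
      then show "emeasure lborel {y \<in> space lborel. 0 < norm (x - y) \<and> norm (x - y) \<le> r'} \<le> ennreal (unit_ball_vol (real DIM('a)) * r' powr real DIM('a))"
        using r' by (simp add: emeasure_cball_vol)
    qed (use r \<gamma> in auto)
    then show "(\<integral>\<^sup>+y\<in>{y. 0 < norm (x - y) \<and> norm (x - y) \<le> r}. ennreal (norm (x - y) powr - (real DIM('a) + s * p - p)) \<partial>lborel)
      \<le> ennreal (K * r powr (p - s * p))"
      by (simp add: K_def \<gamma>_def)
  qed
qed

text \<open>For the measure d(y)^(-\<alpha>) dy, balls of radius r \<ge> d(x)/2 have mass of order
  r^(N - \<alpha>) at most, and the kernel decays faster than this growth.\<close>

lemma far_kernel_bound: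
  assumes "ereal \<alpha> < lower_assouad_codim (frontier \<Omega>)"
  obtains K :: real where "0 < K"
    "\<And>x r. x \<in> \<Omega> \<Longrightarrow> d x / 2 \<le> r \<Longrightarrow>
      (\<integral>\<^sup>+y\<in>{y. r \<le> norm (x - y)}. ennreal (norm (x - y) powr - (real DIM('a) + s * p)) * (ennreal (d y powr - \<alpha>) * indicator \<Omega> y) \<partial>lborel)
      \<le> ennreal (K * r powr - (s * p + \<alpha>))"
proof -
  obtain A where A: "0 < A" "\<And>x r. x \<in> \<Omega> \<Longrightarrow> d x / 2 \<le> r \<Longrightarrow>
      (\<integral>\<^sup>+y. ennreal (d y powr - \<alpha>) * indicator (\<Omega> \<inter> cball x r) y \<partial>lborel) \<le> ennreal (A * r powr (real DIM('a) - \<alpha>))"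
    by (fact aikawa_ball[OF \<alpha> assms])
  define \<gamma> where "\<gamma> = real DIM('a) + s * p"
  have "0 < s * p" using s p by simp
  then have \<gamma>: "real DIM('a) - \<alpha> < \<gamma>" using \<alpha> by (simp add: \<gamma>_def)
  define K where "K = 2 powr \<bar>\<gamma>\<bar> / (1 - 2 powr (real DIM('a) - \<alpha> - \<gamma>)) * A"
  have "2 powr (real DIM('a) - \<alpha> - \<gamma>) < 1"
    using \<gamma> powr_less_mono[of "real DIM('a) - \<alpha> - \<gamma>" 0 "2::real"] by simp
  then have K: "0 < K" using A by (simp add: K_def)
  \<comment> \<open>With the weight inside the measure, the dyadic estimate sees only the function
    |x - y|.\<close>
  define M where "M = density lborel (\<lambda>y. ennreal (d y powr - \<alpha>) * indicator \<Omega> y)"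
  have [measurable_cong]: "sets M = sets borel" by (simp add: M_def)
  have [simp]: "space M = UNIV" by (simp add: M_def)
  show ?thesis
  proof (rule that[OF K])
    fix x r assume x: "x \<in> \<Omega>" and r: "d x / 2 \<le> r"
    have r0: "0 < r" using d_pos[OF x] r by linarith
    have "(\<integral>\<^sup>+y\<in>{y \<in> space M. r \<le> norm (x - y)}. ennreal (norm (x - y) powr - \<gamma>) \<partial>M)
      \<le> ennreal (2 powr \<bar>\<gamma>\<bar> / (1 - 2 powr (real DIM('a) - \<alpha> - \<gamma>)) * A * r powr (real DIM('a) - \<alpha> - \<gamma>))"
    proof (rule nn_integral_powr_superlevel)
      fix r' :: real assume r': "r \<le> r'"
      have "emeasure M {y \<in> space M. norm (x - y) \<le> r'} =
        (\<integral>\<^sup>+y. ennreal (d y powr - \<alpha>) * indicator \<Omega> y * indicator {y \<in> space M. norm (x - y) \<le> r'} y \<partial>lborel)"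
        unfolding M_def by (subst emeasure_density) auto
      also have "\<dots> = (\<integral>\<^sup>+y. ennreal (d y powr - \<alpha>) * indicator (\<Omega> \<inter> cball x r') y \<partial>lborel)"
        by (intro nn_integral_cong) (auto simp: indicator_def dist_norm)
      also have "\<dots> \<le> ennreal (A * r' powr (real DIM('a) - \<alpha>))"
        using r r' by (intro A(2) x) auto
      finally show "emeasure M {y \<in> space M. norm (x - y) \<le> r'} \<le> ennreal (A * r' powr (real DIM('a) - \<alpha>))" .
    qed (use r0 \<gamma> A in auto)
    also have "2 powr \<bar>\<gamma>\<bar> / (1 - 2 powr (real DIM('a) - \<alpha> - \<gamma>)) * A * r powr (real DIM('a) - \<alpha> - \<gamma>) = K * r powr - (s * p + \<alpha>)"
      by (simp add: K_def \<gamma>_def algebra_simps)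
    also have "(\<integral>\<^sup>+y\<in>{y \<in> space M. r \<le> norm (x - y)}. ennreal (norm (x - y) powr - \<gamma>) \<partial>M) =
      (\<integral>\<^sup>+y. (ennreal (d y powr - \<alpha>) * indicator \<Omega> y) * (ennreal (norm (x - y) powr - \<gamma>) * indicator {y \<in> space M. r \<le> norm (x - y)} y) \<partial>lborel)"
      unfolding M_def by (subst nn_integral_density) auto
    finally show "(\<integral>\<^sup>+y\<in>{y. r \<le> norm (x - y)}. ennreal (norm (x - y) powr - (real DIM('a) + s * p)) * (ennreal (d y powr - \<alpha>) * indicator \<Omega> y) \<partial>lborel)
      \<le> ennreal (K * r powr - (s * p + \<alpha>))"
      by (simp add: \<gamma>_def mult_ac)
  qed
qed

text \<open>Bounds the differences of all cut-offs at once; independence of their parameter is what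
  dominated convergence will use.\<close>

definition cut_bound :: "'a \<Rightarrow> 'a \<Rightarrow> real" where
  "cut_bound x y = (min 1 (4 * norm (x - y) / d x)) powr p"

text \<open>Split at |x - y| = d(x)/2. Nearer points have d(y) \<ge> d(x)/2, so the weight is nearly
  constant and the Lipschitz factor makes the kernel integrable. Farther points use the bound 1 and
  the weighted tail. Both parts scale like the Hardy weight at \<open>x\<close>.\<close>

lemma cut_kernel_bound:
  assumes "ereal \<alpha> < lower_assouad_codim (frontier \<Omega>)"
  obtains K :: real where "0 < K"
    "\<And>x. x \<in> \<Omega> \<Longrightarrow> (\<integral>\<^sup>+y. ennreal (cut_bound x y * kernel x y) * indicator \<Omega> y \<partial>lborel)
      \<le> ennreal (K * d x powr - (s * p + \<alpha> + \<beta>))"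
proof -
  obtain K1 where K1: "0 < K1" and near: "\<And>x::'a. \<And>r. 0 < r \<Longrightarrow>
      (\<integral>\<^sup>+y\<in>{y. 0 < norm (x - y) \<and> norm (x - y) \<le> r}. ennreal (norm (x - y) powr - (real DIM('a) + s * p - p)) \<partial>lborel)
      \<le> ennreal (K1 * r powr (p - s * p))"
    by (fact near_kernel_bound)
  obtain K2 where K2: "0 < K2" and far: "\<And>x r. x \<in> \<Omega> \<Longrightarrow> d x / 2 \<le> r \<Longrightarrow>
      (\<integral>\<^sup>+y\<in>{y. r \<le> norm (x - y)}. ennreal (norm (x - y) powr - (real DIM('a) + s * p)) * (ennreal (d y powr - \<alpha>) * indicator \<Omega> y) \<partial>lborel)
      \<le> ennreal (K2 * r powr - (s * p + \<alpha>))"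
    by (fact far_kernel_bound[OF assms])
  \<comment> \<open>The near and the far contribution at radius d(x)/2, with the powers of 2 pulled
    out.\<close>
  define K where "K = 4 powr p * 2 powr \<alpha> * K1 * (1/2) powr (p - s * p) + K2 * 2 powr (s * p + \<alpha>)"
  have K: "0 < K" using K1 K2 by (simp add: K_def add_pos_pos)
  show ?thesis
  proof (rule that[OF K])
    fix x assume x: "x \<in> \<Omega>"
    define t where "t = d x"
    have t: "0 < t" using d_pos[OF x] by (simp add: t_def)
    define c where "c = 4 powr p * 2 powr \<alpha> * t powr - (p + \<alpha>) * t powr - \<beta>"
    have c: "0 \<le> c" by (simp add: c_def)
    have "ennreal (cut_bound x y * kernel x y) * indicator \<Omega> y \<le>
      ennreal c * (ennreal (norm (x - y) powr - (real DIM('a) + s * p - p)) * indicator {y. 0 < norm (x - y) \<and> norm (x - y) \<le> t / 2} y)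
      + ennreal (t powr - \<beta>) * (ennreal (norm (x - y) powr - (real DIM('a) + s * p)) * (ennreal (d y powr - \<alpha>) * indicator \<Omega> y) * indicator {y. t / 2 \<le> norm (x - y)} y)" for y
    proof (cases "y \<in> \<Omega> \<and> x \<noteq> y")
      case True
      then have y: "y \<in> \<Omega>" and nz: "0 < norm (x - y)" by auto
      show ?thesis
      proof (cases "norm (x - y) < t / 2")
        case True
        have "t / 2 \<le> d y" using d_lipschitz[of x y] True unfolding t_def by linarith
        then have 1: "d y powr - \<alpha> \<le> (t / 2) powr - \<alpha>" using t \<alpha> by (intro powr_mono2') auto
        have 2: "cut_bound x y \<le> (4 * norm (x - y) / t) powr p"
          unfolding cut_bound_def t_def[symmetric] using t p nz by (intro powr_mono2) auto
        have "cut_bound x y * kernel x y = cut_bound x y * (d y powr - \<alpha> * t powr - \<beta> * norm (x - y) powr - (real DIM('a) + s * p))"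
          by (simp only: kernel_def t_def powr_minus divide_inverse)
        also have "\<dots> \<le> (4 * norm (x - y) / t) powr p * ((t / 2) powr - \<alpha> * t powr - \<beta> * norm (x - y) powr - (real DIM('a) + s * p))"
          by (intro mult_mono 1 2) (auto simp: cut_bound_def)
        also have "\<dots> = c * norm (x - y) powr - (real DIM('a) + s * p - p)"
        proof -
          have a: "(4 * norm (x - y) / t) powr p = 4 powr p * norm (x - y) powr p * t powr - p"
            using t by (simp add: powr_divide powr_mult powr_minus field_simps)
          have b: "(t / 2) powr - \<alpha> = 2 powr \<alpha> * t powr - \<alpha>"
            using t by (simp add: powr_divide powr_minus field_simps)
          have e: "norm (x - y) powr - (real DIM('a) + s * p - p) = norm (x - y) powr p * norm (x - y) powr - (real DIM('a) + s * p)"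
            unfolding powr_add[symmetric] by (rule arg_cong[where f = "(powr) (norm (x - y))"]) simp
          have f: "t powr - (p + \<alpha>) = t powr - p * t powr - \<alpha>"
            unfolding powr_add[symmetric] by (rule arg_cong[where f = "(powr) t"]) simp
          show ?thesis unfolding c_def a b e f by (simp only: mult_ac)
        qed
        finally have "ennreal (cut_bound x y * kernel x y) \<le> ennreal c * ennreal (norm (x - y) powr - (real DIM('a) + s * p - p))"
          using c by (subst ennreal_mult[symmetric]) (auto intro: ennreal_leI)
        then show ?thesis using True y nz by (intro add_increasing2) auto
      next
        case False
        have "cut_bound x y \<le> 1 powr p" unfolding cut_bound_def using p t by (intro powr_mono2) (auto simp: t_def)
        then have "cut_bound x y * kernel x y \<le> 1 * kernel x y" using kernel_nonneg by (intro mult_right_mono) auto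
        also have "1 * kernel x y = t powr - \<beta> * (norm (x - y) powr - (real DIM('a) + s * p) * d y powr - \<alpha>)"
          by (simp only: kernel_def t_def powr_minus divide_inverse mult_1 mult_ac)
        finally have "ennreal (cut_bound x y * kernel x y) \<le> ennreal (t powr - \<beta>) * (ennreal (norm (x - y) powr - (real DIM('a) + s * p)) * ennreal (d y powr - \<alpha>))"
          by (subst ennreal_mult[symmetric], simp, simp, subst ennreal_mult[symmetric], simp, simp, intro ennreal_leI)
        then show ?thesis using False y by (intro add_increasing) auto
      qed
    qed (auto simp: kernel_def)
    then have "(\<integral>\<^sup>+y. ennreal (cut_bound x y * kernel x y) * indicator \<Omega> y \<partial>lborel) \<le>
      (\<integral>\<^sup>+y. ennreal c * (ennreal (norm (x - y) powr - (real DIM('a) + s * p - p)) * indicator {y. 0 < norm (x - y) \<and> norm (x - y) \<le> t / 2} y)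
      + ennreal (t powr - \<beta>) * (ennreal (norm (x - y) powr - (real DIM('a) + s * p)) * (ennreal (d y powr - \<alpha>) * indicator \<Omega> y) * indicator {y. t / 2 \<le> norm (x - y)} y) \<partial>lborel)"
      by (rule nn_integral_mono)
    also have "\<dots> = ennreal c * (\<integral>\<^sup>+y\<in>{y. 0 < norm (x - y) \<and> norm (x - y) \<le> t / 2}. ennreal (norm (x - y) powr - (real DIM('a) + s * p - p)) \<partial>lborel)
      + ennreal (t powr - \<beta>) * (\<integral>\<^sup>+y\<in>{y. t / 2 \<le> norm (x - y)}. ennreal (norm (x - y) powr - (real DIM('a) + s * p)) * (ennreal (d y powr - \<alpha>) * indicator \<Omega> y) \<partial>lborel)"
      by (subst nn_integral_add, measurable, subst nn_integral_cmult, measurable, subst nn_integral_cmult, measurable)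
    also have "\<dots> \<le> ennreal c * ennreal (K1 * (t / 2) powr (p - s * p)) + ennreal (t powr - \<beta>) * ennreal (K2 * (t / 2) powr - (s * p + \<alpha>))"
      using t by (intro add_mono mult_left_mono near far x) (auto simp: t_def)
    also have "\<dots> = ennreal (c * (K1 * (t / 2) powr (p - s * p)) + t powr - \<beta> * (K2 * (t / 2) powr - (s * p + \<alpha>)))"
      using c K1 K2 by (simp add: ennreal_mult)
    also have "c * (K1 * (t / 2) powr (p - s * p)) + t powr - \<beta> * (K2 * (t / 2) powr - (s * p + \<alpha>)) = K * t powr - (s * p + \<alpha> + \<beta>)"
    proof -
      have a: "(t / 2) powr (p - s * p) = (1/2) powr (p - s * p) * t powr (p - s * p)"
        using t by (simp flip: powr_mult)
      have b0: "(t / 2) powr - e = 2 powr e * t powr - e" for e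
        using t by (simp add: powr_divide powr_minus field_simps)
      have b: "(t / 2) powr - (s * p + \<alpha>) = 2 powr (s * p + \<alpha>) * t powr - (s * p + \<alpha>)"
        by (rule b0)
      have e: "t powr - (s * p + \<alpha> + \<beta>) = t powr - (p + \<alpha>) * t powr - \<beta> * t powr (p - s * p)"
        unfolding powr_add[symmetric] by (rule arg_cong[where f = "(powr) t"]) simp
      have f: "t powr - \<beta> * t powr - (s * p + \<alpha>) = t powr - (p + \<alpha>) * t powr - \<beta> * t powr (p - s * p)"
        unfolding powr_add[symmetric] by (rule arg_cong[where f = "(powr) t"]) simp
      have g: "t powr - \<beta> * (K2 * (2 powr (s * p + \<alpha>) * t powr - (s * p + \<alpha>))) = K2 * 2 powr (s * p + \<alpha>) * (t powr - \<beta> * t powr - (s * p + \<alpha>))"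
        by (simp only: mult_ac)
      show ?thesis unfolding a b e g[unfolded f] c_def K_def by (simp only: distrib_right distrib_left mult_ac)
    qed
    finally show "(\<integral>\<^sup>+y. ennreal (cut_bound x y * kernel x y) * indicator \<Omega> y \<partial>lborel) \<le> ennreal (K * d x powr - (s * p + \<alpha> + \<beta>))"
      by (simp add: t_def)
  qed
qed

text \<open>Equal to 1 next to the boundary and 0 deeper inside, so f times \<open>cut n\<close> is
  the part to be discarded.\<close>

definition cut :: "real \<Rightarrow> 'a \<Rightarrow> real" where
  "cut n x = max 0 (min 1 (2 - n * d x))"

lemma cut_measurable [measurable]: "cut n \<in> borel_measurable borel"
  unfolding cut_def[abs_def] by measurable

text \<open>The slope \<open>n\<close> is traded for 4/d(x), which is larger as long as n d(x) \<le>
  4. Otherwise the cut-off vanishes at \<open>x\<close>, and a nonzero value at \<open>y\<close>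
  forces d(y) < d(x)/2; then |x - y| exceeds d(x)/2 and the bound 1 is enough.\<close>

lemma cut_diff_le:
  assumes "x \<in> \<Omega>" and n: "0 \<le> n"
  shows "\<bar>cut n x - cut n y\<bar> powr p \<le> cut_bound x y"
  unfolding cut_bound_def
proof (rule powr_mono2)
  have dx: "0 < d x" using assms(1) by (rule d_pos)
  have "n * \<bar>d x - d y\<bar> \<le> n * norm (x - y)" using n d_lipschitz by (intro mult_left_mono) auto
  moreover have "\<bar>cut n x - cut n y\<bar> \<le> \<bar>n * d x - n * d y\<bar>" by (auto simp: cut_def)
  moreover have "\<bar>n * d x - n * d y\<bar> = n * \<bar>d x - d y\<bar>" using n by (simp flip: right_diff_distrib add: abs_mult)
  ultimately have lip: "\<bar>cut n x - cut n y\<bar> \<le> n * norm (x - y)" by linarith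
  have c01: "0 \<le> cut n z" "cut n z \<le> 1" for z by (auto simp: cut_def)
  have le1: "\<bar>cut n x - cut n y\<bar> \<le> 1"
    unfolding abs_le_iff using c01[of x] c01[of y] by linarith
  have "\<bar>cut n x - cut n y\<bar> \<le> 4 * norm (x - y) / d x"
  proof (cases "n * d x \<le> 4")
    case True
    then have "n \<le> 4 / d x" using dx by (simp add: field_simps)
    then have "n * norm (x - y) \<le> 4 / d x * norm (x - y)" by (intro mult_right_mono) auto
    then show ?thesis using lip by simp
  next
    case False
    then have cx: "cut n x = 0" by (simp add: cut_def)
    show ?thesis
    proof (cases "cut n y = 0")
      case True
      then show ?thesis using cx dx by simp
    next
      case ny: False
      then have "n * d y < 2" by (auto simp: cut_def split: if_splits)
      then have "n * (2 * d y) < n * d x" using False by linarith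
      then have "2 * d y < d x" using n by (simp add: mult_less_cancel_left)
      then have "d x \<le> 2 * norm (x - y)" using d_lipschitz[of x y] by linarith
      then have "1 \<le> 4 * norm (x - y) / d x" using dx by (simp add: field_simps)
      then show ?thesis using le1 by linarith
    qed
  qed
  then show "\<bar>cut n x - cut n y\<bar> \<le> min 1 (4 * norm (x - y) / d x)" using le1 by simp
qed (use p in auto)

lemma cut_eventually_zero:
  assumes "x \<in> \<Omega>"
  shows "eventually (\<lambda>n. cut (real n) x = 0) sequentially"
proof -
  have dx: "0 < d x" using assms by (rule d_pos)
  show ?thesis
    using eventually_ge_at_top[of "nat \<lceil>2 / d x\<rceil>"]
  proof eventually_elim
    case (elim n)
    then have "2 / d x \<le> real n" by linarith
    then have "2 \<le> real n * d x" using dx by (simp add: field_simps)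
    then show ?case by (simp add: cut_def)
  qed
qed

lemma cut_bound_measurable [measurable]: "case_prod cut_bound \<in> borel_measurable (borel \<Otimes>\<^sub>M borel)"
  unfolding cut_bound_def by measurable

lemma Lp_cut_tendsto:
  assumes [measurable]: "f \<in> borel_measurable borel" and "Lp f < \<infinity>"
  shows "(\<lambda>n. Lp (\<lambda>x. f x * cut (real n) x)) \<longlonglongrightarrow> 0"
proof -
  have "(\<lambda>n. Lp (\<lambda>x. f x * cut (real n) x)) \<longlonglongrightarrow> (\<integral>\<^sup>+x. 0 \<partial>(lborel :: 'a measure))"
    unfolding Lp_def
  proof (rule nn_integral_dominated_convergence[where w = "\<lambda>x. ennreal (\<bar>f x\<bar> powr p) * indicator \<Omega> x"])
    show "AE x in lborel. ennreal (\<bar>f x * cut (real n) x\<bar> powr p) * indicator \<Omega> x \<le> ennreal (\<bar>f x\<bar> powr p) * indicator \<Omega> x" for n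
      using p by (intro AE_I2 mult_right_mono ennreal_leI powr_mono2) (auto simp: abs_mult cut_def intro: mult_left_le)
    show "AE x in lborel. (\<lambda>n. ennreal (\<bar>f x * cut (real n) x\<bar> powr p) * indicator \<Omega> x) \<longlonglongrightarrow> 0"
    proof (intro AE_I2)
      fix x
      show "(\<lambda>n. ennreal (\<bar>f x * cut (real n) x\<bar> powr p) * indicator \<Omega> x) \<longlonglongrightarrow> 0"
      proof (cases "x \<in> \<Omega>")
        case True
        have "eventually (\<lambda>n. ennreal (\<bar>f x * cut (real n) x\<bar> powr p) * indicator \<Omega> x = 0) sequentially"
          using cut_eventually_zero[OF True] by eventually_elim (use p in simp)
        then show ?thesis by (rule tendsto_eventually)
      qed simp
    qed
    show "(\<integral>\<^sup>+x. ennreal (\<bar>f x\<bar> powr p) * indicator \<Omega> x \<partial>lborel) < \<infinity>"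
      using assms(2) by (simp add: Lp_def)
  qed measurable
  then show ?thesis by simp
qed

text \<open>A difference of products is (f x - f y) cut y + f x (cut x - cut y). The first part is
  dominated by the energy and the second, through \<open>cut_kernel_bound\<close>, by the Hardy
  integral. At each pair of points both cut-offs are eventually 0.\<close>

lemma energy_cut_tendsto:
  assumes [measurable]: "f \<in> borel_measurable borel" and E: "energy f < \<infinity>" and H: "hardy f < \<infinity>"
    and \<alpha>': "ereal \<alpha> < lower_assouad_codim (frontier \<Omega>)"
  shows "(\<lambda>n. energy (\<lambda>x. f x * cut (real n) x)) \<longlonglongrightarrow> 0"
proof -
  obtain K where K: "0 < K" and cb: "\<And>x. x \<in> \<Omega> \<Longrightarrow> (\<integral>\<^sup>+y. ennreal (cut_bound x y * kernel x y) * indicator \<Omega> y \<partial>lborel)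
      \<le> ennreal (K * d x powr - (s * p + \<alpha> + \<beta>))"
    by (fact cut_kernel_bound[OF \<alpha>'])
  define G where "G x y = ennreal (\<bar>f x - f y\<bar> powr p * kernel x y) * (indicator \<Omega> x * indicator \<Omega> y)" for x y
  define J where "J x y = ennreal (\<bar>f x\<bar> powr p) * indicator \<Omega> x * (ennreal (cut_bound x y * kernel x y) * indicator \<Omega> y)" for x y
  have [measurable]: "case_prod G \<in> borel_measurable (lborel \<Otimes>\<^sub>M lborel)" unfolding G_def by measurable
  have [measurable]: "case_prod J \<in> borel_measurable (lborel \<Otimes>\<^sub>M lborel)" unfolding J_def by measurable
  have JI: "(\<integral>\<^sup>+x. \<integral>\<^sup>+y. J x y \<partial>lborel \<partial>lborel) < \<infinity>"
  proof -
    have "(\<integral>\<^sup>+x. \<integral>\<^sup>+y. J x y \<partial>lborel \<partial>lborel) \<le> (\<integral>\<^sup>+x. ennreal K * (ennreal (\<bar>f x\<bar> powr p * d x powr - (s * p + \<alpha> + \<beta>)) * indicator \<Omega> x) \<partial>lborel)"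
    proof (rule nn_integral_mono)
      fix x
      have "(\<integral>\<^sup>+y. J x y \<partial>lborel) = ennreal (\<bar>f x\<bar> powr p) * indicator \<Omega> x * (\<integral>\<^sup>+y. ennreal (cut_bound x y * kernel x y) * indicator \<Omega> y \<partial>lborel)"
        unfolding J_def by (rule nn_integral_cmult) measurable
      also have "\<dots> \<le> ennreal K * (ennreal (\<bar>f x\<bar> powr p * d x powr - (s * p + \<alpha> + \<beta>)) * indicator \<Omega> x)"
      proof (cases "x \<in> \<Omega>")
        case True
        have "ennreal (\<bar>f x\<bar> powr p) * (\<integral>\<^sup>+y. ennreal (cut_bound x y * kernel x y) * indicator \<Omega> y \<partial>lborel)
          \<le> ennreal (\<bar>f x\<bar> powr p) * ennreal (K * d x powr - (s * p + \<alpha> + \<beta>))"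
          by (intro mult_left_mono cb True) auto
        also have "\<dots> = ennreal (\<bar>f x\<bar> powr p * (K * d x powr - (s * p + \<alpha> + \<beta>)))"
          using K by (intro ennreal_mult[symmetric]) auto
        also have "\<bar>f x\<bar> powr p * (K * d x powr - (s * p + \<alpha> + \<beta>)) = K * (\<bar>f x\<bar> powr p * d x powr - (s * p + \<alpha> + \<beta>))"
          by (simp only: mult_ac)
        also have "ennreal \<dots> = ennreal K * ennreal (\<bar>f x\<bar> powr p * d x powr - (s * p + \<alpha> + \<beta>))"
          using K by (intro ennreal_mult) auto
        finally show ?thesis using True by simp
      qed simp
      finally show "(\<integral>\<^sup>+y. J x y \<partial>lborel) \<le> ennreal K * (ennreal (\<bar>f x\<bar> powr p * d x powr - (s * p + \<alpha> + \<beta>)) * indicator \<Omega> x)" .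
    qed
    also have "\<dots> = ennreal K * hardy f" unfolding hardy_def by (rule nn_integral_cmult) measurable
    also have "\<dots> < \<infinity>" using H by (simp add: ennreal_mult_less_top)
    finally show ?thesis .
  qed
  show ?thesis
    unfolding energy_def
  proof (rule iterated_dominated_convergence_0[where w = "\<lambda>x y. ennreal (2 powr p) * (G x y + J x y)"])
    show "(\<integral>\<^sup>+x. \<integral>\<^sup>+y. ennreal (2 powr p) * (G x y + J x y) \<partial>lborel \<partial>lborel) < \<infinity>"
    proof -
      have "(\<integral>\<^sup>+x. \<integral>\<^sup>+y. ennreal (2 powr p) * (G x y + J x y) \<partial>lborel \<partial>lborel)
        = ennreal (2 powr p) * (energy f + (\<integral>\<^sup>+x. \<integral>\<^sup>+y. J x y \<partial>lborel \<partial>lborel))"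
        unfolding energy_def G_def[symmetric] by (simp add: nn_integral_add nn_integral_cmult)
      then show ?thesis using E JI by (simp add: ennreal_mult_less_top)
    qed
    fix x y
    show "ennreal (\<bar>f x * cut (real n) x - f y * cut (real n) y\<bar> powr p * kernel x y) * (indicator \<Omega> x * indicator \<Omega> y)
        \<le> ennreal (2 powr p) * (G x y + J x y)" for n
    proof (cases "x \<in> \<Omega> \<and> y \<in> \<Omega>")
      case True
      have "\<bar>f x * cut (real n) x - f y * cut (real n) y\<bar> powr p =
        \<bar>(f x - f y) * cut (real n) y + f x * (cut (real n) x - cut (real n) y)\<bar> powr p"
        by (simp add: algebra_simps)
      also have "\<dots> \<le> 2 powr p * (\<bar>(f x - f y) * cut (real n) y\<bar> powr p + \<bar>f x * (cut (real n) x - cut (real n) y)\<bar> powr p)"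
        by (rule powr_abs_add_le[OF p])
      also have "\<dots> \<le> 2 powr p * (\<bar>f x - f y\<bar> powr p + \<bar>f x\<bar> powr p * cut_bound x y)"
      proof (intro mult_left_mono add_mono)
        show "\<bar>(f x - f y) * cut (real n) y\<bar> powr p \<le> \<bar>f x - f y\<bar> powr p"
          using p by (intro powr_mono2) (auto simp: abs_mult cut_def intro: mult_left_le)
        show "\<bar>f x * (cut (real n) x - cut (real n) y)\<bar> powr p \<le> \<bar>f x\<bar> powr p * cut_bound x y"
          unfolding abs_mult powr_mult
          using True by (intro mult_left_mono cut_diff_le) auto
      qed auto
      finally have "\<bar>f x * cut (real n) x - f y * cut (real n) y\<bar> powr p * kernel x y \<le>
        2 powr p * (\<bar>f x - f y\<bar> powr p + \<bar>f x\<bar> powr p * cut_bound x y) * kernel x y"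
        using kernel_nonneg by (rule mult_right_mono)
      also have "\<dots> = 2 powr p * (\<bar>f x - f y\<bar> powr p * kernel x y + \<bar>f x\<bar> powr p * (cut_bound x y * kernel x y))"
        by (simp only: distrib_right mult.assoc)
      finally have "ennreal (\<bar>f x * cut (real n) x - f y * cut (real n) y\<bar> powr p * kernel x y) \<le>
        ennreal (2 powr p * (\<bar>f x - f y\<bar> powr p * kernel x y + \<bar>f x\<bar> powr p * (cut_bound x y * kernel x y)))"
        by (rule ennreal_leI)
      also have "\<dots> = ennreal (2 powr p) * (G x y + J x y)"
        using True kernel_nonneg[of x y] by (simp add: G_def J_def ennreal_mult' ennreal_plus cut_bound_def)
      finally show ?thesis using True by simp
    qed auto
    show "(\<lambda>n. ennreal (\<bar>f x * cut (real n) x - f y * cut (real n) y\<bar> powr p * kernel x y) * (indicator \<Omega> x * indicator \<Omega> y)) \<longlonglongrightarrow> 0"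
    proof (cases "x \<in> \<Omega> \<and> y \<in> \<Omega>")
      case True
      have "eventually (\<lambda>n. cut (real n) x = 0 \<and> cut (real n) y = 0) sequentially"
        using True by (intro eventually_conj cut_eventually_zero) auto
      then have "eventually (\<lambda>n. ennreal (\<bar>f x * cut (real n) x - f y * cut (real n) y\<bar> powr p * kernel x y) * (indicator \<Omega> x * indicator \<Omega> y) = 0) sequentially"
        by (rule eventually_mono) (use p in auto)
      then show ?thesis by (rule tendsto_eventually)
    qed auto
  qed measurable
qed

lemma compactly_supported_approx:
  assumes [measurable]: "f \<in> borel_measurable borel" and "Lp f < \<infinity>" "energy f < \<infinity>" "hardy f < \<infinity>"
    and "ereal \<alpha> < lower_assouad_codim (frontier \<Omega>)" and \<epsilon>: "0 < (\<epsilon> :: ennreal)"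
  obtains g \<delta> where "g \<in> borel_measurable borel" "\<And>x. x \<notin> \<Omega> \<Longrightarrow> g x = 0" "0 < \<delta>" "\<And>x. g x \<noteq> 0 \<Longrightarrow> \<delta> \<le> d x"
    "Lp (\<lambda>x. f x - g x) < \<epsilon>" "energy (\<lambda>x. f x - g x) < \<epsilon>"
proof -
  have "eventually (\<lambda>n. Lp (\<lambda>x. f x * cut (real n) x) < \<epsilon>) sequentially"
    by (rule order_tendstoD(2)[OF Lp_cut_tendsto[OF assms(1,2)] \<epsilon>])
  moreover have "eventually (\<lambda>n. energy (\<lambda>x. f x * cut (real n) x) < \<epsilon>) sequentially"
    by (rule order_tendstoD(2)[OF energy_cut_tendsto[OF assms(1,3,4,5)] \<epsilon>])
  moreover have "eventually (\<lambda>n. 0 < n) sequentially" by (rule eventually_gt_at_top)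
  ultimately have "eventually (\<lambda>n. Lp (\<lambda>x. f x * cut (real n) x) < \<epsilon> \<and> energy (\<lambda>x. f x * cut (real n) x) < \<epsilon> \<and> 0 < n) sequentially"
    by eventually_elim auto
  then obtain n where n: "Lp (\<lambda>x. f x * cut (real n) x) < \<epsilon>" "energy (\<lambda>x. f x * cut (real n) x) < \<epsilon>" "0 < n"
    by (auto simp: eventually_sequentially)
  define g where "g x = f x * (1 - cut (real n) x) * indicator \<Omega> x" for x
  have "AE x in lborel. x \<in> \<Omega> \<longrightarrow> f x - g x = f x * cut (real n) x"
    by (auto simp: g_def algebra_simps)
  note eq = AE_cong_functionals[OF this]
  show ?thesis
  proof (rule that[of g "1 / real n"])
    show "g \<in> borel_measurable borel" unfolding g_def[abs_def] by measurable
    fix x assume "g x \<noteq> 0"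
    then have "cut (real n) x \<noteq> 1" by (auto simp: g_def)
    then have "1 \<le> real n * d x" by (auto simp: cut_def split: if_splits)
    then show "1 / real n \<le> d x" using n(3) by (simp add: field_simps)
  qed (use n eq in \<open>auto simp: g_def\<close>)
qed

section \<open>Smooth approximation\<close>

lemma domain_norm_bound: obtains R where "\<And>x. x \<in> \<Omega> \<Longrightarrow> norm x \<le> R"
  using bounded unfolding bounded_iff by auto

lemma d_bound: obtains D where "0 < D" "\<And>x. x \<in> \<Omega> \<Longrightarrow> d x \<le> D"
proof -
  obtain R where R: "\<And>x. x \<in> \<Omega> \<Longrightarrow> norm x \<le> R" by (fact domain_norm_bound)
  obtain z where z: "z \<in> frontier \<Omega>" using frontier_nonempty by auto
  obtain a where a: "a \<in> \<Omega>" using nonempty by auto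
  have D: "d x \<le> R + norm z" if "x \<in> \<Omega>" for x
    using d_le_dist[OF z, of x] norm_triangle_ineq4[of x z] R[OF that] by linarith
  show ?thesis
  proof (rule that[OF _ D])
    show "0 < R + norm z" using d_pos[OF a] D[OF a] by linarith
  qed
qed

text \<open>The unweighted kernel in a strip around the diagonal. As a function of x - y alone it
  fits \<open>nn_integral_mollify_diff_le\<close>.\<close>

definition near_kernel :: "real \<Rightarrow> 'a \<Rightarrow> ennreal" where
  "near_kernel \<tau> z = ennreal (norm z powr - (real DIM('a) + s * p)) * indicator {z. norm z < \<tau>} z"

lemma near_kernel_measurable [measurable]: "near_kernel \<tau> \<in> borel_measurable borel"
  unfolding near_kernel_def[abs_def] by measurable

definition near_energy :: "real \<Rightarrow> ('a \<Rightarrow> real) \<Rightarrow> ennreal" where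
  "near_energy \<tau> f = (\<integral>\<^sup>+x. \<integral>\<^sup>+y. ennreal (\<bar>f x - f y\<bar> powr p) * near_kernel \<tau> (x - y) \<partial>lborel \<partial>lborel)"

lemma near_energy_diff:
  assumes [measurable]: "f \<in> borel_measurable borel" "g \<in> borel_measurable borel"
  shows "near_energy \<tau> (\<lambda>x. f x - g x) \<le> ennreal (2 powr p) * (near_energy \<tau> f + near_energy \<tau> g)"
proof -
  have "near_energy \<tau> (\<lambda>x. f x - g x) \<le> (\<integral>\<^sup>+x. \<integral>\<^sup>+y. ennreal (2 powr p) * (ennreal (\<bar>f x - f y\<bar> powr p) * near_kernel \<tau> (x - y)
      + ennreal (\<bar>g x - g y\<bar> powr p) * near_kernel \<tau> (x - y)) \<partial>lborel \<partial>lborel)"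
    unfolding near_energy_def
  proof (intro nn_integral_mono)
    fix x y
    have "\<bar>(f x - g x) - (f y - g y)\<bar> powr p \<le> 2 powr p * (\<bar>f x - f y\<bar> powr p + \<bar>g x - g y\<bar> powr p)"
      using powr_abs_diff_le[OF p, of "f x - f y" "g x - g y"] by (simp add: algebra_simps)
    then have "ennreal (\<bar>(f x - g x) - (f y - g y)\<bar> powr p) \<le> ennreal (2 powr p * (\<bar>f x - f y\<bar> powr p + \<bar>g x - g y\<bar> powr p))"
      by (rule ennreal_leI)
    also have "\<dots> = ennreal (2 powr p) * (ennreal (\<bar>f x - f y\<bar> powr p) + ennreal (\<bar>g x - g y\<bar> powr p))"
      by (simp add: ennreal_mult ennreal_plus)
    finally show "ennreal (\<bar>(f x - g x) - (f y - g y)\<bar> powr p) * near_kernel \<tau> (x - y) \<le> ennreal (2 powr p) * (ennreal (\<bar>f x - f y\<bar> powr p) * near_kernel \<tau> (x - y)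
      + ennreal (\<bar>g x - g y\<bar> powr p) * near_kernel \<tau> (x - y))"
      unfolding distrib_right[symmetric] mult.assoc[symmetric] by (rule mult_right_mono) simp
  qed
  also have "\<dots> = ennreal (2 powr p) * (near_energy \<tau> f + near_energy \<tau> g)"
    unfolding near_energy_def by (simp add: nn_integral_cmult nn_integral_add)
  finally show ?thesis .
qed

text \<open>On a bounded domain the weights are bounded below, so the weighted energy dominates the
  unweighted one. As the strip shrinks only the diagonal survives, where the integrand is 0.\<close>

lemma near_energy_tendsto:
  assumes [measurable]: "g \<in> borel_measurable borel" and E: "energy g < \<infinity>"
    and zero: "\<And>x. x \<notin> \<Omega> \<Longrightarrow> g x = 0" and \<delta>: "0 < \<delta>" "\<And>x. g x \<noteq> 0 \<Longrightarrow> \<delta> \<le> d x"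
  shows "(\<lambda>n. near_energy (\<delta> / real (Suc n)) g) \<longlonglongrightarrow> 0"
proof -
  obtain D where D: "0 < D" "\<And>x. x \<in> \<Omega> \<Longrightarrow> d x \<le> D" by (fact d_bound)
  have low: "norm (x - y) powr - (real DIM('a) + s * p) \<le> D powr (\<alpha> + \<beta>) * kernel x y" if "x \<in> \<Omega>" "y \<in> \<Omega>" for x y
  proof -
    have "D powr - \<alpha> \<le> d y powr - \<alpha>" "D powr - \<beta> \<le> d x powr - \<beta>"
      using d_pos that D(2) \<alpha> \<beta> by (auto intro!: powr_mono2')
    then have "D powr - \<alpha> * D powr - \<beta> \<le> d y powr - \<alpha> * d x powr - \<beta>" by (intro mult_mono) auto
    then have le: "D powr (\<alpha> + \<beta>) * (D powr - \<alpha> * D powr - \<beta> * norm (x - y) powr - (real DIM('a) + s * p))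
      \<le> D powr (\<alpha> + \<beta>) * (d y powr - \<alpha> * d x powr - \<beta> * norm (x - y) powr - (real DIM('a) + s * p))"
      by (intro mult_left_mono mult_right_mono) auto
    have one: "D powr (\<alpha> + \<beta>) * (D powr - \<alpha> * D powr - \<beta>) = 1"
      using D(1) by (simp flip: powr_add)
    have "norm (x - y) powr - (real DIM('a) + s * p) =
        D powr (\<alpha> + \<beta>) * (D powr - \<alpha> * D powr - \<beta>) * norm (x - y) powr - (real DIM('a) + s * p)"
      unfolding one by simp
    also have "\<dots> = D powr (\<alpha> + \<beta>) * (D powr - \<alpha> * D powr - \<beta> * norm (x - y) powr - (real DIM('a) + s * p))"
      by (rule mult.assoc)
    also note le
    also have "d y powr - \<alpha> * d x powr - \<beta> * norm (x - y) powr - (real DIM('a) + s * p) = kernel x y"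
      by (simp only: kernel_def powr_minus divide_inverse)
    finally show ?thesis .
  qed
  define G where "G x y = ennreal (\<bar>g x - g y\<bar> powr p * kernel x y) * (indicator \<Omega> x * indicator \<Omega> y)" for x y
  have [measurable]: "case_prod G \<in> borel_measurable (lborel \<Otimes>\<^sub>M lborel)" unfolding G_def by measurable
  show ?thesis unfolding near_energy_def
  proof (rule iterated_dominated_convergence_0[where w = "\<lambda>x y. ennreal (D powr (\<alpha> + \<beta>)) * G x y"])
    show "(\<integral>\<^sup>+x. \<integral>\<^sup>+y. ennreal (D powr (\<alpha> + \<beta>)) * G x y \<partial>lborel \<partial>lborel) < \<infinity>"
      using E unfolding energy_def G_def[symmetric] by (simp add: nn_integral_cmult ennreal_mult_less_top)
    fix x y
    show "ennreal (\<bar>g x - g y\<bar> powr p) * near_kernel (\<delta> / real (Suc n)) (x - y) \<le> ennreal (D powr (\<alpha> + \<beta>)) * G x y" for n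
    proof (cases "g x = g y \<or> \<not> norm (x - y) < \<delta> / real (Suc n)")
      case True
      then show ?thesis using p by (auto simp: near_kernel_def)
    next
      case False
      then have near: "norm (x - y) < \<delta> / real (Suc n)" and ne: "g x \<noteq> g y" by auto
      have "\<delta> / real (Suc n) \<le> \<delta>" using \<delta>(1) by (simp add: field_simps)
      then have n: "norm (x - y) < \<delta>" using near by linarith
      \<comment> \<open>The integral runs over the whole space; but one of the points lies in the
        support, at depth at least \<delta>, and the other is closer to it than \<delta>, hence also
        in the domain.\<close>
      have in\<Omega>: "x \<in> \<Omega> \<and> y \<in> \<Omega>"
      proof (cases "g x = 0")
        case True
        then have "g y \<noteq> 0" using ne by simp
        then show ?thesis using zero \<delta>(2) n mem_domain_of_near[of y x] by (force simp: norm_minus_commute)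
      next
        case False
        then show ?thesis using zero \<delta>(2) n mem_domain_of_near[of x y] by force
      qed
      have "\<bar>g x - g y\<bar> powr p * norm (x - y) powr - (real DIM('a) + s * p) \<le> \<bar>g x - g y\<bar> powr p * (D powr (\<alpha> + \<beta>) * kernel x y)"
        using low in\<Omega> by (intro mult_left_mono) auto
      also have "\<dots> = D powr (\<alpha> + \<beta>) * (\<bar>g x - g y\<bar> powr p * kernel x y)" by (simp only: mult_ac)
      finally have "ennreal (\<bar>g x - g y\<bar> powr p * norm (x - y) powr - (real DIM('a) + s * p)) \<le> ennreal (D powr (\<alpha> + \<beta>) * (\<bar>g x - g y\<bar> powr p * kernel x y))"
        by (rule ennreal_leI)
      then have "ennreal (\<bar>g x - g y\<bar> powr p) * ennreal (norm (x - y) powr - (real DIM('a) + s * p)) \<le> ennreal (D powr (\<alpha> + \<beta>)) * ennreal (\<bar>g x - g y\<bar> powr p * kernel x y)"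
        using kernel_nonneg[of x y] by (subst (1 2) ennreal_mult[symmetric]) auto
      then show ?thesis using in\<Omega> near by (simp add: near_kernel_def G_def)
    qed
    show "(\<lambda>n. ennreal (\<bar>g x - g y\<bar> powr p) * near_kernel (\<delta> / real (Suc n)) (x - y)) \<longlonglongrightarrow> 0"
    proof (cases "x = y")
      case False
      have "(\<lambda>n. \<delta> / real (Suc n)) \<longlonglongrightarrow> 0"
        using LIMSEQ_Suc[OF tendsto_divide_0[OF tendsto_const[of \<delta>] filterlim_real_sequentially[THEN filterlim_at_top_imp_at_infinity]]] by simp
      then have "eventually (\<lambda>n. \<delta> / real (Suc n) < norm (x - y)) sequentially"
        using False by (intro order_tendstoD(2)) auto
      then have "eventually (\<lambda>n. ennreal (\<bar>g x - g y\<bar> powr p) * near_kernel (\<delta> / real (Suc n)) (x - y) = 0) sequentially"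
        by (rule eventually_mono) (auto simp: near_kernel_def)
      then show ?thesis by (rule tendsto_eventually)
    qed (use p in simp)
  qed measurable
qed

text \<open>In the strip the weights are bounded. Outside it the kernel is bounded in terms of
  \<tau>, and |u x - u y|^p splits into terms with \<open>u\<close> at a single point. The weight at
  that point is bounded on the support; the other weight is integrated over the domain, so both
  exponents occur.\<close>

lemma energy_near_far:
  assumes [measurable]: "u \<in> borel_measurable borel"
    and \<delta>: "0 < \<delta>" "\<And>x. u x \<noteq> 0 \<Longrightarrow> x \<in> \<Omega> \<and> \<delta> \<le> d x" and \<tau>: "0 < \<tau>" "\<tau> \<le> \<delta> / 2"
  shows "energy u \<le> ennreal ((\<delta> / 2) powr - (\<alpha> + \<beta>)) * near_energy \<tau> u +
    ennreal (2 powr p * \<tau> powr - (real DIM('a) + s * p)) *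
      (ennreal (\<delta> powr - \<beta>) * (\<integral>\<^sup>+y. ennreal (d y powr - \<alpha>) * indicator \<Omega> y \<partial>lborel)
        + ennreal (\<delta> powr - \<alpha>) * (\<integral>\<^sup>+y. ennreal (d y powr - \<beta>) * indicator \<Omega> y \<partial>lborel)) * Lp u"
proof -
  define c1 c2 where "c1 = (\<delta> / 2) powr - (\<alpha> + \<beta>)" and "c2 = 2 powr p * \<tau> powr - (real DIM('a) + s * p)"
  have c: "0 \<le> c1" "0 \<le> c2" by (auto simp: c1_def c2_def)
  define Ia Ib where "Ia = (\<integral>\<^sup>+y. ennreal (d y powr - \<alpha>) * indicator \<Omega> y \<partial>lborel)"
    and "Ib = (\<integral>\<^sup>+y. ennreal (d y powr - \<beta>) * indicator \<Omega> y \<partial>lborel)"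
  define U where "U x = ennreal (\<bar>u x\<bar> powr p) * indicator \<Omega> x" for x
  have [measurable]: "U \<in> borel_measurable borel" unfolding U_def by measurable
  have Lp: "Lp u = (\<integral>\<^sup>+x. U x \<partial>lborel)" by (simp add: Lp_def U_def)
  define F1 where "F1 x y = ennreal (\<delta> powr - \<beta>) * U x * (ennreal (d y powr - \<alpha>) * indicator \<Omega> y)" for x y
  define F2 where "F2 x y = ennreal (\<delta> powr - \<alpha>) * (ennreal (d x powr - \<beta>) * indicator \<Omega> x) * U y" for x y
  have [measurable]: "case_prod F1 \<in> borel_measurable (lborel \<Otimes>\<^sub>M lborel)" "case_prod F2 \<in> borel_measurable (lborel \<Otimes>\<^sub>M lborel)"
    unfolding F1_def F2_def by measurable
  \<comment> \<open>True also off the support, where d(x) may be small: both sides are 0.\<close>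
  have weight: "\<bar>u x\<bar> powr p * d x powr - \<gamma> \<le> \<bar>u x\<bar> powr p * \<delta> powr - \<gamma>" if "0 \<le> \<gamma>" for x \<gamma>
  proof (cases "u x = 0")
    case False
    then have "d x powr - \<gamma> \<le> \<delta> powr - \<gamma>" using \<delta>(1) \<delta>(2)[of x] that by (intro powr_mono2') auto
    then show ?thesis by (intro mult_left_mono) auto
  qed (use p in simp)
  have pw: "ennreal (\<bar>u x - u y\<bar> powr p * kernel x y) * (indicator \<Omega> x * indicator \<Omega> y) \<le>
    ennreal c1 * (ennreal (\<bar>u x - u y\<bar> powr p) * near_kernel \<tau> (x - y)) + ennreal c2 * (F1 x y + F2 x y)" for x y
  proof (cases "x \<in> \<Omega> \<and> y \<in> \<Omega> \<and> u x \<noteq> u y")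
    case True
    then have x: "x \<in> \<Omega>" and y: "y \<in> \<Omega>" and ne: "u x \<noteq> u y" by auto
    have k: "kernel x y = d y powr - \<alpha> * d x powr - \<beta> * norm (x - y) powr - (real DIM('a) + s * p)"
      by (simp only: kernel_def powr_minus divide_inverse)
    show ?thesis
    proof (cases "norm (x - y) < \<tau>")
      case True
      \<comment> \<open>Because u x and u y differ, one point lies in the support; the other is less
        than \<tau> \<le> \<delta>/2 away.\<close>
      have "\<delta> / 2 \<le> d x \<and> \<delta> / 2 \<le> d y"
      proof (cases "u x = 0")
        case t: True
        then have "\<delta> \<le> d y" using ne \<delta>(2)[of y] by auto
        then show ?thesis using d_lipschitz[of x y] True \<tau>(2) \<delta>(1) by linarith
      next
        case f: False
        then have "\<delta> \<le> d x" using ne \<delta>(2)[of x] by auto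
        then show ?thesis using d_lipschitz[of x y] True \<tau>(2) \<delta>(1) by linarith
      qed
      then have "d y powr - \<alpha> \<le> (\<delta> / 2) powr - \<alpha>" "d x powr - \<beta> \<le> (\<delta> / 2) powr - \<beta>"
        using \<delta>(1) \<alpha> \<beta> by (auto intro!: powr_mono2')
      then have "d y powr - \<alpha> * d x powr - \<beta> \<le> (\<delta> / 2) powr - \<alpha> * (\<delta> / 2) powr - \<beta>" by (intro mult_mono) auto
      also have "\<dots> = c1" unfolding c1_def powr_add[symmetric] by (rule arg_cong[where f = "(powr) (\<delta> / 2)"]) simp
      finally have "kernel x y \<le> c1 * norm (x - y) powr - (real DIM('a) + s * p)"
        unfolding k by (rule mult_right_mono) simp
      then have "\<bar>u x - u y\<bar> powr p * kernel x y \<le> \<bar>u x - u y\<bar> powr p * (c1 * norm (x - y) powr - (real DIM('a) + s * p))"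
        by (rule mult_left_mono) simp
      also have "\<dots> = c1 * (\<bar>u x - u y\<bar> powr p * norm (x - y) powr - (real DIM('a) + s * p))" by (simp only: mult_ac)
      finally have "ennreal (\<bar>u x - u y\<bar> powr p * kernel x y) \<le> ennreal (c1 * (\<bar>u x - u y\<bar> powr p * norm (x - y) powr - (real DIM('a) + s * p)))"
        by (rule ennreal_leI)
      also have "\<dots> = ennreal c1 * (ennreal (\<bar>u x - u y\<bar> powr p) * near_kernel \<tau> (x - y))"
        using True c by (simp add: near_kernel_def ennreal_mult)
      finally show ?thesis using x y by - (rule add_increasing2, simp_all)
    next
      case False
      have n: "norm (x - y) powr - (real DIM('a) + s * p) \<le> \<tau> powr - (real DIM('a) + s * p)"
      proof (rule powr_mono2')
        have "0 \<le> s * p" using s p by simp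
        then show "- (real DIM('a) + s * p) \<le> 0" by simp
      qed (use False \<tau>(1) in auto)
      have "\<bar>u x - u y\<bar> powr p * kernel x y \<le> (2 powr p * (\<bar>u x\<bar> powr p + \<bar>u y\<bar> powr p)) * (d y powr - \<alpha> * d x powr - \<beta> * \<tau> powr - (real DIM('a) + s * p))"
        unfolding k using n by (intro mult_mono powr_abs_diff_le p) auto
      also have "\<dots> = c2 * (\<bar>u x\<bar> powr p * d x powr - \<beta> * d y powr - \<alpha> + \<bar>u y\<bar> powr p * d y powr - \<alpha> * d x powr - \<beta>)"
        unfolding c2_def by (simp add: algebra_simps)
      also have "\<dots> \<le> c2 * (\<bar>u x\<bar> powr p * \<delta> powr - \<beta> * d y powr - \<alpha> + \<bar>u y\<bar> powr p * \<delta> powr - \<alpha> * d x powr - \<beta>)"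
        by (intro mult_left_mono add_mono mult_right_mono weight \<alpha> \<beta> c) auto
      finally have "ennreal (\<bar>u x - u y\<bar> powr p * kernel x y) \<le> ennreal (c2 * (\<bar>u x\<bar> powr p * \<delta> powr - \<beta> * d y powr - \<alpha> + \<bar>u y\<bar> powr p * \<delta> powr - \<alpha> * d x powr - \<beta>))"
        by (rule ennreal_leI)
      also have "\<dots> = ennreal c2 * (F1 x y + F2 x y)"
        using x y c by (simp add: F1_def F2_def U_def ennreal_mult ennreal_plus mult_ac)
      finally show ?thesis using x y by - (rule add_increasing, simp_all)
    qed
  qed (use p in auto)
  have "energy u \<le> (\<integral>\<^sup>+x. \<integral>\<^sup>+y. ennreal c1 * (ennreal (\<bar>u x - u y\<bar> powr p) * near_kernel \<tau> (x - y)) + ennreal c2 * (F1 x y + F2 x y) \<partial>lborel \<partial>lborel)"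
    unfolding energy_def by (intro nn_integral_mono pw)
  also have "\<dots> = ennreal c1 * near_energy \<tau> u + ennreal c2 * ((\<integral>\<^sup>+x. \<integral>\<^sup>+y. F1 x y \<partial>lborel \<partial>lborel) + (\<integral>\<^sup>+x. \<integral>\<^sup>+y. F2 x y \<partial>lborel \<partial>lborel))"
    unfolding near_energy_def by (simp add: nn_integral_add nn_integral_cmult)
  also have "(\<integral>\<^sup>+x. \<integral>\<^sup>+y. F1 x y \<partial>lborel \<partial>lborel) = ennreal (\<delta> powr - \<beta>) * Ia * Lp u"
  proof -
    have "(\<integral>\<^sup>+y. F1 x y \<partial>lborel) = ennreal (\<delta> powr - \<beta>) * U x * Ia" for x
      unfolding F1_def Ia_def by (rule nn_integral_cmult) measurable
    then show ?thesis unfolding Lp by (simp add: nn_integral_cmult nn_integral_multc mult_ac)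
  qed
  also have "(\<integral>\<^sup>+x. \<integral>\<^sup>+y. F2 x y \<partial>lborel \<partial>lborel) = ennreal (\<delta> powr - \<alpha>) * Ib * Lp u"
  proof -
    have "(\<integral>\<^sup>+y. F2 x y \<partial>lborel) = ennreal (\<delta> powr - \<alpha>) * (ennreal (d x powr - \<beta>) * indicator \<Omega> x) * Lp u" for x
      unfolding F2_def Lp by (rule nn_integral_cmult) measurable
    then have "(\<integral>\<^sup>+x. \<integral>\<^sup>+y. F2 x y \<partial>lborel \<partial>lborel) = (\<integral>\<^sup>+x. ennreal (\<delta> powr - \<alpha>) * (ennreal (d x powr - \<beta>) * indicator \<Omega> x) * Lp u \<partial>lborel)"
      by simp
    also have "\<dots> = (\<integral>\<^sup>+x. ennreal (\<delta> powr - \<alpha>) * (ennreal (d x powr - \<beta>) * indicator \<Omega> x) \<partial>lborel) * Lp u"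
      by (rule nn_integral_multc) measurable
    also have "(\<integral>\<^sup>+x. ennreal (\<delta> powr - \<alpha>) * (ennreal (d x powr - \<beta>) * indicator \<Omega> x) \<partial>lborel) = ennreal (\<delta> powr - \<alpha>) * Ib"
      unfolding Ib_def by (rule nn_integral_cmult) measurable
    finally show ?thesis .
  qed
  finally show ?thesis
    by (simp add: c1_def c2_def Ia_def Ib_def distrib_left distrib_right mult_ac)
qed

text \<open>Mollification consumes less than \<delta> of the margin 2 \<delta>. The points of the
  closure with d \<ge> \<delta> form a compact set that avoids the boundary, where d = 0, and hence
  lies in the open domain.\<close>

lemma mollify_in_Cc_infinity:
  assumes \<psi>: "mollifier \<epsilon> \<psi>" and g: "integrable lborel g" and \<delta>: "0 < \<delta>" "\<epsilon> < \<delta>"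
    and supp: "\<And>x. g x \<noteq> 0 \<Longrightarrow> x \<in> \<Omega> \<and> 2 * \<delta> \<le> d x"
  shows "mollify \<psi> g x \<noteq> 0 \<Longrightarrow> x \<in> \<Omega> \<and> \<delta> \<le> d x" "mollify \<psi> g \<in> Cc_infinity \<Omega>"
proof -
  show S: "x \<in> \<Omega> \<and> \<delta> \<le> d x" if "mollify \<psi> g x \<noteq> 0" for x
  proof -
    have "\<exists>y. norm (x - y) \<le> \<epsilon> \<and> g y \<noteq> 0"
      using mollify_vanishes[OF \<psi>, of x g] that by auto
    then obtain y where y: "norm (x - y) \<le> \<epsilon>" "g y \<noteq> 0" by auto
    then have "y \<in> \<Omega>" "2 * \<delta> \<le> d y" using supp by auto
    then show ?thesis using y(1) \<delta> d_lipschitz[of x y] mem_domain_of_near[of y x]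
      by (auto simp: norm_minus_commute)
  qed
  define K where "K = {x. \<delta> \<le> d x} \<inter> closure \<Omega>"
  have "closed {x. \<delta> \<le> d x}" by (intro closed_Collect_le continuous_intros continuous_d)
  then have K: "closed K" unfolding K_def by (intro closed_Int closed_closure)
  have sub: "closure {x. mollify \<psi> g x \<noteq> 0} \<subseteq> K"
    using S closure_subset by (intro closure_minimal K) (auto simp: K_def)
  have "K \<subseteq> \<Omega>"
  proof
    fix x assume x: "x \<in> K"
    then have "x \<notin> frontier \<Omega>" using \<delta>(1) d_le_dist[of x x] by (auto simp: K_def)
    then show "x \<in> \<Omega>" using x open_domain by (auto simp: K_def frontier_def interior_open)
  qed
  moreover have "bounded K" using bounded by (auto simp: K_def intro: bounded_Int bounded_closure)
  then have "compact (closure {x. mollify \<psi> g x \<noteq> 0})"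
    using sub bounded_subset by (auto simp: compact_eq_bounded_closed)
  ultimately show "mollify \<psi> g \<in> Cc_infinity \<Omega>"
    using sub Ck_mollify[OF \<psi> g] by (auto simp: Cc_infinity_def)
qed

text \<open>The strip width is chosen from \<open>g\<close> alone: mollification does not increase
  the near energy, so smallness passes to the difference. Only then is the mollification radius
  chosen, with an L^p error small against the constant of the far part.\<close>

lemma smooth_approx:
  assumes [measurable]: "g \<in> borel_measurable borel" and L: "Lp g < \<infinity>" and E: "energy g < \<infinity>"
    and zero: "\<And>x. x \<notin> \<Omega> \<Longrightarrow> g x = 0" and \<delta>0: "0 < \<delta>0" "\<And>x. g x \<noteq> 0 \<Longrightarrow> \<delta>0 \<le> d x"
    and codim: "ereal \<alpha> < lower_assouad_codim (frontier \<Omega>)" "ereal \<beta> < lower_assouad_codim (frontier \<Omega>)"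
    and \<epsilon>: "0 < (\<epsilon> :: real)"
  obtains \<phi> where "\<phi> \<in> Cc_infinity \<Omega>" "Lp (\<lambda>x. g x - \<phi> x) \<le> ennreal \<epsilon>" "energy (\<lambda>x. g x - \<phi> x) \<le> ennreal \<epsilon>"
proof -
  obtain R where R: "\<And>x. x \<in> \<Omega> \<Longrightarrow> norm x \<le> R" by (fact domain_norm_bound)
  define \<delta> where "\<delta> = \<delta>0 / 2"
  have \<delta>: "0 < \<delta>" using \<delta>0(1) by (simp add: \<delta>_def)
  have supp: "x \<in> \<Omega> \<and> 2 * \<delta> \<le> d x" if "g x \<noteq> 0" for x using \<delta>0(2)[OF that] zero that by (auto simp: \<delta>_def)
  have L': "(\<integral>\<^sup>+x. ennreal (\<bar>g x\<bar> powr p) \<partial>lborel) < \<infinity>"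
  proof -
    have "(\<integral>\<^sup>+x. ennreal (\<bar>g x\<bar> powr p) \<partial>lborel) = Lp g"
      unfolding Lp_def using zero p by (intro nn_integral_cong) (auto simp: indicator_def)
    then show ?thesis using L by simp
  qed
  have gR: "g x = 0" if "R < norm x" for x using zero[of x] R[of x] that by force
  have g: "integrable lborel g"
    by (rule integrable_of_powr_integrable[OF p _ L' gR]) auto
  obtain a where a: "0 \<le> a" "(\<integral>\<^sup>+y. ennreal (d y powr - \<alpha>) * indicator \<Omega> y \<partial>lborel) = ennreal a"
    using nn_integral_d_powr_finite[OF \<alpha> codim(1)] by (cases "\<integral>\<^sup>+y. ennreal (d y powr - \<alpha>) * indicator \<Omega> y \<partial>lborel") auto
  obtain b where b: "0 \<le> b" "(\<integral>\<^sup>+y. ennreal (d y powr - \<beta>) * indicator \<Omega> y \<partial>lborel) = ennreal b"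
    using nn_integral_d_powr_finite[OF \<beta> codim(2)] by (cases "\<integral>\<^sup>+y. ennreal (d y powr - \<beta>) * indicator \<Omega> y \<partial>lborel") auto
  define c1 where "c1 = (\<delta> / 2) powr - (\<alpha> + \<beta>)"
  have c1: "0 < c1" using \<delta> by (simp add: c1_def)
  \<comment> \<open>Makes the near part, c1 times \<open>2 powr p\<close> times 2 \<eta>, equal to
    \<epsilon>/2.\<close>
  define \<eta> where "\<eta> = \<epsilon> / (4 * 2 powr p * c1)"
  have \<eta>: "0 < \<eta>" using \<epsilon> c1 by (simp add: \<eta>_def)
  have "(\<lambda>n. near_energy (\<delta> / real (Suc n)) g) \<longlonglongrightarrow> 0"
  proof (rule near_energy_tendsto[OF _ E zero \<delta>])
    show "\<delta> \<le> d x" if "g x \<noteq> 0" for x using supp[OF that] \<delta> by auto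
  qed auto
  then have "eventually (\<lambda>n. near_energy (\<delta> / real (Suc n)) g < ennreal \<eta>) sequentially"
    using \<eta> by (intro order_tendstoD(2)) auto
  \<comment> \<open>The condition n \<ge> 1 gives \<tau> = \<delta>/(n+1) \<le> \<delta>/2, as the
    splitting of the energy requires.\<close>
  then have "eventually (\<lambda>n. near_energy (\<delta> / real (Suc n)) g < ennreal \<eta> \<and> 1 \<le> n) sequentially"
    using eventually_ge_at_top[of "1::nat"] by (rule eventually_conj)
  then obtain n :: nat where n: "near_energy (\<delta> / real (Suc n)) g < ennreal \<eta>" "1 \<le> n"
    by (auto simp: eventually_sequentially)
  define \<tau> where "\<tau> = \<delta> / real (Suc n)"
  have \<tau>: "0 < \<tau>" "\<tau> \<le> \<delta> / 2" 
  proof -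
    show "0 < \<tau>" using \<delta> by (simp add: \<tau>_def)
    show "\<tau> \<le> \<delta> / 2" unfolding \<tau>_def using \<delta> n(2) by (intro divide_left_mono) auto
  qed
  define c3 where "c3 = 2 powr p * \<tau> powr - (real DIM('a) + s * p) * (\<delta> powr - \<beta> * a + \<delta> powr - \<alpha> * b)"
  have c3: "0 \<le> c3" using a b by (simp add: c3_def)
  \<comment> \<open>Leaves \<epsilon>/2 for the far part; the summand 1 covers c3 = 0 and yields
    \<theta> \<le> \<epsilon> for the L^p error.\<close>
  define \<theta> where "\<theta> = \<epsilon> / (2 * (c3 + 1))"
  have \<theta>: "0 < \<theta>" "\<theta> \<le> \<epsilon>" "c3 * \<theta> \<le> \<epsilon> / 2"
  proof -
    show "0 < \<theta>" using \<epsilon> c3 by (simp add: \<theta>_def)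
    have "\<theta> \<le> \<epsilon> / 1" unfolding \<theta>_def using \<epsilon> c3 by (intro divide_left_mono) auto
    then show "\<theta> \<le> \<epsilon>" by simp
    show "c3 * \<theta> \<le> \<epsilon> / 2" using \<epsilon> c3 by (simp add: \<theta>_def field_simps)
  qed
  obtain r where r: "0 < r" and conv: "\<And>e \<psi>. e < r \<Longrightarrow> mollifier e \<psi> \<Longrightarrow>
      (\<integral>\<^sup>+x. ennreal (\<bar>g x - mollify \<psi> g x\<bar> powr p) \<partial>lborel) < ennreal \<theta>"
    by (rule mollify_tendsto_Lp[OF p _ L' gR \<theta>(1)]) auto
  define e where "e = min r \<delta> / 2"
  have e: "0 < e" "e < r" "e < \<delta>" using r \<delta> by (auto simp: e_def min_def)
  obtain \<psi> :: "'a \<Rightarrow> real" where \<psi>: "mollifier e \<psi>"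
    using mollifier_exists[OF e(1)] unfolding mollifier_def by metis
  define \<phi> where "\<phi> = mollify \<psi> g"
  have \<phi>: "\<phi> \<in> Cc_infinity \<Omega>" "\<And>x. \<phi> x \<noteq> 0 \<Longrightarrow> x \<in> \<Omega> \<and> \<delta> \<le> d x"
    using mollify_in_Cc_infinity[OF \<psi> g \<delta> e(3) supp] by (auto simp: \<phi>_def)
  have [measurable]: "\<phi> \<in> borel_measurable borel"
    unfolding \<phi>_def by (intro borel_measurable_continuous_onI continuous_on_Ck[OF Ck_mollify[OF \<psi> g]])
  define u where "u x = g x - \<phi> x" for x
  have [measurable]: "u \<in> borel_measurable borel" unfolding u_def by measurable
  have usupp: "x \<in> \<Omega> \<and> \<delta> \<le> d x" if "u x \<noteq> 0" for x
  proof -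
    have "g x \<noteq> 0 \<or> \<phi> x \<noteq> 0" using that by (auto simp: u_def)
    then show ?thesis using supp[of x] \<phi>(2)[of x] \<delta> by auto
  qed
  have Lu: "Lp u \<le> ennreal \<theta>"
  proof -
    have "Lp u \<le> (\<integral>\<^sup>+x. ennreal (\<bar>g x - mollify \<psi> g x\<bar> powr p) \<partial>lborel)"
      unfolding Lp_def u_def \<phi>_def by (intro nn_integral_mono) (auto simp: indicator_def)
    then show ?thesis using conv[OF e(2) \<psi>] by auto
  qed
  have N: "near_energy \<tau> u \<le> ennreal (2 powr p * (2 * \<eta>))"
  proof -
    have "near_energy \<tau> \<phi> \<le> near_energy \<tau> g"
      unfolding near_energy_def \<phi>_def by (rule nn_integral_mollify_diff_le[OF p \<psi> g]) simp
    then have "near_energy \<tau> g + near_energy \<tau> \<phi> \<le> ennreal \<eta> + ennreal \<eta>"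
      using n(1) by (intro add_mono) (auto simp: \<tau>_def)
    also have "\<dots> = ennreal (2 * \<eta>)" using \<eta> by (subst ennreal_plus[symmetric]) auto
    finally have "ennreal (2 powr p) * (near_energy \<tau> g + near_energy \<tau> \<phi>) \<le> ennreal (2 powr p) * ennreal (2 * \<eta>)"
      by (rule mult_left_mono) simp
    also have "\<dots> = ennreal (2 powr p * (2 * \<eta>))" using \<eta> by (intro ennreal_mult[symmetric]) auto
    finally show ?thesis
      using near_energy_diff[of g \<phi> \<tau>] unfolding u_def by (auto intro: order_trans)
  qed
  have "energy u \<le> ennreal c1 * near_energy \<tau> u + ennreal (2 powr p * \<tau> powr - (real DIM('a) + s * p)) *
      (ennreal (\<delta> powr - \<beta>) * ennreal a + ennreal (\<delta> powr - \<alpha>) * ennreal b) * Lp u"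
    using energy_near_far[of u, OF _ \<delta> usupp \<tau>] unfolding a(2) b(2) c1_def by simp
  also have "ennreal (2 powr p * \<tau> powr - (real DIM('a) + s * p)) *
      (ennreal (\<delta> powr - \<beta>) * ennreal a + ennreal (\<delta> powr - \<alpha>) * ennreal b) = ennreal c3"
    unfolding c3_def using a b by (simp add: ennreal_mult ennreal_plus)
  also have "ennreal c1 * near_energy \<tau> u + ennreal c3 * Lp u \<le> ennreal c1 * ennreal (2 powr p * (2 * \<eta>)) + ennreal c3 * ennreal \<theta>"
    by (intro add_mono mult_left_mono N Lu) auto
  also have "\<dots> = ennreal (c1 * (2 powr p * (2 * \<eta>)) + c3 * \<theta>)"
    using c1 c3 \<eta> \<theta> by (simp add: ennreal_mult ennreal_plus)
  also have "\<dots> \<le> ennreal \<epsilon>"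
  proof (rule ennreal_leI)
    have "c1 * (2 powr p * (2 * \<eta>)) = \<epsilon> / 2" using c1 by (simp add: \<eta>_def field_simps)
    then show "c1 * (2 powr p * (2 * \<eta>)) + c3 * \<theta> \<le> \<epsilon>" using \<theta>(3) by linarith
  qed
  finally have "energy u \<le> ennreal \<epsilon>" .
  moreover have "Lp u \<le> ennreal \<epsilon>" using Lu \<theta> by (auto intro: order_trans ennreal_leI)
  ultimately show ?thesis using that[OF \<phi>(1)] unfolding u_def by blast
qed

section \<open>The two inclusions\<close>

lemma sobolev_iff:
  "f \<in> sobolev \<Omega> s p \<alpha> \<beta> \<longleftrightarrow> f \<in> borel_measurable (lebesgue_on \<Omega>) \<and> Lp f < \<infinity> \<and> energy f < \<infinity>"
  by (auto simp: sobolev_def Lp_space_def Lp_eq energy_eq)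

lemma sobolev_norm_eq:
  "sobolev_norm \<Omega> s p \<alpha> \<beta> f = enn2real (Lp f) powr (1 / p) + enn2real (energy f) powr (1 / p)"
  by (simp add: sobolev_norm_def Lp_norm_def gagliardo_seminorm_def Lp_eq energy_eq)

text \<open>Thirds instead of halves, so that two non-strict bounds give a strict one.\<close>

lemma sobolev_norm_less:
  assumes "0 < \<epsilon>" "Lp f \<le> ennreal ((\<epsilon> / 3) powr p)" "energy f \<le> ennreal ((\<epsilon> / 3) powr p)"
  shows "sobolev_norm \<Omega> s p \<alpha> \<beta> f < \<epsilon>"
proof -
  have *: "enn2real X powr (1 / p) \<le> \<epsilon> / 3" if "X \<le> ennreal ((\<epsilon> / 3) powr p)" for X
  proof -
    have "enn2real X \<le> (\<epsilon> / 3) powr p" using that by (intro enn2real_leI) auto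
    then have "enn2real X powr (1 / p) \<le> ((\<epsilon> / 3) powr p) powr (1 / p)" using p by (intro powr_mono2) auto
    also have "\<dots> = \<epsilon> / 3" using p assms(1) by (simp add: powr_powr)
    finally show ?thesis .
  qed
  show ?thesis using *[OF assms(2)] *[OF assms(3)] assms(1) unfolding sobolev_norm_eq by linarith
qed

text \<open>Finiteness is assumed because \<open>enn2real\<close> sends infinity to 0, and a small
  norm alone would then say nothing.\<close>

lemma le_of_sobolev_norm_less:
  assumes "sobolev_norm \<Omega> s p \<alpha> \<beta> f < \<epsilon>" "Lp f < \<infinity>" "energy f < \<infinity>"
  shows "Lp f \<le> ennreal (\<epsilon> powr p)" "energy f \<le> ennreal (\<epsilon> powr p)"
proof -
  have *: "X \<le> ennreal (\<epsilon> powr p)" if "X < \<infinity>" "enn2real X powr (1 / p) < \<epsilon>" for X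
  proof -
    have "(enn2real X powr (1 / p)) powr p \<le> \<epsilon> powr p" using that p by (intro powr_mono2) auto
    then have "enn2real X \<le> \<epsilon> powr p" using p by (simp add: powr_powr)
    then have "ennreal (enn2real X) \<le> ennreal (\<epsilon> powr p)" by (rule ennreal_leI)
    then show ?thesis by (subst (asm) ennreal_enn2real) (use that in auto)
  qed
  have "0 \<le> enn2real (Lp f) powr (1 / p)" "0 \<le> enn2real (energy f) powr (1 / p)" by auto
  then have "enn2real (Lp f) powr (1 / p) < \<epsilon>" "enn2real (energy f) powr (1 / p) < \<epsilon>"
    using assms(1) unfolding sobolev_norm_eq by linarith+
  then show "Lp f \<le> ennreal (\<epsilon> powr p)" "energy f \<le> ennreal (\<epsilon> powr p)"
    using * assms(2,3) by auto
qed

text \<open>Extension by 0 is Lebesgue measurable on the whole space and so agrees with a Borel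
  function off a null set.\<close>

lemma borel_representative:
  fixes f :: "'a \<Rightarrow> real"
  assumes "f \<in> borel_measurable (lebesgue_on \<Omega>)"
  obtains f' where "f' \<in> borel_measurable borel" "AE x in lborel. x \<in> \<Omega> \<longrightarrow> f x = f' x"
proof -
  have "(\<lambda>x. if x \<in> \<Omega> then f x else 0) \<in> borel_measurable lebesgue"
    using assms open_domain by (subst borel_measurable_if) auto
  then obtain f' where f': "f' \<in> borel_measurable lborel" "AE x in lborel. (if x \<in> \<Omega> then f x else 0) = f' x"
    using completion_ex_borel_measurable_real by blast
  show ?thesis
  proof (rule that)
    show "f' \<in> borel_measurable borel" using f'(1) by simp
    show "AE x in lborel. x \<in> \<Omega> \<longrightarrow> f x = f' x" using f'(2) by eventually_elim (auto split: if_splits)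
  qed
qed

lemma Cc_infinity_measurable: "\<phi> \<in> Cc_infinity \<Omega> \<Longrightarrow> \<phi> \<in> borel_measurable borel"
  unfolding Cc_infinity_def by (auto intro!: borel_measurable_continuous_onI continuous_on_Ck)

lemma Cc_infinity_support:
  assumes "\<phi> \<in> Cc_infinity \<Omega>"
  obtains \<delta> where "0 < \<delta>" "\<And>x. \<phi> x \<noteq> 0 \<Longrightarrow> \<delta> \<le> d x"
proof -
  define K where "K = closure {x. \<phi> x \<noteq> 0}"
  have K: "compact K" "K \<subseteq> \<Omega>" using assms by (auto simp: Cc_infinity_def K_def)
  have KS: "x \<in> K" if "\<phi> x \<noteq> 0" for x
    unfolding K_def by (rule subsetD[OF closure_subset]) (use that in simp)
  show ?thesis
  proof (cases "K = {}")
    case True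
    then show ?thesis using that[of 1] KS by auto
  next
    case False
    then obtain w where w: "w \<in> K" "\<And>x. x \<in> K \<Longrightarrow> d w \<le> d x"
      using continuous_attains_inf[OF K(1) False continuous_d] by blast
    show ?thesis
    proof (rule that)
      show "0 < d w" using w K d_pos by auto
      show "d w \<le> d x" if "\<phi> x \<noteq> 0" for x using w(2) KS[OF that] by auto
    qed
  qed
qed

text \<open>The test function depends on the truncation level: its L^p error is taken below the
  reciprocal of the largest weight on the truncated set. All truncated integrals then share one
  bound, and they increase to the Hardy integral.\<close>

lemma sobolev0_imp_hardy_finite:
  assumes "uniform_domain \<Omega>" "upper_assouad_codim (frontier \<Omega>) < ereal (s * p + \<alpha> + \<beta>)"
    and f: "f \<in> sobolev0 \<Omega> s p \<alpha> \<beta>"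
  shows "hardy f < \<infinity>"
proof -
  obtain C where C: "0 < C" and har:
    "\<And>\<phi>. \<phi> \<in> borel_measurable borel \<Longrightarrow> hardy \<phi> < \<infinity> \<Longrightarrow> hardy \<phi> \<le> ennreal C * (Lp \<phi> + energy \<phi>)"
    by (fact fractional_hardy_inequality[OF assms(1,2)])
  have fm: "f \<in> borel_measurable (lebesgue_on \<Omega>)" and fin: "Lp f < \<infinity>" "energy f < \<infinity>"
    using f by (auto simp: sobolev0_def sobolev_iff)
  obtain f' where f'[measurable]: "f' \<in> borel_measurable borel" and ae: "AE x in lborel. x \<in> \<Omega> \<longrightarrow> f x = f' x"
    using borel_representative[OF fm] by blast
  note eq = AE_cong_functionals[OF ae]
  define P where "P = ennreal (2 powr p)"
  \<comment> \<open>The first 1 bounds the weighted error on the truncated set, the other two bound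
    \<open>Lp\<close> and \<open>energy\<close> of f' - \<phi>; each \<open>P\<close> comes from a
    triangle inequality.\<close>
  define B where "B = P * (1 + ennreal C * (P * (Lp f' + 1) + P * (energy f' + 1)))"
  have Bfin: "B < \<infinity>"
    using fin unfolding eq B_def P_def by (simp add: ennreal_mult_less_top)
  define \<sigma> where "\<sigma> = s * p + \<alpha> + \<beta>"
  have \<sigma>: "0 \<le> \<sigma>" using s p \<alpha> \<beta> by (simp add: \<sigma>_def)
  define h where "h n x = ennreal (\<bar>f' x\<bar> powr p * d x powr - \<sigma>) * indicator (\<Omega> \<inter> {x. 1 / real (Suc n) \<le> d x}) x" for n x
  have hB: "(\<integral>\<^sup>+x. h n x \<partial>lborel) \<le> B" for n
  proof -
    define \<delta> where "\<delta> = 1 / real (Suc n)"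
    have \<delta>: "0 < \<delta>" by (simp add: \<delta>_def)
    \<comment> \<open>The error \<epsilon>^p = m is at most 1, for a bound free of n, and at most
      \<delta>^\<sigma>, to offset the weight \<delta>^(-\<sigma>).\<close>
    define m where "m = min 1 (\<delta> powr \<sigma>)"
    have m: "0 < m" "m \<le> 1" "m \<le> \<delta> powr \<sigma>" using \<delta> by (auto simp: m_def)
    define \<epsilon> where "\<epsilon> = m powr (1 / p)"
    have \<epsilon>: "0 < \<epsilon>" "\<epsilon> powr p \<le> 1" "\<epsilon> powr p \<le> \<delta> powr \<sigma>"
      using m p by (auto simp: \<epsilon>_def powr_powr)
    obtain \<phi> where \<phi>: "\<phi> \<in> Cc_infinity \<Omega>" "\<phi> \<in> sobolev \<Omega> s p \<alpha> \<beta>" "sobolev_norm \<Omega> s p \<alpha> \<beta> (\<lambda>x. f x - \<phi> x) < \<epsilon>"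
      using f \<epsilon>(1) by (auto simp: sobolev0_def)
    note [measurable] = Cc_infinity_measurable[OF \<phi>(1)]
    have \<phi>fin: "Lp \<phi> < \<infinity>" "energy \<phi> < \<infinity>" using \<phi>(2) by (auto simp: sobolev_iff)
    have "AE x in lborel. x \<in> \<Omega> \<longrightarrow> f x - \<phi> x = f' x - \<phi> x" using ae by eventually_elim auto
    note eq' = AE_cong_functionals[OF this]
    define v where "v x = f' x - \<phi> x" for x
    have [measurable]: "v \<in> borel_measurable borel" unfolding v_def by measurable
    have vfin: "Lp v < \<infinity>" "energy v < \<infinity>"
    proof -
      have "Lp v \<le> ennreal (2 powr p) * (Lp f' + Lp \<phi>)" unfolding v_def by (rule Lp_diff) auto
      also have "\<dots> < \<infinity>" using fin \<phi>fin unfolding eq by (simp add: ennreal_mult_less_top)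
      finally show "Lp v < \<infinity>" .
      have "energy v \<le> ennreal (2 powr p) * (energy f' + energy \<phi>)" unfolding v_def by (rule energy_diff) auto
      also have "\<dots> < \<infinity>" using fin \<phi>fin unfolding eq by (simp add: ennreal_mult_less_top)
      finally show "energy v < \<infinity>" .
    qed
    have v: "Lp v \<le> ennreal (\<epsilon> powr p)" "energy v \<le> ennreal (\<epsilon> powr p)"
      using le_of_sobolev_norm_less[OF \<phi>(3)] vfin unfolding eq' v_def by auto
    have e1: "ennreal (\<epsilon> powr p) \<le> 1" using \<epsilon>(2) by simp
    have v1: "Lp v \<le> 1" "energy v \<le> 1" using order_trans[OF v(1) e1] order_trans[OF v(2) e1] by auto
    have "\<phi> = (\<lambda>x. f' x - v x)" by (auto simp: v_def)
    then have L1: "Lp \<phi> \<le> P * (Lp f' + Lp v)" and E1: "energy \<phi> \<le> P * (energy f' + energy v)"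
      using Lp_diff[of f' v] energy_diff[of f' v] by (auto simp: P_def)
    have \<phi>b: "Lp \<phi> \<le> P * (Lp f' + 1)" "energy \<phi> \<le> P * (energy f' + 1)"
      by (rule order_trans[OF L1] order_trans[OF E1], intro mult_left_mono add_left_mono v1, simp)+
    obtain \<rho> where \<rho>: "0 < \<rho>" "\<And>x. \<phi> x \<noteq> 0 \<Longrightarrow> \<rho> \<le> d x" by (fact Cc_infinity_support[OF \<phi>(1)])
    have "hardy \<phi> < \<infinity>" using \<rho> by (intro hardy_finite_of_support[OF \<phi>fin(1) \<rho>(1)]) auto
    then have "hardy \<phi> \<le> ennreal C * (Lp \<phi> + energy \<phi>)" by (intro har) auto
    also have "\<dots> \<le> ennreal C * (P * (Lp f' + 1) + P * (energy f' + 1))"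
      using \<phi>b by (intro mult_left_mono add_mono) auto
    finally have H: "hardy \<phi> \<le> ennreal C * (P * (Lp f' + 1) + P * (energy f' + 1))" .
    have "(\<integral>\<^sup>+x. h n x \<partial>lborel) \<le> (\<integral>\<^sup>+x. P * (ennreal (\<delta> powr - \<sigma>) * (ennreal (\<bar>v x\<bar> powr p) * indicator \<Omega> x) +
        ennreal (\<bar>\<phi> x\<bar> powr p * d x powr - \<sigma>) * indicator \<Omega> x) \<partial>lborel)"
    proof (rule nn_integral_mono)
      fix x
      have hx: "h n x = ennreal (\<bar>f' x\<bar> powr p * d x powr - \<sigma>) * indicator (\<Omega> \<inter> {x. \<delta> \<le> d x}) x"
        by (simp only: h_def \<delta>_def)
      show "h n x \<le> P * (ennreal (\<delta> powr - \<sigma>) * (ennreal (\<bar>v x\<bar> powr p) * indicator \<Omega> x) +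
        ennreal (\<bar>\<phi> x\<bar> powr p * d x powr - \<sigma>) * indicator \<Omega> x)"
      proof (cases "x \<in> \<Omega> \<and> \<delta> \<le> d x")
        case True
        have "d x powr - \<sigma> \<le> \<delta> powr - \<sigma>" using True \<delta> \<sigma> by (intro powr_mono2') auto
        then have 1: "\<bar>v x\<bar> powr p * d x powr - \<sigma> \<le> \<bar>v x\<bar> powr p * \<delta> powr - \<sigma>" by (rule mult_left_mono) simp
        have "\<bar>f' x\<bar> powr p \<le> 2 powr p * (\<bar>v x\<bar> powr p + \<bar>\<phi> x\<bar> powr p)"
          using powr_abs_add_le[OF p, of "v x" "\<phi> x"] by (simp add: v_def)
        then have "\<bar>f' x\<bar> powr p * d x powr - \<sigma> \<le> 2 powr p * (\<bar>v x\<bar> powr p + \<bar>\<phi> x\<bar> powr p) * d x powr - \<sigma>"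
          by (rule mult_right_mono) simp
        also have "\<dots> = 2 powr p * (\<bar>v x\<bar> powr p * d x powr - \<sigma> + \<bar>\<phi> x\<bar> powr p * d x powr - \<sigma>)"
          by (simp only: distrib_right mult.assoc)
        also have "\<dots> \<le> 2 powr p * (\<bar>v x\<bar> powr p * \<delta> powr - \<sigma> + \<bar>\<phi> x\<bar> powr p * d x powr - \<sigma>)"
          by (rule mult_left_mono, rule add_right_mono, rule 1) simp
        finally have "ennreal (\<bar>f' x\<bar> powr p * d x powr - \<sigma>) \<le> ennreal (2 powr p * (\<bar>v x\<bar> powr p * \<delta> powr - \<sigma> + \<bar>\<phi> x\<bar> powr p * d x powr - \<sigma>))"
          by (rule ennreal_leI)
        also have "\<dots> = P * (ennreal (\<delta> powr - \<sigma>) * ennreal (\<bar>v x\<bar> powr p) + ennreal (\<bar>\<phi> x\<bar> powr p * d x powr - \<sigma>))"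
          unfolding P_def by (simp add: ennreal_mult ennreal_plus mult.commute)
        finally show ?thesis using True by (simp add: hx)
      qed (auto simp: hx)
    qed
    also have "\<dots> = P * (ennreal (\<delta> powr - \<sigma>) * Lp v + hardy \<phi>)"
      unfolding Lp_def hardy_def \<sigma>_def[symmetric] by (simp add: nn_integral_cmult nn_integral_add)
    also have "\<dots> \<le> P * (1 + ennreal C * (P * (Lp f' + 1) + P * (energy f' + 1)))"
    proof (intro mult_left_mono add_mono H)
      have "ennreal (\<delta> powr - \<sigma>) * Lp v \<le> ennreal (\<delta> powr - \<sigma>) * ennreal (\<delta> powr \<sigma>)"
        using v(1) \<epsilon>(3) by (intro mult_left_mono) (auto intro: order_trans ennreal_leI)
      also have "\<dots> = ennreal (\<delta> powr - \<sigma> * \<delta> powr \<sigma>)" by (rule ennreal_mult[symmetric]) auto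
      also have "\<delta> powr - \<sigma> * \<delta> powr \<sigma> = 1" using \<delta> by (simp flip: powr_add)
      finally show "ennreal (\<delta> powr - \<sigma>) * Lp v \<le> 1" by simp
    qed auto
    finally show ?thesis by (simp add: B_def)
  qed
  \<comment> \<open>The truncated sets exhaust the domain because d is positive on it.\<close>
  have "hardy f' = (\<integral>\<^sup>+x. (SUP n. h n x) \<partial>lborel)"
    unfolding hardy_def
  proof (intro nn_integral_cong)
    fix x
    show "ennreal (\<bar>f' x\<bar> powr p * d x powr - (s * p + \<alpha> + \<beta>)) * indicator \<Omega> x = (SUP n. h n x)"
    proof (rule antisym)
      show "(SUP n. h n x) \<le> ennreal (\<bar>f' x\<bar> powr p * d x powr - (s * p + \<alpha> + \<beta>)) * indicator \<Omega> x"
        by (intro SUP_least) (auto simp: h_def \<sigma>_def indicator_def)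
      show "ennreal (\<bar>f' x\<bar> powr p * d x powr - (s * p + \<alpha> + \<beta>)) * indicator \<Omega> x \<le> (SUP n. h n x)"
      proof (cases "x \<in> \<Omega>")
        case True
        then obtain n where "inverse (real (Suc n)) < d x" using reals_Archimedean[OF d_pos[OF True]] by blast
        then have "ennreal (\<bar>f' x\<bar> powr p * d x powr - (s * p + \<alpha> + \<beta>)) * indicator \<Omega> x = h n x"
          using True by (auto simp: h_def \<sigma>_def inverse_eq_divide)
        then show ?thesis by (simp only:) (rule SUP_upper, simp)
      qed simp
    qed
  qed
  also have "\<dots> = (SUP n. \<integral>\<^sup>+x. h n x \<partial>lborel)"
  proof (rule nn_integral_monotone_convergence_SUP)
    show "incseq h"
    proof (intro incseq_SucI le_funI)
      fix n x
      have "1 / real (Suc (Suc n)) \<le> 1 / real (Suc n)" by (intro divide_left_mono) auto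
      then show "h n x \<le> h (Suc n) x" unfolding h_def by (intro mult_left_mono) (auto simp: indicator_def)
    qed
    show "h n \<in> borel_measurable lborel" for n unfolding h_def by measurable
  qed
  also have "\<dots> \<le> B" using hB by (intro SUP_least)
  finally show ?thesis using Bfin unfolding eq by (rule order.strict_trans1)
qed

lemma hardy_finite_imp_sobolev0:
  assumes codim: "ereal \<alpha> < lower_assouad_codim (frontier \<Omega>)" "ereal \<beta> < lower_assouad_codim (frontier \<Omega>)"
    and f: "f \<in> sobolev \<Omega> s p \<alpha> \<beta>" and H: "hardy f < \<infinity>"
  shows "f \<in> sobolev0 \<Omega> s p \<alpha> \<beta>"
proof -
  have fm: "f \<in> borel_measurable (lebesgue_on \<Omega>)" and fin: "Lp f < \<infinity>" "energy f < \<infinity>"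
    using f by (auto simp: sobolev_iff)
  obtain f' where f'[measurable]: "f' \<in> borel_measurable borel" and ae: "AE x in lborel. x \<in> \<Omega> \<longrightarrow> f x = f' x"
    using borel_representative[OF fm] by blast
  note eq = AE_cong_functionals[OF ae]
  note fin' = fin[unfolded eq] H[unfolded eq]
  have "\<exists>\<phi>\<in>Cc_infinity \<Omega> \<inter> sobolev \<Omega> s p \<alpha> \<beta>. sobolev_norm \<Omega> s p \<alpha> \<beta> (\<lambda>x. f x - \<phi> x) < \<epsilon>"
    if \<epsilon>: "0 < \<epsilon>" for \<epsilon>
  proof -
    \<comment> \<open>Two errors of size \<eta> with the factor \<open>2 powr p\<close> give
      (\<epsilon>/3)^p, the threshold in \<open>sobolev_norm_less\<close>.\<close>
    define \<eta> where "\<eta> = (\<epsilon> / 3) powr p / (2 * 2 powr p)"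
    have \<eta>: "0 < \<eta>" using \<epsilon> by (simp add: \<eta>_def)
    then have \<eta>': "0 < ennreal \<eta>" by simp
    obtain g \<delta> where g[measurable]: "g \<in> borel_measurable borel" and g0: "\<And>x. x \<notin> \<Omega> \<Longrightarrow> g x = 0"
      and \<delta>: "0 < \<delta>" "\<And>x. g x \<noteq> 0 \<Longrightarrow> \<delta> \<le> d x"
      and fg: "Lp (\<lambda>x. f' x - g x) < ennreal \<eta>" "energy (\<lambda>x. f' x - g x) < ennreal \<eta>"
      by (fact compactly_supported_approx[OF f' fin' codim(1) \<eta>'])
    have fg_fin: "Lp (\<lambda>x. f' x - g x) < \<infinity>" "energy (\<lambda>x. f' x - g x) < \<infinity>"
      using fg by (auto intro: less_trans)
    have geq: "g = (\<lambda>x. f' x - (f' x - g x))" by auto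
    have "Lp (\<lambda>x. f' x - (f' x - g x)) \<le> ennreal (2 powr p) * (Lp f' + Lp (\<lambda>x. f' x - g x))"
      by (rule Lp_diff) auto
    also have "\<dots> < \<infinity>" using fin' fg_fin by (simp add: ennreal_mult_less_top)
    finally have Lg: "Lp g < \<infinity>" by simp
    have "energy (\<lambda>x. f' x - (f' x - g x)) \<le> ennreal (2 powr p) * (energy f' + energy (\<lambda>x. f' x - g x))"
      by (rule energy_diff) auto
    also have "\<dots> < \<infinity>" using fin' fg_fin by (simp add: ennreal_mult_less_top)
    finally have Eg: "energy g < \<infinity>" by simp
    obtain \<phi> where \<phi>: "\<phi> \<in> Cc_infinity \<Omega>" "Lp (\<lambda>x. g x - \<phi> x) \<le> ennreal \<eta>" "energy (\<lambda>x. g x - \<phi> x) \<le> ennreal \<eta>"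
      by (rule smooth_approx[OF g Lg Eg g0 \<delta> codim \<eta>])
    note [measurable] = Cc_infinity_measurable[OF \<phi>(1)]
    have const: "ennreal (2 powr p) * (ennreal \<eta> + ennreal \<eta>) = ennreal ((\<epsilon> / 3) powr p)"
    proof -
      have "ennreal (2 powr p) * (ennreal \<eta> + ennreal \<eta>) = ennreal (2 powr p) * ennreal (\<eta> + \<eta>)"
        using \<eta> by (subst ennreal_plus) auto
      also have "\<dots> = ennreal (2 powr p * (\<eta> + \<eta>))" using \<eta> by (intro ennreal_mult[symmetric]) auto
      also have "2 powr p * (\<eta> + \<eta>) = (\<epsilon> / 3) powr p" by (simp add: \<eta>_def)
      finally show ?thesis .
    qed
    have "Lp (\<lambda>x. (f' x - g x) + (g x - \<phi> x)) \<le> ennreal (2 powr p) * (Lp (\<lambda>x. f' x - g x) + Lp (\<lambda>x. g x - \<phi> x))"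
      by (rule Lp_add) auto
    also have "\<dots> \<le> ennreal (2 powr p) * (ennreal \<eta> + ennreal \<eta>)"
      using fg(1) \<phi>(2) by (intro mult_left_mono add_mono) auto
    finally have L: "Lp (\<lambda>x. f' x - \<phi> x) \<le> ennreal ((\<epsilon> / 3) powr p)" unfolding const by simp
    have "energy (\<lambda>x. (f' x - g x) + (g x - \<phi> x)) \<le> ennreal (2 powr p) * (energy (\<lambda>x. f' x - g x) + energy (\<lambda>x. g x - \<phi> x))"
      by (rule energy_add) auto
    also have "\<dots> \<le> ennreal (2 powr p) * (ennreal \<eta> + ennreal \<eta>)"
      using fg(2) \<phi>(3) by (intro mult_left_mono add_mono) auto
    finally have E: "energy (\<lambda>x. f' x - \<phi> x) \<le> ennreal ((\<epsilon> / 3) powr p)" unfolding const by simp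
    have "AE x in lborel. x \<in> \<Omega> \<longrightarrow> f x - \<phi> x = f' x - \<phi> x" using ae by eventually_elim auto
    note eq' = AE_cong_functionals[OF this]
    have small: "sobolev_norm \<Omega> s p \<alpha> \<beta> (\<lambda>x. f x - \<phi> x) < \<epsilon>"
      using L E by (intro sobolev_norm_less \<epsilon>) (auto simp: eq')
    \<comment> \<open>Membership of \<phi> in the space is read off from f' and f' - \<phi> rather
      than from smoothness.\<close>
    have "Lp (\<lambda>x. f' x - (f' x - \<phi> x)) \<le> ennreal (2 powr p) * (Lp f' + Lp (\<lambda>x. f' x - \<phi> x))"
      by (rule Lp_diff) auto
    also have "\<dots> < \<infinity>" using fin' L by (auto simp: ennreal_mult_less_top intro: le_less_trans)
    finally have L\<phi>: "Lp \<phi> < \<infinity>" by simp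
    have "energy (\<lambda>x. f' x - (f' x - \<phi> x)) \<le> ennreal (2 powr p) * (energy f' + energy (\<lambda>x. f' x - \<phi> x))"
      by (rule energy_diff) auto
    also have "\<dots> < \<infinity>" using fin' E by (auto simp: ennreal_mult_less_top intro: le_less_trans)
    finally have E\<phi>: "energy \<phi> < \<infinity>" by simp
    have "\<phi> \<in> borel_measurable (lebesgue_on \<Omega>)"
      by (intro measurable_restrict_space1 measurable_completion) simp
    then have "\<phi> \<in> sobolev \<Omega> s p \<alpha> \<beta>" using L\<phi> E\<phi> by (simp add: sobolev_iff)
    then show ?thesis using \<phi>(1) small by blast
  qed
  then show ?thesis using f by (auto simp: sobolev0_def)
qed

end

theorem theorem4:
  fixes \<Omega> :: "'a::euclidean_space set" and s p \<alpha> \<beta> :: real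
  assumes "\<Omega> \<noteq> {}" and "bounded \<Omega>" and "open \<Omega>" and "uniform_domain \<Omega>"
    and "0 < s" and "s < 1" and "1 \<le> p"
    and "0 \<le> \<alpha>" and "ereal \<alpha> < lower_assouad_codim (frontier \<Omega>)"
    and "0 \<le> \<beta>" and "ereal \<beta> < lower_assouad_codim (frontier \<Omega>)"
    and "ereal (s * p + \<alpha> + \<beta>) > upper_assouad_codim (frontier \<Omega>)"
  shows "sobolev0 \<Omega> s p \<alpha> \<beta> =
    {f \<in> sobolev \<Omega> s p \<alpha> \<beta>.
       (\<integral>\<^sup>+x. ennreal (\<bar>f x\<bar> powr p / bdist \<Omega> x powr (s * p + \<alpha> + \<beta>)) \<partial>lebesgue_on \<Omega>) < \<infinity>}"
proof -
  interpret weighted_domain \<Omega> s p \<alpha> \<beta>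
    using assms by unfold_locales auto
  show ?thesis
    unfolding hardy_eq
    using sobolev0_imp_hardy_finite[OF assms(4,12)] hardy_finite_imp_sobolev0[OF assms(9,11)]
    by (auto simp: sobolev0_def)
qed

end
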